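(* Let $G$ be a locally convex Lie group, let $f\colon M\to N$ be a smooth $G$-equivariant map between (locally convex) $G$-manifolds and let $\mu\in N$. Assume that the stabilizer subgroup $G_\mu$ is a Lie subgroup of $G$ and that the induced action of $G_\mu$ on $M$ is proper. Moreover, assume that $f$ can be brought into an equivariant normal form $(S,\rho,\hat f,f_{\mathrm{sing}})$ at every $m\in f^{-1}(\mu)$ such that the following holds: (i) (submanifold property) The set $$\{(x_1,0)\in S_{(G_m)}: f_{\mathrm{sing}}(x_1,0)=0\}=f_{\mathrm{sing}}^{-1}(0)\cap\mathrm{Ker}\cap S_{(G_m)}$$ is a submanifold of $S_{(G_m)}$. (ii) (approximation property) For every orbit type $(K)\le(G_m)$ of the $G_\mu$-action on $M$, the point $0$ lies in the closure of $f_{\mathrm{sing}}^{-1}(0)\cap\mathrm{Ker}\cap S_{(K)}$ in $S$. Then the partition of $M_\mu=f^{-1}(\mu)$ into the orbit type subsets $M_\mu\cap M_{(H)}$ is a stratification. Moreover, under these assumptions, the decomposition of $\check M_\mu=f^{-1}(\mu)/G_\mu$ into the sets $(M_\mu\cap M_{(H)})/G_\mu$ is a stratification, too.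
   Context: Manifolds are smooth, modeled on locally convex spaces. A subset is a submanifold if around each of its points there is a chart mapping it onto the intersection of the chart image with a closed linear subspace. A $G$-manifold carries a smooth $G$-action. Orbit types refer to the $G_\mu$-action: $(H)$ is the conjugacy class in $G_\mu$ of a stabilizer subgroup $H$, $M_{(H)}$ is the set of points whose $G_\mu$-stabilizer is conjugate in $G_\mu$ to $H$, and $A_{(H)}=A\cap M_{(H)}$ for subsets $A$. $(H)\le(K)$ means some $G_\mu$-conjugate of $H$ is contained in $K$. Stratification of a Hausdorff space $Z$: a partition into subsets $Z_\sigma$ such that (DS1) each $Z_\sigma$ is a locally closed smooth manifold whose manifold topology is the relative topology; (DS2) whenever $Z_\varsigma,Z_\sigma$ are disjoint strata with $Z_\varsigma\cap\overline{Z_\sigma}\neq\emptyset$, then $Z_\varsigma\subseteq\overline{Z_\sigma}\setminus Z_\sigma$ and $Z_\sigma\cap\overline{Z_\varsigma}=\emptyset$. Slice at $m$ for the $G_\mu$-action: a submanifold $S\ni m$ with: (SL1) $G_m\cdot S\subseteq S$; (SL2) if $g\in G_\mu$ and $(g\cdot S)\cap S\ne\emptyset$ then $g\in G_m$; (SL3) $G_m$ is a Lie subgroup for which $G_\mu\to G_\mu/G_m$ is a locally trivial principal bundle, admitting a local section $\chi\colon W\to G_\mu$ on an open neighborhood $W$ of $[e]$ such that $W\times S\to M$, $([g],s)\mapsto\chi([g])\cdot s$ is a diffeomorphism onto an open neighborhood of $m$; (SL4) $S_{(G_m)}$ is a closed submanifold of $S$; (SL5) there are a continuous representation of $G_m$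 on a locally convex space $X$ and a $G_m$-equivariant diffeomorphism $\iota_S$ from a $G_m$-invariant open neighborhood of $0\in X$ onto $S$ with $\iota_S(0)=m$. The tube map is $\chi^T\colon G_\mu\times_{G_m}S\to M$, $[g,s]\mapsto g\cdot s$. Abstract equivariant normal form: a tuple $(H,X,Y,\hat f,f_{\mathrm{sing}})$ with $H$ a compact Lie group; $X,Y$ locally convex spaces with linear $H$-actions and $H$-invariant topological direct sums $X=\mathrm{Ker}\oplus\mathrm{Coim}$, $Y=\mathrm{Coker}\oplus\mathrm{Im}$; $\hat f\colon\mathrm{Coim}\to\mathrm{Im}$ an $H$-equivariant linear topological isomorphism; $f_{\mathrm{sing}}\colon U\to\mathrm{Coker}$ smooth and $H$-equivariant on an $H$-invariant open neighborhood $U$ of $0\in X$ with $f_{\mathrm{sing}}(0,x_2)=0$ for $x_2\in U\cap\mathrm{Coim}$ and $T_0f_{\mathrm{sing}}=0$. Set $f_{\mathrm{NF}}\colon G_\mu\times_HU\to G_\mu\times_HY$, $f_{\mathrm{NF}}([g,x_1,x_2])=[g,\hat f(x_2)+f_{\mathrm{sing}}(x_1,x_2)]$. The map $f$ can be brought into the equivariant normal form $(S,\rho,\hat f,f_{\mathrm{sing}})$ at $m\in f^{-1}(\mu)$ if, with $H=G_m$, there exist a slice $S$ at $m$ for the $G_\mu$-action, a $G_m$-equivariant diffeomorphism $\iota_S\colon X\supseteq U\to S$, and a $G_m$-equivariant chart $\rho\colon N\supseteq V'\to V\subseteq Y$ at $\mu$ (with $\rho(\mu)=0$) with $f(S)\subseteq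 V'$, such that $f\circ\chi^T\circ(\mathrm{id}_{G_\mu}\times\iota_S)=\rho^T\circ f_{\mathrm{NF}}$ on $G_\mu\times_{G_m}U$, where $\rho^T([g,y])=g\cdot\rho^{-1}(y)$. In the claim $S$ is identified via $\iota_S$ with the open subset $U\subseteq X$ (so $m$ corresponds to $0$), and $x_1\in\mathrm{Ker}$. *)

theory Defs
  imports
    "HOL-Analysis.Analysis"
    "HOL-Library.Disjoint_Sets"
    "HOL-Algebra.Group_Action"
    "HOL-Algebra.Left_Coset"
begin

section \<open>Locally convex spaces\<close>

class locally_convex_space = real_vector + topological_ab_group_add + t2_space +
  assumes tendsto_scaleR_nhds: "LIM x (nhds c \<times>\<^sub>F nhds a). fst x *\<^sub>R snd x :> nhds (c *\<^sub>R a)"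
    and locally_convex: "open U \<Longrightarrow> 0 \<in> U \<Longrightarrow>
      \<exists>V. open V \<and> 0 \<in> V \<and> V \<subseteq> U \<and>
        (\<forall>x\<in>V. \<forall>y\<in>V. \<forall>u v. 0 \<le> u \<longrightarrow> 0 \<le> v \<longrightarrow> u + v = 1 \<longrightarrow> u *\<^sub>R x + v *\<^sub>R y \<in> V)"

instance real_normed_vector \<subseteq> locally_convex_space
proof
  fix c :: real and a :: 'a
  show "((\<lambda>x. fst x *\<^sub>R snd x) \<longlongrightarrow> c *\<^sub>R a) (nhds c \<times>\<^sub>F nhds a)"
    by (intro tendsto_scaleR filterlim_fst filterlim_snd)
next
  fix U :: "'a set"
  assume "open U" "0 \<in> U"
  then obtain e where "e > 0" "ball 0 e \<subseteq> U"
    using openE by blast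
  moreover have "\<forall>x\<in>ball 0 e. \<forall>y\<in>ball 0 e. \<forall>u v. 0 \<le> u \<longrightarrow> 0 \<le> v \<longrightarrow> u + v = 1 \<longrightarrow>
      u *\<^sub>R x + v *\<^sub>R y \<in> ball (0::'a) e"
    using convex_ball[of "0::'a" e] unfolding convex_def by blast
  ultimately show "\<exists>V. open V \<and> 0 \<in> V \<and> V \<subseteq> U \<and>
        (\<forall>x\<in>V. \<forall>y\<in>V. \<forall>u v. 0 \<le> u \<longrightarrow> 0 \<le> v \<longrightarrow> u + v = 1 \<longrightarrow> u *\<^sub>R x + v *\<^sub>R y \<in> V)"
    by (intro exI[of _ "ball 0 e"]) auto
qed

lemma tendsto_scaleR_lcs:
  fixes g :: "'a \<Rightarrow> 'b::locally_convex_space"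
  assumes "(f \<longlongrightarrow> c) F" "(g \<longlongrightarrow> a) F"
  shows "((\<lambda>x. f x *\<^sub>R g x) \<longlongrightarrow> c *\<^sub>R a) F"
  using filterlim_compose[OF tendsto_scaleR_nhds, of "\<lambda>x. (f x, g x)" c a F] assms
  by (simp add: nhds_prod[symmetric] tendsto_Pair)

instance prod :: (topological_monoid_add, topological_monoid_add) topological_monoid_add
proof
  fix a b :: "'a \<times> 'b"
  have 1: "(fst \<longlongrightarrow> a) (nhds a \<times>\<^sub>F nhds b)" "(snd \<longlongrightarrow> b) (nhds a \<times>\<^sub>F nhds b)"
    by (rule filterlim_fst filterlim_snd)+
  show "((\<lambda>x. fst x + snd x) \<longlongrightarrow> a + b) (nhds a \<times>\<^sub>F nhds b)"
    unfolding plus_prod_def by (intro tendsto_Pair tendsto_add tendsto_fst tendsto_snd 1)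
qed

instance prod :: (topological_group_add, topological_group_add) topological_group_add
proof
  fix a :: "'a \<times> 'b"
  show "(uminus \<longlongrightarrow> - a) (nhds a)"
    unfolding uminus_prod_def
    by (intro tendsto_Pair tendsto_minus tendsto_fst tendsto_snd filterlim_ident)
qed

instance prod :: (topological_ab_group_add, topological_ab_group_add) topological_ab_group_add ..

instance prod :: (locally_convex_space, locally_convex_space) locally_convex_space
proof
  fix c :: real and a :: "'a \<times> 'b"
  have 1: "(fst \<longlongrightarrow> c) (nhds c \<times>\<^sub>F nhds a)" "(snd \<longlongrightarrow> a) (nhds c \<times>\<^sub>F nhds a)"
    by (rule filterlim_fst filterlim_snd)+
  show "((\<lambda>x. fst x *\<^sub>R snd x) \<longlongrightarrow> c *\<^sub>R a) (nhds c \<times>\<^sub>F nhds a)"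
    unfolding scaleR_prod_def by (intro tendsto_Pair tendsto_scaleR_lcs tendsto_fst tendsto_snd 1)
next
  fix U :: "('a \<times> 'b) set"
  assume "open U" "0 \<in> U"
  then obtain A B where AB: "open A" "open B" "0 \<in> A" "0 \<in> B" "A \<times> B \<subseteq> U"
    unfolding zero_prod_def by (metis mem_Times_iff fst_conv snd_conv open_prod_elim)
  obtain V where V: "open V" "0 \<in> V" "V \<subseteq> A"
    "\<forall>x\<in>V. \<forall>y\<in>V. \<forall>u v. 0 \<le> u \<longrightarrow> 0 \<le> v \<longrightarrow> u + v = 1 \<longrightarrow> u *\<^sub>R x + v *\<^sub>R y \<in> V"
    using locally_convex[OF AB(1,3)] by blast
  obtain W where W: "open W" "0 \<in> W" "W \<subseteq> B"
    "\<forall>x\<in>W. \<forall>y\<in>W. \<forall>u v. 0 \<le> u \<longrightarrow> 0 \<le> v \<longrightarrow> u + v = 1 \<longrightarrow> u *\<^sub>R x + v *\<^sub>R y \<in> W"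
    using locally_convex[OF AB(2,4)] by blast
  have "V \<times> W \<subseteq> U" using V(3) W(3) AB(5) by blast
  moreover have "\<forall>x\<in>V \<times> W. \<forall>y\<in>V \<times> W. \<forall>u v. 0 \<le> u \<longrightarrow> 0 \<le> v \<longrightarrow> u + v = 1 \<longrightarrow>
      u *\<^sub>R x + v *\<^sub>R y \<in> V \<times> W"
    using V(4) W(4) by auto
  ultimately show "\<exists>V. open V \<and> 0 \<in> V \<and> V \<subseteq> U \<and>
        (\<forall>x\<in>V. \<forall>y\<in>V. \<forall>u v. 0 \<le> u \<longrightarrow> 0 \<le> v \<longrightarrow> u + v = 1 \<longrightarrow> u *\<^sub>R x + v *\<^sub>R y \<in> V)"
    using V(1,2) W(1,2) by (intro exI[of _ "V \<times> W"]) (auto simp: open_Times zero_prod_def)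
qed

text \<open>
  Types cannot be quantified inside a formula, but the model space may vary from chart to chart
  and from point to point. Model spaces are therefore closed linear subspaces of a type of class
  locally_convex_space. Nothing is lost: every family of Hausdorff locally convex spaces indexed by
  a set embeds by closed linear embeddings into its product, which is again such a space.
\<close>

definition model_space :: "'e::locally_convex_space set \<Rightarrow> bool" where
  "model_space E \<longleftrightarrow> subspace E \<and> closed E"


section \<open>Smooth maps between locally convex spaces\<close>

text \<open>Smoothness is meant in the sense of Michal and Bastiani: all iterated directional derivatives
  exist and are jointly continuous in the base point and the directions.\<close>

definition dir_deriv ::
    "('e::locally_convex_space \<Rightarrow> 'f::locally_convex_space) \<Rightarrow> 'e \<Rightarrow> 'e \<Rightarrow> 'f" where
  "dir_deriv f x v = Lim (at (0::real)) (\<lambda>t. (1 / t) *\<^sub>R (f (x + t *\<^sub>R v) - f x))"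

definition dir_differentiable ::
    "('e::locally_convex_space \<Rightarrow> 'f::locally_convex_space) \<Rightarrow> 'e \<Rightarrow> 'e \<Rightarrow> bool" where
  "dir_differentiable f x v \<longleftrightarrow>
     (\<exists>l. ((\<lambda>t. (1 / t) *\<^sub>R (f (x + t *\<^sub>R v) - f x)) \<longlongrightarrow> l) (at (0::real)))"

text \<open>The directions of the derivative of order \<open>k\<close> are \<open>v 0, \<dots>, v (k - 1)\<close>; the other values of
  \<open>v\<close> are irrelevant.\<close>

primrec iter_deriv ::
    "('e::locally_convex_space \<Rightarrow> 'f::locally_convex_space) \<Rightarrow> nat \<Rightarrow> (nat \<Rightarrow> 'e) \<Rightarrow> 'e \<Rightarrow> 'f" where
  "iter_deriv f 0 v = f"
| "iter_deriv f (Suc k) v = (\<lambda>x. dir_deriv (iter_deriv f k v) x (v k))"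

text \<open>\<open>U\<close> is meant to be open in the model space \<open>E\<close>.\<close>

definition smooth_on ::
    "'e::locally_convex_space set \<Rightarrow> 'e set \<Rightarrow> ('e \<Rightarrow> 'f::locally_convex_space) \<Rightarrow> bool" where
  "smooth_on E U f \<longleftrightarrow>
     (\<forall>k. (\<forall>x\<in>U. \<forall>v\<in>UNIV \<rightarrow> E. dir_differentiable (iter_deriv f k v) x (v k)) \<and>
          continuous_on (U \<times> (UNIV \<rightarrow> E)) (\<lambda>(x, v). iter_deriv f k v x))"


section \<open>Manifolds\<close>

record ('a, 'e) chart =
  cdom :: "'a set"
  cmap :: "'a \<Rightarrow> 'e"
  cspace :: "'e set"

record ('a, 'e) manifold =
  mtop :: "'a topology"
  matlas :: "('a, 'e) chart set"

definition is_chart :: "'a topology \<Rightarrow> ('a, 'e::locally_convex_space) chart \<Rightarrow> bool" where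
  "is_chart X c \<longleftrightarrow>
     openin X (cdom c) \<and> model_space (cspace c) \<and>
     openin (top_of_set (cspace c)) (cmap c ` cdom c) \<and>
     homeomorphic_map (subtopology X (cdom c)) (top_of_set (cmap c ` cdom c)) (cmap c)"

definition smooth_transition ::
    "('a, 'e::locally_convex_space) chart \<Rightarrow> ('a, 'e) chart \<Rightarrow> bool" where
  "smooth_transition c d \<longleftrightarrow>
     smooth_on (cspace c) (cmap c ` (cdom c \<inter> cdom d)) (cmap d \<circ> inv_into (cdom c) (cmap c))"

definition smooth_manifold :: "('a, 'e::locally_convex_space) manifold \<Rightarrow> bool" where
  "smooth_manifold M \<longleftrightarrow>
     Hausdorff_space (mtop M) \<and>
     (\<forall>c\<in>matlas M. is_chart (mtop M) c) \<and>
     (\<Union>c\<in>matlas M. cdom c) = topspace (mtop M) \<and>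
     (\<forall>c\<in>matlas M. \<forall>d\<in>matlas M. smooth_transition c d)"

definition max_atlas :: "('a, 'e::locally_convex_space) manifold \<Rightarrow> ('a, 'e) chart set" where
  "max_atlas M = {c. is_chart (mtop M) c \<and>
     (\<forall>d\<in>matlas M. smooth_transition c d \<and> smooth_transition d c)}"

definition smooth_map ::
    "('a, 'e::locally_convex_space) manifold \<Rightarrow> ('b, 'f::locally_convex_space) manifold \<Rightarrow>
     ('a \<Rightarrow> 'b) \<Rightarrow> bool" where
  "smooth_map M N f \<longleftrightarrow>
     continuous_map (mtop M) (mtop N) f \<and>
     (\<forall>c\<in>matlas M. \<forall>d\<in>matlas N.
        smooth_on (cspace c) (cmap c ` (cdom c \<inter> f -` cdom d))
          (cmap d \<circ> f \<circ> inv_into (cdom c) (cmap c)))"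

definition diffeomorphism ::
    "('a, 'e::locally_convex_space) manifold \<Rightarrow> ('b, 'f::locally_convex_space) manifold \<Rightarrow>
     ('a \<Rightarrow> 'b) \<Rightarrow> bool" where
  "diffeomorphism M N f \<longleftrightarrow>
     bij_betw f (topspace (mtop M)) (topspace (mtop N)) \<and>
     smooth_map M N f \<and> smooth_map N M (inv_into (topspace (mtop M)) f)"

definition prod_manifold ::
    "('a, 'e::locally_convex_space) manifold \<Rightarrow> ('b, 'f::locally_convex_space) manifold \<Rightarrow>
     ('a \<times> 'b, 'e \<times> 'f) manifold" where
  "prod_manifold M N =
     \<lparr>mtop = prod_topology (mtop M) (mtop N),
      matlas = {\<lparr>cdom = cdom c \<times> cdom d, cmap = map_prod (cmap c) (cmap d),
                 cspace = cspace c \<times> cspace d\<rparr> | c d. c \<in> matlas M \<and> d \<in> matlas N}\<rparr>"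

text \<open>An open subset \<open>U\<close> of the model space \<open>E\<close>, regarded as a manifold.\<close>

definition open_in_model :: "'e::locally_convex_space set \<Rightarrow> 'e set \<Rightarrow> ('e, 'e) manifold" where
  "open_in_model E U =
     \<lparr>mtop = top_of_set U, matlas = {\<lparr>cdom = U, cmap = id, cspace = E\<rparr>}\<rparr>"

definition adapted_chart ::
    "('a, 'e::locally_convex_space) chart \<Rightarrow> 'a set \<Rightarrow> 'e set \<Rightarrow> bool" where
  "adapted_chart c A F \<longleftrightarrow>
     model_space F \<and> F \<subseteq> cspace c \<and> cmap c ` (cdom c \<inter> A) = cmap c ` cdom c \<inter> F"

definition submanifold :: "('a, 'e::locally_convex_space) manifold \<Rightarrow> 'a set \<Rightarrow> bool" where
  "submanifold M A \<longleftrightarrow>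
     A \<subseteq> topspace (mtop M) \<and>
     (\<forall>a\<in>A. \<exists>c\<in>max_atlas M. a \<in> cdom c \<and> (\<exists>F. adapted_chart c A F))"

text \<open>The manifold structure induced on a submanifold; for open \<open>A\<close> it is the usual structure of an
  open subset.\<close>

definition submanifold_of ::
    "('a, 'e::locally_convex_space) manifold \<Rightarrow> 'a set \<Rightarrow> ('a, 'e) manifold" where
  "submanifold_of M A =
     \<lparr>mtop = subtopology (mtop M) A,
      matlas = {\<lparr>cdom = cdom c \<inter> A, cmap = cmap c, cspace = F\<rparr> | c F.
                 c \<in> max_atlas M \<and> adapted_chart c A F}\<rparr>"


section \<open>Lie groups and smooth actions\<close>

definition lie_group :: "'g monoid \<Rightarrow> ('g, 'e::locally_convex_space) manifold \<Rightarrow> bool" where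
  "lie_group G GM \<longleftrightarrow>
     group G \<and> smooth_manifold GM \<and> topspace (mtop GM) = carrier G \<and>
     smooth_map (prod_manifold GM GM) GM (\<lambda>(g, h). g \<otimes>\<^bsub>G\<^esub> h) \<and>
     smooth_map GM GM (\<lambda>g. inv\<^bsub>G\<^esub> g)"

definition lie_subgroup ::
    "'g monoid \<Rightarrow> ('g, 'e::locally_convex_space) manifold \<Rightarrow> 'g set \<Rightarrow> bool" where
  "lie_subgroup G GM H \<longleftrightarrow> subgroup H G \<and> submanifold GM H"

definition smooth_action ::
    "'g monoid \<Rightarrow> ('g, 'eg::locally_convex_space) manifold \<Rightarrow>
     ('m, 'em::locally_convex_space) manifold \<Rightarrow> ('g \<Rightarrow> 'm \<Rightarrow> 'm) \<Rightarrow> bool" where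
  "smooth_action G GM M \<phi> \<longleftrightarrow>
     group_action G (topspace (mtop M)) \<phi> \<and>
     smooth_map (prod_manifold GM M) M (\<lambda>(g, x). \<phi> g x)"

definition proper_action :: "'g topology \<Rightarrow> 'm topology \<Rightarrow> ('g \<Rightarrow> 'm \<Rightarrow> 'm) \<Rightarrow> bool" where
  "proper_action T X \<phi> \<longleftrightarrow>
     proper_map (prod_topology T X) (prod_topology X X) (\<lambda>(g, x). (\<phi> g x, x))"

definition continuous_representation ::
    "'g monoid \<Rightarrow> 'g topology \<Rightarrow> 'x::locally_convex_space set \<Rightarrow> ('g \<Rightarrow> 'x \<Rightarrow> 'x) \<Rightarrow> bool" where
  "continuous_representation H T X r \<longleftrightarrow>
     group_action H X r \<and>
     (\<forall>h\<in>carrier H. \<forall>x\<in>X. \<forall>y\<in>X. \<forall>a b. r h (a *\<^sub>R x + b *\<^sub>R y) = a *\<^sub>R r h x + b *\<^sub>R r h y) \<and>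
     continuous_map (prod_topology T (top_of_set X)) (top_of_set X) (\<lambda>(h, x). r h x)"

text \<open>The stabilizer of a point as a group, and as a Lie group if it is a submanifold.\<close>

definition isotropy_group :: "'g monoid \<Rightarrow> ('g \<Rightarrow> 'm \<Rightarrow> 'm) \<Rightarrow> 'm \<Rightarrow> 'g monoid" where
  "isotropy_group G \<phi> m = G\<lparr>carrier := stabilizer G \<phi> m\<rparr>"

definition isotropy_manifold ::
    "'g monoid \<Rightarrow> ('g, 'e::locally_convex_space) manifold \<Rightarrow> ('g \<Rightarrow> 'm \<Rightarrow> 'm) \<Rightarrow> 'm \<Rightarrow>
     ('g, 'e) manifold" where
  "isotropy_manifold G GM \<phi> m = submanifold_of GM (stabilizer G \<phi> m)"


section \<open>Orbit types\<close>

definition conjugate_set :: "'g monoid \<Rightarrow> 'g \<Rightarrow> 'g set \<Rightarrow> 'g set" where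
  "conjugate_set P g H = g <#\<^bsub>P\<^esub> H #>\<^bsub>P\<^esub> (inv\<^bsub>P\<^esub> g)"

definition orbit_type_le :: "'g monoid \<Rightarrow> 'g set \<Rightarrow> 'g set \<Rightarrow> bool" where
  "orbit_type_le P H K \<longleftrightarrow> (\<exists>g\<in>carrier P. conjugate_set P g H \<subseteq> K)"

text \<open>\<open>orbit_type_subset P \<phi> A H\<close> is the set \<open>A\<^bsub>(H)\<^esub>\<close>.\<close>

definition orbit_type_subset ::
    "'g monoid \<Rightarrow> ('g \<Rightarrow> 'm \<Rightarrow> 'm) \<Rightarrow> 'm set \<Rightarrow> 'g set \<Rightarrow> 'm set" where
  "orbit_type_subset P \<phi> A H =
     {x \<in> A. \<exists>g\<in>carrier P. stabilizer P \<phi> x = conjugate_set P g H}"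

text \<open>The partition of \<open>A\<close> into its nonempty orbit type subsets.\<close>

definition orbit_type_partition ::
    "'g monoid \<Rightarrow> ('g \<Rightarrow> 'm \<Rightarrow> 'm) \<Rightarrow> 'm set \<Rightarrow> 'm set set" where
  "orbit_type_partition P \<phi> A = (\<lambda>x. orbit_type_subset P \<phi> A (stabilizer P \<phi> x)) ` A"


section \<open>Stratifications\<close>

definition quotient_topology :: "'a topology \<Rightarrow> ('a \<Rightarrow> 'b) \<Rightarrow> 'b topology" where
  "quotient_topology X p =
     topology (\<lambda>V. V \<subseteq> p ` topspace X \<and> openin X {x \<in> topspace X. p x \<in> V})"

lemma openin_quotient_topology:
  "openin (quotient_topology X p) V \<longleftrightarrow>
     V \<subseteq> p ` topspace X \<and> openin X {x \<in> topspace X. p x \<in> V}"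
proof -
  have "istopology (\<lambda>V. V \<subseteq> p ` topspace X \<and> openin X {x \<in> topspace X. p x \<in> V})"
    unfolding istopology_def
  proof (intro conjI allI impI)
    fix S T
    assume S: "S \<subseteq> p ` topspace X \<and> openin X {x \<in> topspace X. p x \<in> S}"
      and T: "T \<subseteq> p ` topspace X \<and> openin X {x \<in> topspace X. p x \<in> T}"
    show "S \<inter> T \<subseteq> p ` topspace X" using S by blast
    have "{x \<in> topspace X. p x \<in> S \<inter> T} = {x \<in> topspace X. p x \<in> S} \<inter> {x \<in> topspace X. p x \<in> T}"
      by blast
    with openin_Int[of X "{x \<in> topspace X. p x \<in> S}" "{x \<in> topspace X. p x \<in> T}"] S T
    show "openin X {x \<in> topspace X. p x \<in> S \<inter> T}" by argo
  next
    fix K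
    assume K: "\<forall>V\<in>K. V \<subseteq> p ` topspace X \<and> openin X {x \<in> topspace X. p x \<in> V}"
    show "\<Union>K \<subseteq> p ` topspace X" using K by blast
    have "{x \<in> topspace X. p x \<in> \<Union>K} = (\<Union>V\<in>K. {x \<in> topspace X. p x \<in> V})" by blast
    then show "openin X {x \<in> topspace X. p x \<in> \<Union>K}" using K by auto
  qed
  then show ?thesis unfolding quotient_topology_def by (simp add: topology_inverse')
qed

text \<open>\<open>\<A> \<sigma>\<close> is the atlas of the stratum \<open>\<sigma>\<close>. It is an argument, to be quantified existentially,
  because the type of its model spaces has to occur in the type of the predicate.\<close>

definition stratification ::
    "'z topology \<Rightarrow> 'z set set \<Rightarrow> ('z set \<Rightarrow> ('z, 'e::locally_convex_space) chart set) \<Rightarrow> bool" where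
  "stratification Z \<Sigma> \<A> \<longleftrightarrow>
     Hausdorff_space Z \<and> partition_on (topspace Z) \<Sigma> \<and>
     (\<forall>\<sigma>\<in>\<Sigma>. (\<exists>A B. openin Z A \<and> closedin Z B \<and> \<sigma> = A \<inter> B) \<and>
            smooth_manifold \<lparr>mtop = subtopology Z \<sigma>, matlas = \<A> \<sigma>\<rparr>) \<and>
     (\<forall>\<tau>\<in>\<Sigma>. \<forall>\<sigma>\<in>\<Sigma>. disjnt \<tau> \<sigma> \<and> \<tau> \<inter> (Z closure_of \<sigma>) \<noteq> {} \<longrightarrow>
            \<tau> \<subseteq> (Z closure_of \<sigma>) - \<sigma> \<and> \<sigma> \<inter> (Z closure_of \<tau>) = {})"


section \<open>Slices\<close>

text \<open>\<open>Q\<close> is the base \<open>P / H\<close>. Local triviality makes the projection an open map, so the topology of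
  \<open>Q\<close> is the quotient topology.\<close>

definition principal_bundle ::
    "'g monoid \<Rightarrow> ('g, 'e::locally_convex_space) manifold \<Rightarrow> 'g set \<Rightarrow>
     ('g set, 'q::locally_convex_space) manifold \<Rightarrow> bool" where
  "principal_bundle P PM H Q \<longleftrightarrow>
     smooth_manifold Q \<and> topspace (mtop Q) = lcosets\<^bsub>P\<^esub> H \<and>
     smooth_map PM Q (\<lambda>g. g <#\<^bsub>P\<^esub> H) \<and>
     (\<forall>q\<in>topspace (mtop Q). \<exists>W \<Theta>. openin (mtop Q) W \<and> q \<in> W \<and>
        diffeomorphism (prod_manifold (submanifold_of Q W) (submanifold_of PM H))
          (submanifold_of PM {g \<in> carrier P. g <#\<^bsub>P\<^esub> H \<in> W}) \<Theta> \<and>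
        (\<forall>w\<in>W. \<forall>h\<in>H. \<Theta> (w, h) <#\<^bsub>P\<^esub> H = w \<and>
           (\<forall>k\<in>H. \<Theta> (w, h \<otimes>\<^bsub>P\<^esub> k) = \<Theta> (w, h) \<otimes>\<^bsub>P\<^esub> k)))"

text \<open>\<open>S\<close> is a slice at \<open>m\<close> for the action \<open>\<phi>\<close> of \<open>P\<close> on \<open>M\<close>, with linear model
  \<open>\<iota> : X \<supseteq> U \<rightarrow> S\<close> and linear action \<open>r\<close> on \<open>X\<close>. The base \<open>Q\<close> may be modelled on closed subspaces of
  the type that models \<open>P\<close>: the derivative of a smooth local section identifies the model space of
  \<open>Q\<close> with a complemented subspace of that of \<open>P\<close>.\<close>

definition slice ::
    "'g monoid \<Rightarrow> ('g, 'eg::locally_convex_space) manifold \<Rightarrow>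
     ('m, 'em::locally_convex_space) manifold \<Rightarrow> ('g \<Rightarrow> 'm \<Rightarrow> 'm) \<Rightarrow> 'm \<Rightarrow> 'm set \<Rightarrow>
     'x::locally_convex_space set \<Rightarrow> ('g \<Rightarrow> 'x \<Rightarrow> 'x) \<Rightarrow> 'x set \<Rightarrow> ('x \<Rightarrow> 'm) \<Rightarrow> bool" where
  "slice P PM M \<phi> m S X r U \<iota> \<longleftrightarrow>
     (let H = stabilizer P \<phi> m; SM = submanifold_of M S in
      submanifold M S \<and> m \<in> S \<and>
      (\<forall>h\<in>H. \<phi> h ` S \<subseteq> S) \<and>
      (\<forall>g\<in>carrier P. \<phi> g ` S \<inter> S \<noteq> {} \<longrightarrow> g \<in> H) \<and>
      (lie_subgroup P PM H \<and>
        (\<exists>(Q :: ('g set, 'eg) manifold) W \<kappa> O'.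
           principal_bundle P PM H Q \<and>
           openin (mtop Q) W \<and> H \<in> W \<and>
           smooth_map (submanifold_of Q W) PM \<kappa> \<and> (\<forall>w\<in>W. \<kappa> w <#\<^bsub>P\<^esub> H = w) \<and>
           openin (mtop M) O' \<and> m \<in> O' \<and>
           diffeomorphism (prod_manifold (submanifold_of Q W) SM) (submanifold_of M O')
             (\<lambda>(w, s). \<phi> (\<kappa> w) s))) \<and>
      (closedin (mtop SM) (orbit_type_subset P \<phi> S H) \<and>
        submanifold SM (orbit_type_subset P \<phi> S H)) \<and>
      (model_space X \<and>
        continuous_representation (P\<lparr>carrier := H\<rparr>) (subtopology (mtop PM) H) X r \<and>
        openin (top_of_set X) U \<and> 0 \<in> U \<and> (\<forall>h\<in>H. r h ` U \<subseteq> U) \<and>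
        diffeomorphism (open_in_model X U) SM \<iota> \<and> \<iota> 0 = m \<and>
        (\<forall>h\<in>H. \<forall>x\<in>U. \<iota> (r h x) = \<phi> h (\<iota> x))))"


section \<open>Associated bundles\<close>

text \<open>The class \<open>[g, s]\<close> in \<open>P \<times>\<^bsub>H\<^esub> S\<close> of the \<open>H\<close>-action \<open>h \<cdot> (g, s) = (g h\<^sup>-\<^sup>1, h \<cdot> s)\<close>.\<close>

definition assoc_class ::
    "'g monoid \<Rightarrow> 'g set \<Rightarrow> ('g \<Rightarrow> 's \<Rightarrow> 's) \<Rightarrow> 'g \<Rightarrow> 's \<Rightarrow> ('g \<times> 's) set" where
  "assoc_class P H r g s = {(g \<otimes>\<^bsub>P\<^esub> inv\<^bsub>P\<^esub> h, r h s) | h. h \<in> H}"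

definition assoc_bundle ::
    "'g monoid \<Rightarrow> 'g set \<Rightarrow> ('g \<Rightarrow> 's \<Rightarrow> 's) \<Rightarrow> 's set \<Rightarrow> ('g \<times> 's) set set" where
  "assoc_bundle P H r S = {assoc_class P H r g s | g s. g \<in> carrier P \<and> s \<in> S}"

text \<open>The map \<open>[g, s] \<mapsto> [g, k s]\<close> induced by an \<open>H\<close>-equivariant map \<open>k\<close>: by equivariance, the image
  of the class of \<open>(g, s)\<close> is the class of \<open>(g, k s)\<close>.\<close>

definition assoc_map :: "('s \<Rightarrow> 't) \<Rightarrow> ('g \<times> 's) set \<Rightarrow> ('g \<times> 't) set" where
  "assoc_map k c = map_prod id k ` c"

text \<open>The tube map \<open>[g, s] \<mapsto> g \<cdot> s\<close>, which is constant on each class.\<close>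

definition tube_map :: "('g \<Rightarrow> 'm \<Rightarrow> 'm) \<Rightarrow> ('g \<times> 'm) set \<Rightarrow> 'm" where
  "tube_map \<phi> c = the_elem ((\<lambda>(g, s). \<phi> g s) ` c)"


section \<open>Equivariant normal forms\<close>

definition topological_direct_sum :: "'x::locally_convex_space set \<Rightarrow> 'x set \<Rightarrow> 'x set \<Rightarrow> bool" where
  "topological_direct_sum X A B \<longleftrightarrow>
     model_space A \<and> model_space B \<and>
     homeomorphic_map (top_of_set (A \<times> B)) (top_of_set X) (\<lambda>(a, b). a + b)"

text \<open>The component in \<open>B\<close> of an element of the direct sum of \<open>A\<close> and \<open>B\<close>.\<close>

definition second_component :: "'x::real_vector set \<Rightarrow> 'x set \<Rightarrow> 'x \<Rightarrow> 'x" where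
  "second_component A B x = (THE b. b \<in> B \<and> x - b \<in> A)"

text \<open>The tuple \<open>(H, X, Y, f\<^sub>h\<^sub>a\<^sub>t, f\<^sub>s\<^sub>i\<^sub>n\<^sub>g)\<close> without the group \<open>H\<close>. Pairs \<open>(x\<^sub>1, x\<^sub>2)\<close> in
  \<open>Ker \<oplus> Coim\<close> are written as sums \<open>x\<^sub>1 + x\<^sub>2\<close>.\<close>

record ('g, 'x, 'y) normal_form =
  nfX :: "'x set"
  nfActX :: "'g \<Rightarrow> 'x \<Rightarrow> 'x"
  nfKer :: "'x set"
  nfCoim :: "'x set"
  nfY :: "'y set"
  nfActY :: "'g \<Rightarrow> 'y \<Rightarrow> 'y"
  nfCoker :: "'y set"
  nfIm :: "'y set"
  nfHat :: "'x \<Rightarrow> 'y"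
  nfU :: "'x set"
  nfSing :: "'x \<Rightarrow> 'y"

definition abstract_normal_form ::
    "'g monoid \<Rightarrow> ('g, 'e::locally_convex_space) manifold \<Rightarrow>
     ('g, 'x::locally_convex_space, 'y::locally_convex_space) normal_form \<Rightarrow> bool" where
  "abstract_normal_form H HM A \<longleftrightarrow>
     lie_group H HM \<and> compact_space (mtop HM) \<and>
     model_space (nfX A) \<and> model_space (nfY A) \<and>
     continuous_representation H (mtop HM) (nfX A) (nfActX A) \<and>
     continuous_representation H (mtop HM) (nfY A) (nfActY A) \<and>
     topological_direct_sum (nfX A) (nfKer A) (nfCoim A) \<and>
     topological_direct_sum (nfY A) (nfCoker A) (nfIm A) \<and>
     (\<forall>h\<in>carrier H.
        nfActX A h ` nfKer A \<subseteq> nfKer A \<and> nfActX A h ` nfCoim A \<subseteq> nfCoim A \<and>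
        nfActY A h ` nfCoker A \<subseteq> nfCoker A \<and> nfActY A h ` nfIm A \<subseteq> nfIm A) \<and>
     homeomorphic_map (top_of_set (nfCoim A)) (top_of_set (nfIm A)) (nfHat A) \<and>
     (\<forall>x\<in>nfCoim A. \<forall>y\<in>nfCoim A. \<forall>a b.
        nfHat A (a *\<^sub>R x + b *\<^sub>R y) = a *\<^sub>R nfHat A x + b *\<^sub>R nfHat A y) \<and>
     (\<forall>h\<in>carrier H. \<forall>x\<in>nfCoim A. nfHat A (nfActX A h x) = nfActY A h (nfHat A x)) \<and>
     openin (top_of_set (nfX A)) (nfU A) \<and> 0 \<in> nfU A \<and>
     (\<forall>h\<in>carrier H. nfActX A h ` nfU A \<subseteq> nfU A) \<and>
     nfSing A ` nfU A \<subseteq> nfCoker A \<and> smooth_on (nfX A) (nfU A) (nfSing A) \<and>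
     (\<forall>h\<in>carrier H. \<forall>x\<in>nfU A. nfSing A (nfActX A h x) = nfActY A h (nfSing A x)) \<and>
     (\<forall>x\<in>nfU A \<inter> nfCoim A. nfSing A x = 0) \<and>
     (\<forall>v\<in>nfX A. dir_deriv (nfSing A) 0 v = 0)"

text \<open>The fibre part \<open>(x\<^sub>1, x\<^sub>2) \<mapsto> f\<^sub>h\<^sub>a\<^sub>t x\<^sub>2 + f\<^sub>s\<^sub>i\<^sub>n\<^sub>g (x\<^sub>1, x\<^sub>2)\<close> and the map \<open>f\<^sub>N\<^sub>F\<close> itself.\<close>

definition nf_fibre ::
    "('g, 'x::locally_convex_space, 'y::locally_convex_space) normal_form \<Rightarrow> 'x \<Rightarrow> 'y" where
  "nf_fibre A x = nfHat A (second_component (nfKer A) (nfCoim A) x) + nfSing A x"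

definition nf_map ::
    "('g, 'x::locally_convex_space, 'y::locally_convex_space) normal_form \<Rightarrow>
     ('g \<times> 'x) set \<Rightarrow> ('g \<times> 'y) set" where
  "nf_map A = assoc_map (nf_fibre A)"

text \<open>\<open>f\<close> is brought into the equivariant normal form \<open>A\<close> at \<open>m\<close> by the slice \<open>S\<close>, the map
  \<open>\<iota> : U \<rightarrow> S\<close> and the chart \<open>\<rho> : V' \<rightarrow> V\<close>. Here \<open>P\<close> is the stabilizer of \<open>\<mu>\<close>. The clause
  \<open>nf_fibre A ` nfU A \<subseteq> V\<close> is what makes the right-hand side of the last equation defined.\<close>

definition in_normal_form_at ::
    "'g monoid \<Rightarrow> ('g, 'eg::locally_convex_space) manifold \<Rightarrow>
     ('m, 'em::locally_convex_space) manifold \<Rightarrow> ('g \<Rightarrow> 'm \<Rightarrow> 'm) \<Rightarrow>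
     ('n, 'en::locally_convex_space) manifold \<Rightarrow> ('g \<Rightarrow> 'n \<Rightarrow> 'n) \<Rightarrow> ('m \<Rightarrow> 'n) \<Rightarrow> 'n \<Rightarrow> 'm \<Rightarrow>
     'm set \<Rightarrow> ('x::locally_convex_space \<Rightarrow> 'm) \<Rightarrow> 'n set \<Rightarrow> 'y::locally_convex_space set \<Rightarrow>
     ('n \<Rightarrow> 'y) \<Rightarrow> ('g, 'x, 'y) normal_form \<Rightarrow> bool" where
  "in_normal_form_at P PM M \<phi> N \<psi> f \<mu> m S \<iota> V' V \<rho> A \<longleftrightarrow>
     (let H = stabilizer P \<phi> m in
      abstract_normal_form (isotropy_group P \<phi> m) (isotropy_manifold P PM \<phi> m) A \<and>
      slice P PM M \<phi> m S (nfX A) (nfActX A) (nfU A) \<iota> \<and>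
      openin (mtop N) V' \<and> \<mu> \<in> V' \<and> (\<forall>h\<in>H. \<psi> h ` V' \<subseteq> V') \<and>
      openin (top_of_set (nfY A)) V \<and>
      diffeomorphism (submanifold_of N V') (open_in_model (nfY A) V) \<rho> \<and> \<rho> \<mu> = 0 \<and>
      (\<forall>h\<in>H. \<forall>n\<in>V'. \<rho> (\<psi> h n) = nfActY A h (\<rho> n)) \<and>
      f ` S \<subseteq> V' \<and> nf_fibre A ` nfU A \<subseteq> V \<and>
      (\<forall>c\<in>assoc_bundle P H (nfActX A) (nfU A).
         f (tube_map \<phi> (assoc_map \<iota> c)) =
         tube_map \<psi> (assoc_map (inv_into V' \<rho>) (nf_map A c))))"

text \<open>The set of all \<open>(x\<^sub>1, 0)\<close> with \<open>f\<^sub>s\<^sub>i\<^sub>n\<^sub>g (x\<^sub>1, 0) = 0\<close>, that is, the zeros of \<open>f\<^sub>s\<^sub>i\<^sub>n\<^sub>g\<close> in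
  \<open>U \<inter> Ker\<close>.\<close>

definition sing_zeros ::
    "('g, 'x::locally_convex_space, 'y::locally_convex_space) normal_form \<Rightarrow> 'x set" where
  "sing_zeros A = {x \<in> nfU A \<inter> nfKer A. nfSing A x = 0}"

text \<open>In the next two properties, \<open>S\<close> is identified with \<open>U\<close> by \<open>\<iota>\<close>; the point \<open>0\<close> corresponds
  to \<open>m = \<iota> 0\<close>.\<close>

definition submanifold_property ::
    "'g monoid \<Rightarrow> ('m, 'em::locally_convex_space) manifold \<Rightarrow> ('g \<Rightarrow> 'm \<Rightarrow> 'm) \<Rightarrow> 'm \<Rightarrow> 'm set \<Rightarrow>
     ('x \<Rightarrow> 'm) \<Rightarrow> ('g, 'x::locally_convex_space, 'y::locally_convex_space) normal_form \<Rightarrow> bool" where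
  "submanifold_property P M \<phi> m S \<iota> A \<longleftrightarrow>
     (let S\<^sub>H = orbit_type_subset P \<phi> S (stabilizer P \<phi> m) in
      submanifold (submanifold_of (submanifold_of M S) S\<^sub>H) (\<iota> ` sing_zeros A \<inter> S\<^sub>H))"

definition approximation_property ::
    "'g monoid \<Rightarrow> ('m, 'em::locally_convex_space) manifold \<Rightarrow> ('g \<Rightarrow> 'm \<Rightarrow> 'm) \<Rightarrow> 'm \<Rightarrow> 'm set \<Rightarrow>
     ('x \<Rightarrow> 'm) \<Rightarrow> ('g, 'x::locally_convex_space, 'y::locally_convex_space) normal_form \<Rightarrow> bool" where
  "approximation_property P M \<phi> m S \<iota> A \<longleftrightarrow>
     (\<forall>K \<in> stabilizer P \<phi> ` topspace (mtop M). orbit_type_le P K (stabilizer P \<phi> m) \<longrightarrow>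
        m \<in> subtopology (mtop M) S closure_of (\<iota> ` sing_zeros A \<inter> orbit_type_subset P \<phi> S K))"

definition level_set :: "('m, 'e::locally_convex_space) manifold \<Rightarrow> ('m \<Rightarrow> 'n) \<Rightarrow> 'n \<Rightarrow> 'm set" where
  "level_set M f \<mu> = {x \<in> topspace (mtop M). f x = \<mu>}"

end

theory Submission
  imports Defs "HOL-Homology.Invariance_of_Domain"
begin

text \<open>
  In a normal form at \<open>m\<close>, the level set meets the slice \<open>S\<close> exactly in the zeros of the singular
  part on the kernel. The tube around \<open>m\<close> is diffeomorphic to \<open>W \<times> S\<close>, where \<open>W\<close> is open in
  \<open>P / P\<^sub>m\<close> for the stabilizer \<open>P\<close> of \<open>\<mu>\<close>, so there the stratum of \<open>m\<close> is \<open>W \<times> L\<^sub>H\<close>, where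
  \<open>L\<^sub>H\<close> is the part of \<open>S\<close> in the level set with the orbit type of \<open>m\<close>, a submanifold by the
  submanifold property.

  If a stratum \<open>\<tau>\<close> meets the closure of \<open>\<sigma>\<close>, the tube at a common point shows that the orbit type of
  \<open>\<sigma>\<close> is below that of \<open>\<tau>\<close>, and the approximation property gives \<open>\<tau> \<subseteq> closure \<sigma>\<close>. If \<open>\<sigma>\<close> also met
  the closure of \<open>\<tau>\<close>, then \<open>\<sigma> \<subseteq> closure \<tau>\<close>, and since \<open>\<tau>\<close> is locally closed the two would intersect.

  In the quotient, \<open>L\<^sub>H\<close> itself is a chart domain, because the stabilizer \<open>H\<close> of \<open>m\<close> fixes it
  pointwise. This needs that no proper subgroup of \<open>H\<close> is conjugate to \<open>H\<close>: as \<open>H\<close> is a compact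
  manifold, its model space is finite-dimensional, so by invariance of domain an injective continuous
  endomorphism of \<open>H\<close> is open, and compactness makes it surjective. The quotient is Hausdorff because
  the action is proper.
\<close>


section \<open>Smooth maps between locally convex spaces\<close>

text \<open>The model spaces need be neither normed nor complete, so operator norms and integrals
  are not at hand. The one analytic tool is a mean value statement for convex open sets, proved by
  bisection; strict differentiability, linearity in the directions and the chain rule all come from
  it. A chart of a stratum passes through a slice, its orbit type part, the tube diffeomorphism and,
  in the quotient, a choice of representatives. Comparing two such charts directly would pile up
  inverses of restricted charts. Testing smoothness on maps out of open sets of model spaces
  (\<open>smooth_into\<close>) turns every comparison into a composition. A stratum is locally a
  product of a piece of \<open>P / H\<close> with a submanifold of the slice, whence the type
  \<open>'eg \<times> 'em\<close> of its model spaces; dividing by the group removes the first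
  factor and leaves \<open>'em\<close>.\<close>

lemma tendsto_coordinatewise:
  fixes w :: "'i \<Rightarrow> 'a \<Rightarrow> 'b::topological_space"
  assumes "\<And>i. ((\<lambda>t. w t i) \<longlongrightarrow> l i) F"
  shows "(w \<longlongrightarrow> l) F"
proof -
  have "limitin (product_topology (\<lambda>_. euclidean) UNIV) w l F"
    using assms by (simp add: limitin_componentwise limitin_canonical_iff)
  then show ?thesis
    by (simp add: euclidean_product_topology limitin_canonical_iff)
qed

lemma tendsto_coordinate:
  fixes w :: "'i \<Rightarrow> 'a \<Rightarrow> 'b::topological_space"
  assumes "(w \<longlongrightarrow> l) F"
  shows "((\<lambda>t. w t i) \<longlongrightarrow> l i) F"
proof -
  have "continuous_on UNIV (\<lambda>x::'a \<Rightarrow> 'b. x i)"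
    by (rule continuous_on_product_coordinates)
  from continuous_on_tendsto_compose[OF this assms] show ?thesis by simp
qed

lemma continuous_on_scaleR_lcs [continuous_intros]:
  fixes g :: "'a::topological_space \<Rightarrow> 'b::locally_convex_space"
  shows "continuous_on S f \<Longrightarrow> continuous_on S g \<Longrightarrow> continuous_on S (\<lambda>x. f x *\<^sub>R g x)"
  by (simp add: continuous_on_def tendsto_scaleR_lcs)

lemma continuous_on_plus_lcs [continuous_intros]:
  fixes f g :: "'a::topological_space \<Rightarrow> 'b::locally_convex_space"
  shows "continuous_on S f \<Longrightarrow> continuous_on S g \<Longrightarrow> continuous_on S (\<lambda>x. f x + g x)"
  by (simp add: continuous_on_def tendsto_add)

lemma continuous_on_diff_lcs:
  fixes f g :: "'a::topological_space \<Rightarrow> 'b::locally_convex_space"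
  shows "continuous_on S f \<Longrightarrow> continuous_on S g \<Longrightarrow> continuous_on S (\<lambda>x. f x - g x)"
  by (simp add: continuous_on_def tendsto_diff)

text \<open>Local convexity is given at 0 only; a convex neighbourhood of 0 is translated to
  \<open>l\<close>.\<close>

lemma convex_nbhd:
  fixes l :: "'e::locally_convex_space"
  assumes "open S" "l \<in> S"
  obtains C where "open C" "convex C" "l \<in> C" "C \<subseteq> S"
proof -
  have "continuous_on UNIV (\<lambda>x. l + x)"
    by (intro continuous_on_plus_lcs continuous_on_const continuous_on_id)
  then have "open ((\<lambda>x. l + x) -` S)" "0 \<in> (\<lambda>x. l + x) -` S"
    using assms open_vimage by auto
  from locally_convex[OF this] obtain V where V: "open V" "0 \<in> V" "V \<subseteq> (\<lambda>x. l + x) -` S"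
    "\<forall>x\<in>V. \<forall>y\<in>V. \<forall>u v. 0 \<le> u \<longrightarrow> 0 \<le> v \<longrightarrow> u + v = 1 \<longrightarrow> u *\<^sub>R x + v *\<^sub>R y \<in> V"
    by auto
  have cV: "convex V"
    using V(4) unfolding convex_def by blast
  define C where "C = (\<lambda>x. x - l) -` V"
  have "open C" unfolding C_def
    by (intro open_vimage V(1) continuous_on_diff_lcs continuous_on_const continuous_on_id)
  moreover have "C = (+) l ` V" unfolding C_def by (auto simp: image_iff algebra_simps intro!: bexI[of _ "_ - l"])
  then have "convex C" using cV convex_translation by auto
  moreover have "l \<in> C" using V(2) by (simp add: C_def)
  moreover have "C \<subseteq> S"
  proof
    fix x assume "x \<in> C"
    then have "l + (x - l) \<in> S" using V(3) by (auto simp: C_def)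
    then show "x \<in> S" by simp
  qed
  ultimately show ?thesis using that by blast
qed

section \<open>Directional derivatives and the mean value statement\<close>

definition has_dir_deriv ::
    "('e::locally_convex_space \<Rightarrow> 'f::locally_convex_space) \<Rightarrow> 'e \<Rightarrow> 'e \<Rightarrow> 'f \<Rightarrow> bool" where
  "has_dir_deriv f x v l \<longleftrightarrow> ((\<lambda>t. (1 / t) *\<^sub>R (f (x + t *\<^sub>R v) - f x)) \<longlongrightarrow> l) (at (0::real))"

lemma has_dir_deriv_dir_deriv: "has_dir_deriv f x v l \<Longrightarrow> dir_deriv f x v = l"
  unfolding has_dir_deriv_def dir_deriv_def by (rule tendsto_Lim) auto

lemma has_dir_deriv_unique: "has_dir_deriv f x v l \<Longrightarrow> has_dir_deriv f x v l' \<Longrightarrow> l = l'"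
  using has_dir_deriv_dir_deriv by blast

lemma dir_differentiable_iff:
  "dir_differentiable f x v \<longleftrightarrow> has_dir_deriv f x v (dir_deriv f x v)"
proof
  assume "dir_differentiable f x v"
  then obtain l where "has_dir_deriv f x v l" unfolding dir_differentiable_def has_dir_deriv_def by blast
  then show "has_dir_deriv f x v (dir_deriv f x v)" using has_dir_deriv_dir_deriv[of f x v l] by simp
qed (auto simp: dir_differentiable_def has_dir_deriv_def)

lemma eventually_in_openin:
  assumes "openin (top_of_set E) U" "(y \<longlongrightarrow> x) F" "x \<in> U" "eventually (\<lambda>i. y i \<in> E) F"
  shows "eventually (\<lambda>i. y i \<in> U) F"
proof -
  obtain T where T: "open T" "U = E \<inter> T" using assms(1) by (auto simp: openin_open)
  then have "eventually (\<lambda>i. y i \<in> T) F"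
    using assms(2,3) topological_tendstoD by blast
  with assms(4) show ?thesis by eventually_elim (simp add: T)
qed

lemma tendsto_ray:
  fixes x v :: "'e::locally_convex_space"
  shows "((\<lambda>t. x + t *\<^sub>R v) \<longlongrightarrow> x) (at (0::real))"
proof -
  have "((\<lambda>t. x + t *\<^sub>R v) \<longlongrightarrow> x + 0 *\<^sub>R v) (at (0::real))"
    by (intro tendsto_add tendsto_const tendsto_scaleR_lcs tendsto_ident_at)
  then show ?thesis by simp
qed

lemma subspace_ray: "subspace E \<Longrightarrow> x \<in> E \<Longrightarrow> v \<in> E \<Longrightarrow> x + t *\<^sub>R v \<in> E"
  by (simp add: subspace_add subspace_scale)

lemma eventually_ray:
  assumes "model_space E" "openin (top_of_set E) U" "x \<in> U" "v \<in> E"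
  shows "eventually (\<lambda>t. x + t *\<^sub>R v \<in> U) (at (0::real))"
  using assms openin_imp_subset[OF assms(2)]
  by (intro eventually_in_openin[OF assms(2) tendsto_ray]) (auto simp: model_space_def subspace_ray)

lemma has_dir_deriv_cong:
  assumes "model_space E" "openin (top_of_set E) U" "x \<in> U" "v \<in> E"
    and "\<And>y. y \<in> U \<Longrightarrow> f y = g y" and "has_dir_deriv g x v l"
  shows "has_dir_deriv f x v l"
  unfolding has_dir_deriv_def
proof (rule Lim_transform_eventually[OF assms(6)[unfolded has_dir_deriv_def]])
  show "\<forall>\<^sub>F t in at 0. (1 / t) *\<^sub>R (g (x + t *\<^sub>R v) - g x) = (1 / t) *\<^sub>R (f (x + t *\<^sub>R v) - f x)"
    using eventually_ray[OF assms(1-4)] by eventually_elim (simp add: assms(3,5))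
qed

text \<open>The difference quotient over an interval is a convex combination of those over its two
  parts, so membership in \<open>C\<close> is additive over intervals. Bisection reduces the claim
  to short intervals around each \<open>s\<close>, where the quotients over \<open>[a, s]\<close>
  and \<open>[s, b]\<close> are close to \<open>\<gamma>' s\<close> and hence in the open set
  \<open>C\<close>.\<close>

lemma mean_value_convex:
  fixes \<gamma> :: "real \<Rightarrow> 'f::locally_convex_space"
  assumes "a < b" and der: "\<And>s. a \<le> s \<Longrightarrow> s \<le> b \<Longrightarrow> has_dir_deriv \<gamma> s 1 (\<gamma>' s)"
    and C: "\<And>s. a \<le> s \<Longrightarrow> s \<le> b \<Longrightarrow> \<gamma>' s \<in> C" "open C" "convex C"
  shows "(1 / (b - a)) *\<^sub>R (\<gamma> b - \<gamma> a) \<in> C"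
proof -
  let ?q = "\<lambda>a b. (1 / (b - a)) *\<^sub>R (\<gamma> b - \<gamma> a)"
  have comb: "?q a c \<in> C" if "?q a b \<in> C" "?q b c \<in> C" "a < b" "b < c" for a b c
  proof -
    have "((b - a) / (c - a)) *\<^sub>R ?q a b + ((c - b) / (c - a)) *\<^sub>R ?q b c \<in> C"
      using that C(3) by (intro convexD) (auto simp: add_divide_distrib[symmetric])
    moreover have "((b - a) / (c - a)) *\<^sub>R ?q a b + ((c - b) / (c - a)) *\<^sub>R ?q b c = ?q a c"
    proof -
      have "((b - a) / (c - a)) *\<^sub>R ?q a b = (1 / (c - a)) *\<^sub>R (\<gamma> b - \<gamma> a)"
           "((c - b) / (c - a)) *\<^sub>R ?q b c = (1 / (c - a)) *\<^sub>R (\<gamma> c - \<gamma> b)"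
        using that by (auto simp: field_simps)
      then show ?thesis by (simp add: scaleR_add_right[symmetric])
    qed
    ultimately show ?thesis by simp
  qed
  have "a < b \<longrightarrow> ?q a b \<in> C"
  proof (rule Bolzano[where P = "\<lambda>a b. a < b \<longrightarrow> ?q a b \<in> C"])
    show "a \<le> b" using assms(1) by simp
  next
    fix a b c assume h: "a < b \<longrightarrow> ?q a b \<in> C" "b < c \<longrightarrow> ?q b c \<in> C" "a \<le> b" "b \<le> c"
    show "a < c \<longrightarrow> ?q a c \<in> C"
      using h comb[where a = a and b = b and c = c] by (metis order_le_less)
  next
    fix s assume s: "a \<le> s" "s \<le> b"
    have "eventually (\<lambda>t. (1 / t) *\<^sub>R (\<gamma> (s + t *\<^sub>R 1) - \<gamma> s) \<in> C) (at 0)"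
      using topological_tendstoD[OF der[OF s, unfolded has_dir_deriv_def] C(2) C(1)[OF s]] .
    then obtain d where d: "d > 0" "\<And>t. t \<noteq> 0 \<Longrightarrow> \<bar>t\<bar> < d \<Longrightarrow> (1 / t) *\<^sub>R (\<gamma> (s + t) - \<gamma> s) \<in> C"
      unfolding eventually_at by (auto simp: dist_real_def)
    have l: "?q a s \<in> C" if "a < s" "s - a < d" for a
    proof -
      have "?q a s = (1 / (a - s)) *\<^sub>R (\<gamma> a - \<gamma> s)"
      proof -
        have e: "1 / (s - a) = - (1 / (a - s))" using that by (simp add: field_simps)
        show ?thesis by (simp only: e scaleR_minus_left scaleR_minus_right[symmetric] minus_diff_eq)
      qed
      then show ?thesis using d(2)[of "a - s"] that by simp
    qed
    have r: "?q s b \<in> C" if "s < b" "b - s < d" for b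
      using d(2)[of "b - s"] that by simp
    show "\<exists>d>0. \<forall>a b. a \<le> s \<and> s \<le> b \<and> b - a < d \<longrightarrow> a < b \<longrightarrow> ?q a b \<in> C"
    proof (intro exI[of _ d] conjI allI impI d(1))
      fix a b assume h: "a \<le> s \<and> s \<le> b \<and> b - a < d" "a < b"
      show "?q a b \<in> C"
        using h l[of a] r[of b] comb[where a = a and b = s and c = b] by (smt (verit))
    qed
  qed
  then show ?thesis using assms(1) by simp
qed

text \<open>Strict differentiability: base point, direction and step vary together. By joint
  continuity all derivatives along the segment from \<open>y i\<close> to
  \<open>y i + t i *\<^sub>R z i\<close> lie in one convex neighbourhood of \<open>dh y0 z0\<close>,
  and the mean value statement puts the quotient there too. The moving direction serves the chain
  rule, the moving base point serves additivity.\<close>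

lemma c1_strict:
  fixes h :: "'e::locally_convex_space \<Rightarrow> 'f::locally_convex_space"
  assumes E: "model_space E" and V: "openin (top_of_set E) V"
    and der: "\<And>y z. y \<in> V \<Longrightarrow> z \<in> E \<Longrightarrow> has_dir_deriv h y z (dh y z)"
    and cont: "continuous_on (V \<times> E) (\<lambda>(y, z). dh y z)"
    and y: "(y \<longlongrightarrow> y0) F" "y0 \<in> V" "eventually (\<lambda>i. y i \<in> E) F"
    and z: "(z \<longlongrightarrow> z0) F" "z0 \<in> E" "eventually (\<lambda>i. z i \<in> E) F"
    and t: "(t \<longlongrightarrow> 0) F" "eventually (\<lambda>i. t i \<noteq> (0::real)) F"
  shows "((\<lambda>i. (1 / t i) *\<^sub>R (h (y i + t i *\<^sub>R z i) - h (y i))) \<longlongrightarrow> dh y0 z0) F"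
proof (rule topological_tendstoI)
  fix S assume "open S" "dh y0 z0 \<in> S"
  then obtain C where C: "open C" "convex C" "dh y0 z0 \<in> C" "C \<subseteq> S"
    using convex_nbhd by metis
  obtain OV where OV: "open OV" "V = E \<inter> OV" using V by (auto simp: openin_open)
  obtain A where A: "open A" "A \<inter> (V \<times> E) = (\<lambda>(y, z). dh y z) -` C \<inter> (V \<times> E)"
    using cont C(1) unfolding continuous_on_open_invariant by metis
  \<comment> \<open>\<open>k\<close> sends a triple (y, s, z) to (y + s z, z). Openness of a
    preimage under \<open>k\<close> at (y0, 0, z0) yields one bound \<open>d\<close> that works
    along whole segments.\<close>
  define k where "k = (\<lambda>p::'e \<times> real \<times> 'e. (fst p + fst (snd p) *\<^sub>R snd (snd p), snd (snd p)))"
  have "continuous_on UNIV k" unfolding k_def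
    by (intro continuous_intros)
  moreover have "open (A \<inter> (OV \<times> UNIV))" using A(1) OV(1) by (simp add: open_Int open_Times)
  ultimately have ok: "open (k -` (A \<inter> (OV \<times> UNIV)))" by (rule open_vimage[rotated])
  have "(y0, z0) \<in> A" using A(2) C(3) y(2) z(2) by auto
  then have "(y0, 0, z0) \<in> k -` (A \<inter> (OV \<times> UNIV))" using y(2) OV(2) by (simp add: k_def)
  from open_prod_elim[OF ok this] obtain R1 Q where R1: "open R1" "open Q" "(y0, 0, z0) \<in> R1 \<times> Q"
    "R1 \<times> Q \<subseteq> k -` (A \<inter> (OV \<times> UNIV))" by blast
  from R1(3) have "(0, z0) \<in> Q" by simp
  from open_prod_elim[OF R1(2) this] obtain R2 R3 where R2: "open R2" "open R3" "0 \<in> R2" "z0 \<in> R3"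
    "R2 \<times> R3 \<subseteq> Q" by (metis mem_Sigma_iff)
  obtain d where d: "d > 0" "ball 0 d \<subseteq> R2" using R2(1,3) openE by blast
  have "eventually (\<lambda>i. y i \<in> R1) F" "eventually (\<lambda>i. z i \<in> R3) F" "eventually (\<lambda>i. t i \<in> ball 0 d) F"
    using topological_tendstoD[OF y(1) R1(1)] topological_tendstoD[OF z(1) R2(2)]
      topological_tendstoD[OF t(1), of "ball 0 d"] R1(3) R2(4) d(1) by auto
  then show "\<forall>\<^sub>F i in F. (1 / t i) *\<^sub>R (h (y i + t i *\<^sub>R z i) - h (y i)) \<in> S"
    using y(3) z(3) t(2)
  proof eventually_elim
    case (elim i)
    define \<gamma> where "\<gamma> = (\<lambda>s::real. h (y i + s *\<^sub>R z i))"
    have in1: "y i + s *\<^sub>R z i \<in> V" "dh (y i + s *\<^sub>R z i) (z i) \<in> C" if "\<bar>s\<bar> < d" for s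
    proof -
      have "s \<in> R2" using d(2) that by (auto simp: dist_real_def)
      then have "k (y i, s, z i) \<in> A \<inter> (OV \<times> UNIV)"
        using R1(4) R2(5) elim by blast
      then have 1: "(y i + s *\<^sub>R z i, z i) \<in> A" "y i + s *\<^sub>R z i \<in> OV" by (auto simp: k_def)
      then show 2: "y i + s *\<^sub>R z i \<in> V"
        using elim E OV(2) by (auto simp: model_space_def subspace_ray)
      have "(y i + s *\<^sub>R z i, z i) \<in> A \<inter> (V \<times> E)" using 1 2 elim by simp
      then show "dh (y i + s *\<^sub>R z i) (z i) \<in> C" unfolding A(2) by simp
    qed
    have der1: "has_dir_deriv \<gamma> s 1 (dh (y i + s *\<^sub>R z i) (z i))" if "\<bar>s\<bar> < d" for s
      using der[OF in1(1)[OF that], of "z i"] elim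
      unfolding has_dir_deriv_def \<gamma>_def by (simp add: algebra_simps)
    have "(1 / t i) *\<^sub>R (\<gamma> (t i) - \<gamma> 0) \<in> C"
    proof (cases "t i > 0")
      case True
      have "(1 / (t i - 0)) *\<^sub>R (\<gamma> (t i) - \<gamma> 0) \<in> C"
        by (rule mean_value_convex[OF True der1 in1(2) C(1,2)]) (use elim True in auto)
      then show ?thesis by simp
    next
      case False
      then have neg: "t i < 0" using elim by simp
      have "(1 / (0 - t i)) *\<^sub>R (\<gamma> 0 - \<gamma> (t i)) \<in> C"
        by (rule mean_value_convex[OF neg der1 in1(2) C(1,2)]) (use elim neg in auto)
      then show ?thesis
        by (simp add: algebra_simps)
    qed
    then show ?case using C(4) by (auto simp: \<gamma>_def)
  qed
qed

lemma has_dir_deriv_in_closed: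
  assumes "model_space F" "model_space E" "openin (top_of_set E) U" "x \<in> U" "v \<in> E"
    "\<And>y. y \<in> U \<Longrightarrow> f y \<in> F" "has_dir_deriv f x v l"
  shows "l \<in> F"
proof (rule Lim_in_closed_set)
  show "closed F" using assms by (simp add: model_space_def)
  show "((\<lambda>t. (1 / t) *\<^sub>R (f (x + t *\<^sub>R v) - f x)) \<longlongrightarrow> l) (at (0::real))"
    using assms by (simp add: has_dir_deriv_def)
  show "\<forall>\<^sub>F t in at 0. (1 / t) *\<^sub>R (f (x + t *\<^sub>R v) - f x) \<in> F"
    using eventually_ray[OF assms(2-5)]
    by eventually_elim (use assms in \<open>auto simp: model_space_def subspace_scale subspace_diff\<close>)
qed simp

section \<open>First derivatives along curves and linearity in the direction\<close>

definition curve_deriv :: "(real \<Rightarrow> 'e::locally_convex_space) \<Rightarrow> 'e \<Rightarrow> bool" where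
  "curve_deriv c l \<longleftrightarrow> ((\<lambda>t. (1 / t) *\<^sub>R (c t - c 0)) \<longlongrightarrow> l) (at (0::real))"

lemma curve_deriv_ray: "has_dir_deriv f x v l \<longleftrightarrow> curve_deriv (\<lambda>t. f (x + t *\<^sub>R v)) l"
  by (simp add: has_dir_deriv_def curve_deriv_def)

lemma curve_deriv_tendsto:
  fixes c :: "real \<Rightarrow> 'e::locally_convex_space"
  assumes "curve_deriv c l"
  shows "(c \<longlongrightarrow> c 0) (at 0)"
proof -
  have "((\<lambda>t. c 0 + t *\<^sub>R ((1 / t) *\<^sub>R (c t - c 0))) \<longlongrightarrow> c 0 + 0 *\<^sub>R l) (at 0)"
    using assms unfolding curve_deriv_def
    by (intro tendsto_add tendsto_const tendsto_scaleR_lcs tendsto_ident_at)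
  then have "((\<lambda>t. c 0 + t *\<^sub>R ((1 / t) *\<^sub>R (c t - c 0))) \<longlongrightarrow> c 0) (at 0)" by simp
  then show ?thesis
    by (rule Lim_transform_eventually) (auto simp: eventually_at intro!: exI[of _ 1])
qed

text \<open>A curve has the form \<open>c 0 + t q(t)\<close>, where its difference quotient
  \<open>q(t)\<close> merely converges to \<open>l\<close>. Differentiability of \<open>h\<close> in
  one fixed direction would not suffice; strict differentiability allows the direction to
  move.\<close>

lemma c1_curve:
  fixes h :: "'e::locally_convex_space \<Rightarrow> 'f::locally_convex_space"
  assumes E: "model_space E" and V: "openin (top_of_set E) V"
    and der: "\<And>y z. y \<in> V \<Longrightarrow> z \<in> E \<Longrightarrow> has_dir_deriv h y z (dh y z)"
    and cont: "continuous_on (V \<times> E) (\<lambda>(y, z). dh y z)"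
    and c: "curve_deriv c l" "c 0 \<in> V" "eventually (\<lambda>t. c t \<in> E) (at 0)" "l \<in> E"
  shows "curve_deriv (\<lambda>t. h (c t)) (dh (c 0) l)"
proof -
  have cE: "c 0 \<in> E" using V c(2) openin_imp_subset by blast
  have "((\<lambda>t. (1 / t) *\<^sub>R (h (c 0 + t *\<^sub>R ((1 / t) *\<^sub>R (c t - c 0))) - h (c 0))) \<longlongrightarrow> dh (c 0) l) (at 0)"
  proof (rule c1_strict[OF E V der cont])
    show "\<forall>\<^sub>F t in at 0. (1 / t) *\<^sub>R (c t - c 0) \<in> E"
      using c(3) by eventually_elim (use E cE in \<open>auto simp: model_space_def subspace_scale subspace_diff\<close>)
  qed (use c cE in \<open>auto simp: curve_deriv_def eventually_at intro!: exI[of _ 1]\<close>)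
  then show ?thesis unfolding curve_deriv_def
    by (rule Lim_transform_eventually) (auto simp: eventually_at intro!: exI[of _ 1])
qed

text \<open>Homogeneity comes from rescaling the step. For additivity the increment along
  \<open>a + b\<close> is split at \<open>y + t *\<^sub>R a\<close>: the second half starts at a
  moving base point, so its limit is taken by \<open>c1_strict\<close>.\<close>

lemma c1_linear:
  fixes h :: "'e::locally_convex_space \<Rightarrow> 'f::locally_convex_space"
  assumes E: "model_space E" and V: "openin (top_of_set E) V"
    and der: "\<And>y z. y \<in> V \<Longrightarrow> z \<in> E \<Longrightarrow> has_dir_deriv h y z (dh y z)"
    and cont: "continuous_on (V \<times> E) (\<lambda>(y, z). dh y z)"
    and y: "y \<in> V" and z: "z1 \<in> E" "z2 \<in> E"
  shows "dh y (p *\<^sub>R z1 + q *\<^sub>R z2) = p *\<^sub>R dh y z1 + q *\<^sub>R dh y z2"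
proof -
  have sE: "subspace E" using E by (simp add: model_space_def)
  have yE: "y \<in> E" using V y openin_imp_subset by blast
  have zE: "p *\<^sub>R z1 + q *\<^sub>R z2 \<in> E" for p q using z sE by (simp add: subspace_add subspace_scale)
  have hom: "dh y (p *\<^sub>R z) = p *\<^sub>R dh y z" if "z \<in> E" for p z
  proof (cases "p = 0")
    case True
    have "has_dir_deriv h y 0 0" by (simp add: has_dir_deriv_def)
    then show ?thesis using True has_dir_deriv_unique[OF der[OF y subspace_0[OF sE]]] by simp
  next
    case False
    have "filterlim (\<lambda>t. t * p) (at 0) (at 0)"
      using False by (auto simp: filterlim_at eventually_at intro!: tendsto_eq_intros exI[of _ 1])
    then have "((\<lambda>t. (1 / (t * p)) *\<^sub>R (h (y + (t * p) *\<^sub>R z) - h y)) \<longlongrightarrow> dh y z) (at 0)"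
      using der[OF y that] unfolding has_dir_deriv_def by (rule filterlim_compose[rotated])
    then have "((\<lambda>t. p *\<^sub>R ((1 / (t * p)) *\<^sub>R (h (y + (t * p) *\<^sub>R z) - h y))) \<longlongrightarrow> p *\<^sub>R dh y z) (at 0)"
      by (intro tendsto_scaleR_lcs tendsto_const)
    then have "has_dir_deriv h y (p *\<^sub>R z) (p *\<^sub>R dh y z)"
      unfolding has_dir_deriv_def using False by simp
    moreover have "has_dir_deriv h y (p *\<^sub>R z) (dh y (p *\<^sub>R z))"
      using der[OF y] sE that by (simp add: subspace_scale)
    ultimately show ?thesis using has_dir_deriv_unique by blast
  qed
  have add: "dh y (a + b) = dh y a + dh y b" if a: "a \<in> E" and b: "b \<in> E" for a b
  proof -
    have "((\<lambda>t. (1 / t) *\<^sub>R (h ((y + t *\<^sub>R a) + t *\<^sub>R b) - h (y + t *\<^sub>R a))) \<longlongrightarrow> dh y b) (at 0)"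
      using sE yE a b
      by (intro c1_strict[OF E V der cont])
         (auto simp: y subspace_ray tendsto_ray eventually_at intro!: exI[of _ 1])
    moreover have "((\<lambda>t. (1 / t) *\<^sub>R (h (y + t *\<^sub>R a) - h y)) \<longlongrightarrow> dh y a) (at 0)"
      using der[OF y a] by (simp add: has_dir_deriv_def)
    ultimately have "((\<lambda>t. (1 / t) *\<^sub>R (h ((y + t *\<^sub>R a) + t *\<^sub>R b) - h (y + t *\<^sub>R a)) +
        (1 / t) *\<^sub>R (h (y + t *\<^sub>R a) - h y)) \<longlongrightarrow> dh y b + dh y a) (at 0)"
      by (rule tendsto_add)
    then have "has_dir_deriv h y (a + b) (dh y b + dh y a)"
      by (simp add: has_dir_deriv_def scaleR_diff_right scaleR_add_right add.assoc)
    then show ?thesis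
      using has_dir_deriv_unique[OF der[OF y subspace_add[OF sE a b]]] by (simp add: add.commute)
  qed
  show ?thesis
    by (simp only: add[OF subspace_scale[OF sE z(1)] subspace_scale[OF sE z(2)]] hom[OF z(1)] hom[OF z(2)])
qed

section \<open>Iterated derivatives and the chain rule of all orders\<close>

abbreviation directions :: "'e set \<Rightarrow> (nat \<Rightarrow> 'e) set" where
  "directions E \<equiv> UNIV \<rightarrow> E"

lemma directions_upd: "v \<in> directions E \<Longrightarrow> a \<in> E \<Longrightarrow> v(i := a) \<in> directions E"
  by auto

lemma smooth_on_has_dir_deriv:
  assumes "smooth_on E U f" "x \<in> U" "v \<in> directions E"
  shows "has_dir_deriv (iter_deriv f k v) x (v k) (iter_deriv f (Suc k) v x)"
  using assms unfolding smooth_on_def dir_differentiable_iff by simp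

lemma iter_deriv_cong_directions:
  "(\<And>i. i < k \<Longrightarrow> v i = w i) \<Longrightarrow> iter_deriv f k v = iter_deriv f k w"
  by (induction k) auto

lemma smooth_on_iter_deriv_cont:
  "smooth_on E U f \<Longrightarrow> continuous_on (U \<times> directions E) (\<lambda>(x, v). iter_deriv f k v x)"
  by (simp add: smooth_on_def)

text \<open>\<open>iter_deriv f k v\<close> depends only on the entries of \<open>v\<close> below
  \<open>k\<close>, so entry \<open>k\<close> is free to hold an arbitrary new direction.\<close>

lemma iter_deriv_has_dir_deriv:
  assumes "smooth_on E U f" "x \<in> U" "v \<in> directions E" "a \<in> E"
  shows "has_dir_deriv (iter_deriv f k v) x a (iter_deriv f (Suc k) (v(k := a)) x)"
  using smooth_on_has_dir_deriv[OF assms(1,2) directions_upd[OF assms(3,4), of k], of k]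
    iter_deriv_cong_directions[of k "v(k := a)" v f] by simp

lemma continuous_on_upd:
  fixes h :: "'a::topological_space \<Rightarrow> nat \<Rightarrow> 'e::topological_space"
  assumes "continuous_on S h" "continuous_on S g"
  shows "continuous_on S (\<lambda>x. (h x)(i := g x))"
proof (rule continuous_on_coordinatewise_then_product)
  fix j show "continuous_on S (\<lambda>x. ((h x)(i := g x)) j)"
    using assms continuous_on_product_then_coordinatewise[OF assms(1)] by (cases "i = j") auto
qed

lemma iter_deriv_c1_cont:
  assumes "smooth_on E U f" "v \<in> directions E"
  shows "continuous_on (U \<times> E) (\<lambda>(y, z). iter_deriv f (Suc k) (v(k := z)) y)"
proof -
  have "continuous_on (U \<times> E) ((\<lambda>(x, v). iter_deriv f (Suc k) v x) \<circ> (\<lambda>(y, z). (y, v(k := z))))"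
  proof (rule continuous_on_compose)
    show "continuous_on (U \<times> E) (\<lambda>(y, z). (y, v(k := z)))"
      unfolding case_prod_beta
      by (intro continuous_on_Pair continuous_on_upd continuous_on_const continuous_intros)
    show "continuous_on ((\<lambda>(y, z). (y, v(k := z))) ` (U \<times> E)) (\<lambda>(x, v). iter_deriv f (Suc k) v x)"
      by (rule continuous_on_subset[OF smooth_on_iter_deriv_cont[OF assms(1)]]) (use assms(2) in auto)
  qed
  then show ?thesis by (simp add: o_def case_prod_beta)
qed

lemma iter_deriv_in:
  assumes "smooth_on E U f" "model_space E" "openin (top_of_set E) U" "model_space F" "f ` U \<subseteq> F"
    "x \<in> U" "v \<in> directions E"
  shows "iter_deriv f k v x \<in> F"
  using assms(6)
proof (induction k arbitrary: x)
  case 0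
  then show ?case using assms by auto
next
  case (Suc k)
  show ?case
    by (rule has_dir_deriv_in_closed[OF assms(4,2,3) Suc.prems _ Suc.IH
          smooth_on_has_dir_deriv[OF assms(1) Suc.prems assms(7)]]) (use assms(7) in auto)
qed

text \<open>In the last direction this is \<open>c1_linear\<close>. In an earlier one the identity
  holds for the derivative of order \<open>k\<close> at all points of \<open>U\<close> and is
  differentiated once more in the direction \<open>v k\<close>.\<close>

lemma iter_deriv_linear:
  assumes "smooth_on E U f" "model_space E" "openin (top_of_set E) U"
    "x \<in> U" "v \<in> directions E" "a \<in> E" "b \<in> E" "i < k"
  shows "iter_deriv f k (v(i := p *\<^sub>R a + q *\<^sub>R b)) x =
    p *\<^sub>R iter_deriv f k (v(i := a)) x + q *\<^sub>R iter_deriv f k (v(i := b)) x"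
  using assms(4,8)
proof (induction k arbitrary: x)
  case 0
  then show ?case by simp
next
  case (Suc k)
  have sE: "subspace E" using assms(2) by (simp add: model_space_def)
  show ?case
  proof (cases "i = k")
    case True
    have "(\<lambda>z. iter_deriv f (Suc k) (v(k := z)) x) (p *\<^sub>R a + q *\<^sub>R b) =
      p *\<^sub>R iter_deriv f (Suc k) (v(k := a)) x + q *\<^sub>R iter_deriv f (Suc k) (v(k := b)) x"
      by (rule c1_linear[where h = "iter_deriv f k v" and dh = "\<lambda>y z. iter_deriv f (Suc k) (v(k := z)) y",
            OF assms(2,3) iter_deriv_has_dir_deriv[OF assms(1) _ assms(5)]
              iter_deriv_c1_cont[OF assms(1,5)] Suc.prems(1) assms(6,7)])
    then show ?thesis by (simp only: True)
  next
    case False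
    let ?v = "\<lambda>c. v(i := c)"
    have ik: "i < k" using Suc.prems(2) False by simp
    have IH: "iter_deriv f k (?v (p *\<^sub>R a + q *\<^sub>R b)) y =
        p *\<^sub>R iter_deriv f k (?v a) y + q *\<^sub>R iter_deriv f k (?v b) y" if "y \<in> U" for y
      using Suc.IH[OF that ik] .
    have vk: "v k \<in> E" using assms(5) by auto
    have d: "has_dir_deriv (iter_deriv f k (?v c)) x (v k) (iter_deriv f (Suc k) (?v c) x)" if "c \<in> E" for c
      using smooth_on_has_dir_deriv[OF assms(1) Suc.prems(1) directions_upd[OF assms(5) that, of i], where k = k] False
      by simp
    have "((\<lambda>t. p *\<^sub>R ((1 / t) *\<^sub>R (iter_deriv f k (?v a) (x + t *\<^sub>R v k) - iter_deriv f k (?v a) x))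
       + q *\<^sub>R ((1 / t) *\<^sub>R (iter_deriv f k (?v b) (x + t *\<^sub>R v k) - iter_deriv f k (?v b) x)))
       \<longlongrightarrow> p *\<^sub>R iter_deriv f (Suc k) (?v a) x + q *\<^sub>R iter_deriv f (Suc k) (?v b) x) (at 0)"
      using d[OF assms(6)] d[OF assms(7)] unfolding has_dir_deriv_def
      by (intro tendsto_add tendsto_scaleR_lcs tendsto_const)
    then have dd: "has_dir_deriv (\<lambda>y. p *\<^sub>R iter_deriv f k (?v a) y + q *\<^sub>R iter_deriv f k (?v b) y) x (v k)
       (p *\<^sub>R iter_deriv f (Suc k) (?v a) x + q *\<^sub>R iter_deriv f (Suc k) (?v b) x)"
      unfolding has_dir_deriv_def
      by (simp add: scaleR_diff_right scaleR_add_right diff_add_eq add_diff_eq ac_simps diff_diff_eq)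
    have "has_dir_deriv (iter_deriv f k (?v (p *\<^sub>R a + q *\<^sub>R b))) x (v k)
       (p *\<^sub>R iter_deriv f (Suc k) (?v a) x + q *\<^sub>R iter_deriv f (Suc k) (?v b) x)"
      by (rule has_dir_deriv_cong[OF assms(2,3) Suc.prems(1) vk _ dd]) (rule IH)
    moreover have "p *\<^sub>R a + q *\<^sub>R b \<in> E"
      using assms(6,7) sE by (simp add: subspace_add subspace_scale)
    ultimately show ?thesis using d has_dir_deriv_unique by blast
  qed
qed

text \<open>The product rule for a multilinear derivative whose base point and directions all move.
  The base point contributes the term of order \<open>Suc j\<close> by \<open>c1_curve\<close>; the
  directions are changed one at a time, and linearity turns each change into the derivative
  evaluated at a difference quotient of \<open>w\<close>, which converges by joint
  continuity.\<close>

lemma iter_deriv_curve: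
  assumes g: "smooth_on E V g" and E: "model_space E" and V: "openin (top_of_set E) V"
    and y: "curve_deriv y y'" "y 0 \<in> V" "eventually (\<lambda>t. y t \<in> E) (at 0)" "y' \<in> E"
    and w: "\<And>i. curve_deriv (\<lambda>t. w t i) (w' i)" "w 0 \<in> directions E" "w' \<in> directions E"
      "eventually (\<lambda>t. w t \<in> directions E) (at 0)"
  shows "curve_deriv (\<lambda>t. iter_deriv g j (w t) (y t))
    (iter_deriv g (Suc j) ((w 0)(j := y')) (y 0) + (\<Sum>i<j. iter_deriv g j ((w 0)(i := w' i)) (y 0)))"
proof -
  have sE: "subspace E" using E by (simp add: model_space_def)
  let ?G = "\<lambda>v y. iter_deriv g j v y"
  have yV: "eventually (\<lambda>t. y t \<in> V) (at 0)"
    by (rule eventually_in_openin[OF V curve_deriv_tendsto[OF y(1)] y(2,3)])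
  have c0: "curve_deriv (\<lambda>t. ?G (w 0) (y t)) (iter_deriv g (Suc j) ((w 0)(j := y')) (y 0))"
    by (rule c1_curve[where dh = "\<lambda>y z. iter_deriv g (Suc j) ((w 0)(j := z)) y", OF E V
          iter_deriv_has_dir_deriv[OF g _ w(2)] iter_deriv_c1_cont[OF g w(2)] y(1-4)])
  \<comment> \<open>In \<open>u t i\<close> the directions below \<open>i\<close> are already frozen
    at time 0 and the others still move, so consecutive sequences differ only in entry
    \<open>i\<close> and the total change telescopes.\<close>
  define u where "u = (\<lambda>t i l. if l < i then w 0 l else w t l)"
  have tel: "?G (w t) (y t) - ?G (w 0) (y t) = (\<Sum>i<j. ?G (u t i) (y t) - ?G (u t (Suc i)) (y t))" for t
  proof -
    have "(\<Sum>i<n. ?G (u t i) (y t) - ?G (u t (Suc i)) (y t)) = ?G (u t 0) (y t) - ?G (u t n) (y t)" for n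
      by (induction n) auto
    moreover have "u t 0 = w t" by (simp add: u_def)
    moreover have "?G (u t j) = ?G (w 0)"
      by (rule iter_deriv_cong_directions) (simp add: u_def)
    ultimately show ?thesis by simp
  qed
  have lim: "((\<lambda>t. (1 / t) *\<^sub>R (?G (u t i) (y t) - ?G (u t (Suc i)) (y t))) \<longlongrightarrow>
      ?G ((w 0)(i := w' i)) (y 0)) (at 0)" if i: "i < j" for i
  proof -
    let ?q = "\<lambda>t. (1 / t) *\<^sub>R (w t i - w 0 i)"
    have "((\<lambda>t. (\<lambda>(x, v). iter_deriv g j v x) (y t, (u t i)(i := ?q t))) \<longlongrightarrow>
        (\<lambda>(x, v). iter_deriv g j v x) (y 0, (w 0)(i := w' i))) (at 0)"
    proof (rule continuous_on_tendsto_compose[OF smooth_on_iter_deriv_cont[OF g]])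
      have "((\<lambda>t. (u t i)(i := ?q t)) \<longlongrightarrow> (w 0)(i := w' i)) (at 0)"
      proof (rule tendsto_coordinatewise)
        fix l show "((\<lambda>t. ((u t i)(i := ?q t)) l) \<longlongrightarrow> ((w 0)(i := w' i)) l) (at 0)"
          using w(1)[of i] curve_deriv_tendsto[OF w(1)[of l]]
          by (cases "l = i"; cases "l < i") (auto simp: u_def curve_deriv_def)
      qed
      then show "((\<lambda>t. (y t, (u t i)(i := ?q t))) \<longlongrightarrow> (y 0, (w 0)(i := w' i))) (at 0)"
        by (intro tendsto_Pair curve_deriv_tendsto[OF y(1)])
      show "(y 0, (w 0)(i := w' i)) \<in> V \<times> directions E" using y(2) w(2,3) by (auto simp: Pi_iff)
      show "\<forall>\<^sub>F t in at 0. (y t, (u t i)(i := ?q t)) \<in> V \<times> directions E"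
        using yV w(4)
        by eventually_elim
          (use w(2) sE in \<open>auto simp: u_def Pi_iff subspace_scale subspace_diff\<close>)
    qed
    then have "((\<lambda>t. ?G ((u t i)(i := ?q t)) (y t)) \<longlongrightarrow> ?G ((w 0)(i := w' i)) (y 0)) (at 0)"
      by simp
    then show ?thesis
    proof (rule Lim_transform_eventually)
      show "\<forall>\<^sub>F t in at 0. ?G ((u t i)(i := ?q t)) (y t) =
          (1 / t) *\<^sub>R (?G (u t i) (y t) - ?G (u t (Suc i)) (y t))"
        using yV w(4)
      proof eventually_elim
        case (elim t)
        have ud: "u t i \<in> directions E" using elim(2) w(2) by (auto simp: u_def Pi_iff)
        have e: "w t i \<in> E" "w 0 i \<in> E" using elim(2) w(2) by auto
        have "?G ((u t i)(i := (1 / t) *\<^sub>R w t i + (- (1 / t)) *\<^sub>R w 0 i)) (y t) =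
          (1 / t) *\<^sub>R ?G ((u t i)(i := w t i)) (y t) + (- (1 / t)) *\<^sub>R ?G ((u t i)(i := w 0 i)) (y t)"
          by (rule iter_deriv_linear[OF g E V elim(1) ud e i])
        moreover have "(u t i)(i := w t i) = u t i" "(u t i)(i := w 0 i) = u t (Suc i)"
          by (auto simp: u_def less_Suc_eq)
        ultimately show ?case by (simp add: scaleR_diff_right)
      qed
    qed
  qed
  have "((\<lambda>t. (1 / t) *\<^sub>R (?G (w 0) (y t) - ?G (w 0) (y 0)) +
      (\<Sum>i<j. (1 / t) *\<^sub>R (?G (u t i) (y t) - ?G (u t (Suc i)) (y t)))) \<longlongrightarrow>
      iter_deriv g (Suc j) ((w 0)(j := y')) (y 0) + (\<Sum>i<j. ?G ((w 0)(i := w' i)) (y 0))) (at 0)"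
    by (intro tendsto_add tendsto_sum c0[unfolded curve_deriv_def]) (use lim in auto)
  then show ?thesis unfolding curve_deriv_def
  proof (rule back_subst[where P = "\<lambda>h. (h \<longlongrightarrow> _) _"])
    show "(\<lambda>t. (1 / t) *\<^sub>R (?G (w 0) (y t) - ?G (w 0) (y 0)) +
      (\<Sum>i<j. (1 / t) *\<^sub>R (?G (u t i) (y t) - ?G (u t (Suc i)) (y t)))) =
      (\<lambda>t. (1 / t) *\<^sub>R (?G (w t) (y t) - ?G (w 0) (y 0)))"
      unfolding scaleR_sum_right[symmetric] tel[symmetric] scaleR_add_right[symmetric] by simp
  qed
qed

text \<open>Iterated tangent maps change the type of the source, so the chain rule cannot be proved by
  induction on the order of differentiability. It is proved by coinduction instead: smooth functions
  are the members of sets, closed under directional derivatives, of continuous functions of a point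
  and a sequence of directions.\<close>

definition jet_closed ::
    "'e::locally_convex_space set \<Rightarrow> 'e set \<Rightarrow> ('e \<Rightarrow> (nat \<Rightarrow> 'e) \<Rightarrow> 'f::locally_convex_space) set \<Rightarrow> bool" where
  "jet_closed E U \<Phi> \<longleftrightarrow> (\<forall>F\<in>\<Phi>. continuous_on (U \<times> directions E) (\<lambda>(x, v). F x v) \<and>
     (\<forall>n. \<exists>F'\<in>\<Phi>. \<forall>x\<in>U. \<forall>v\<in>directions E. has_dir_deriv (\<lambda>x. F x v) x (v n) (F' x v)))"

text \<open>By induction on the order, each iterated derivative coincides on \<open>U\<close> with a
  member of the closed family, and so inherits its continuity and differentiability.\<close>

lemma smooth_on_jet:
  assumes E: "model_space E" and U: "openin (top_of_set E) U"
    and \<Phi>: "jet_closed E U \<Phi>" "F \<in> \<Phi>" "\<And>x v. x \<in> U \<Longrightarrow> v \<in> directions E \<Longrightarrow> f x = F x v"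
  shows "smooth_on E U f"
proof -
  have *: "\<exists>F\<in>\<Phi>. \<forall>x\<in>U. \<forall>v\<in>directions E. iter_deriv f k v x = F x v" for k
  proof (induction k)
    case 0
    then show ?case using \<Phi> by auto
  next
    case (Suc k)
    then obtain F where F: "F \<in> \<Phi>" "\<And>x v. x \<in> U \<Longrightarrow> v \<in> directions E \<Longrightarrow> iter_deriv f k v x = F x v" by blast
    obtain F' where F': "F' \<in> \<Phi>" "\<And>x v. x \<in> U \<Longrightarrow> v \<in> directions E \<Longrightarrow> has_dir_deriv (\<lambda>x. F x v) x (v k) (F' x v)"
      using \<Phi>(1) F(1) unfolding jet_closed_def by blast
    have d: "has_dir_deriv (iter_deriv f k v) x (v k) (F' x v)" if "x \<in> U" "v \<in> directions E" for x v
      by (rule has_dir_deriv_cong[OF E U that(1) _ F(2)[OF _ that(2)] F'(2)[OF that]]) (use that(2) in auto)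
    show ?case using F'(1) by (intro bexI[of _ F']) (simp_all add: has_dir_deriv_dir_deriv[OF d])
  qed
  show ?thesis unfolding smooth_on_def
  proof (intro allI conjI ballI)
    fix k x v assume x: "x \<in> U" and v: "v \<in> directions E"
    obtain F where F: "F \<in> \<Phi>" "\<And>x v. x \<in> U \<Longrightarrow> v \<in> directions E \<Longrightarrow> iter_deriv f k v x = F x v"
      using * by blast
    obtain F' where F': "F' \<in> \<Phi>" "\<And>x v. x \<in> U \<Longrightarrow> v \<in> directions E \<Longrightarrow> has_dir_deriv (\<lambda>x. F x v) x (v k) (F' x v)"
      using \<Phi>(1) F(1) unfolding jet_closed_def by blast
    have "has_dir_deriv (iter_deriv f k v) x (v k) (F' x v)"
      by (rule has_dir_deriv_cong[OF E U x _ F(2)[OF _ v] F'(2)[OF x v]]) (use v in auto)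
    then show "dir_differentiable (iter_deriv f k v) x (v k)"
      unfolding dir_differentiable_def has_dir_deriv_def by blast
  next
    fix k
    obtain F where F: "F \<in> \<Phi>" "\<And>x v. x \<in> U \<Longrightarrow> v \<in> directions E \<Longrightarrow> iter_deriv f k v x = F x v"
      using * by blast
    have "continuous_on (U \<times> directions E) (\<lambda>(x, v). F x v)"
      using \<Phi>(1) F(1) unfolding jet_closed_def by blast
    then show "continuous_on (U \<times> directions E) (\<lambda>(x, v). iter_deriv f k v x)"
      by (rule continuous_on_eq) (use F(2) in auto)
  qed
qed

text \<open>The directions are reindexed by \<open>\<sigma>\<close> because
  \<open>jet_closed\<close> demands a derivative in every direction \<open>v n\<close>, whereas
  \<open>iter_deriv\<close> always takes \<open>v k\<close> as the next one.\<close>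

definition jets :: "('e::locally_convex_space \<Rightarrow> 'f::locally_convex_space) \<Rightarrow> ('e \<Rightarrow> (nat \<Rightarrow> 'e) \<Rightarrow> 'f) set" where
  "jets f = {\<lambda>x v. iter_deriv f k (v \<circ> \<sigma>) x | k \<sigma>. True}"

lemma jets_base: "(\<lambda>x v. f x) \<in> jets f"
  unfolding jets_def by (intro CollectI exI[of _ 0]) simp

lemma jet_closed_jets:
  assumes "smooth_on E U f"
  shows "jet_closed E U (jets f)"
  unfolding jet_closed_def
proof (intro ballI conjI allI)
  fix F assume "F \<in> jets f"
  then obtain k \<sigma> where F: "F = (\<lambda>x v. iter_deriv f k (v \<circ> \<sigma>) x)" by (auto simp: jets_def)
  have "continuous_on (U \<times> directions E) ((\<lambda>(x, v). iter_deriv f k v x) \<circ> (\<lambda>(x, v). (x, v \<circ> \<sigma>)))"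
  proof (rule continuous_on_compose)
    show "continuous_on (U \<times> directions E) (\<lambda>(x, v). (x, v \<circ> \<sigma>))"
      unfolding case_prod_beta comp_def
      by (intro continuous_on_Pair continuous_on_fst continuous_on_id continuous_on_coordinatewise_then_product
          continuous_on_product_then_coordinatewise[OF continuous_on_snd])
    show "continuous_on ((\<lambda>(x, v). (x, v \<circ> \<sigma>)) ` (U \<times> directions E)) (\<lambda>(x, v). iter_deriv f k v x)"
      by (rule continuous_on_subset[OF smooth_on_iter_deriv_cont[OF assms]]) auto
  qed
  then show "continuous_on (U \<times> directions E) (\<lambda>(x, v). F x v)"
    by (simp add: o_def case_prod_beta F)
  fix n
  show "\<exists>F'\<in>jets f. \<forall>x\<in>U. \<forall>v\<in>directions E. has_dir_deriv (\<lambda>x. F x v) x (v n) (F' x v)"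
  proof -
    have "has_dir_deriv (\<lambda>x. F x v) x (v n) (iter_deriv f (Suc k) (v \<circ> \<sigma>(k := n)) x)"
      if x: "x \<in> U" and v: "v \<in> directions E" for x v
    proof -
      have "v \<circ> \<sigma>(k := n) = (v \<circ> \<sigma>)(k := v n)" by (auto simp: fun_eq_iff)
      then show ?thesis
        using iter_deriv_has_dir_deriv[OF assms x, of "v \<circ> \<sigma>" "v n" k] v unfolding F by (simp add: Pi_iff)
    qed
    moreover have "(\<lambda>x v. iter_deriv f (Suc k) (v \<circ> \<sigma>(k := n)) x) \<in> jets f"
      unfolding jets_def by (intro CollectI exI[of _ "Suc k"] exI[of _ "\<sigma>(k := n)"] conjI refl TrueI)
    ultimately show ?thesis
      by (intro bexI[of _ "\<lambda>x v. iter_deriv f (Suc k) (v \<circ> \<sigma>(k := n)) x"] ballI)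
  qed
qed

lemma jets_in:
  assumes "smooth_on E U f" "model_space E" "openin (top_of_set E) U" "model_space F" "f ` U \<subseteq> F"
    "x \<in> U" "v \<in> directions E" "W \<in> jets f"
  shows "W x v \<in> F"
proof -
  obtain k \<sigma> where W: "W = (\<lambda>x v. iter_deriv f k (v \<circ> \<sigma>) x)" using assms(8) by (auto simp: jets_def)
  show ?thesis unfolding W by (rule iter_deriv_in[OF assms(1-6)]) (use assms(7) in auto)
qed

text \<open>The sums of terms that occur in the Faa di Bruno formula.\<close>

inductive_set comp_jets for g f where
  base: "(\<And>i. W i \<in> jets f) \<Longrightarrow> (\<lambda>x v. iter_deriv g j (\<lambda>i. W i x v) (f x)) \<in> comp_jets g f"
| add: "A \<in> comp_jets g f \<Longrightarrow> B \<in> comp_jets g f \<Longrightarrow> (\<lambda>x v. A x v + B x v) \<in> comp_jets g f"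

text \<open>The family \<open>comp_jets g f\<close> is closed under directional derivatives: by
  \<open>iter_deriv_curve\<close> a term of order \<open>j\<close> yields one term of order
  \<open>Suc j\<close>, with a derivative of \<open>f\<close> as new direction, and \<open>j\<close>
  terms of order \<open>j\<close> in which one direction is differentiated. The coinduction
  principle then applies to the term of order 0.\<close>

lemma smooth_on_compose:
  assumes E: "model_space E" "openin (top_of_set E) U" and f: "smooth_on E U f"
    and F: "model_space F" "openin (top_of_set F) V" and g: "smooth_on F V g"
    and fU: "f ` U \<subseteq> V"
  shows "smooth_on E U (\<lambda>x. g (f x))"
proof -
  have fF: "f ` U \<subseteq> F" using fU F(2) openin_imp_subset by blast
  note J = jet_closed_jets[OF f] and JF = jets_in[OF f E F(1) fF]
  have "jet_closed E U (comp_jets g f)"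
    unfolding jet_closed_def
  proof
    fix A assume "A \<in> comp_jets g f"
    then show "continuous_on (U \<times> directions E) (\<lambda>(x, v). A x v) \<and>
     (\<forall>n. \<exists>A'\<in>comp_jets g f. \<forall>x\<in>U. \<forall>v\<in>directions E. has_dir_deriv (\<lambda>x. A x v) x (v n) (A' x v))"
    proof induction
      case (base W j)
      have cW: "continuous_on (U \<times> directions E) (\<lambda>p. W i (fst p) (snd p))" for i
        using J base[of i] unfolding jet_closed_def by (auto simp: case_prod_beta)
      have cf: "continuous_on (U \<times> directions E) (\<lambda>p. f (fst p))"
        using J jets_base[of f] unfolding jet_closed_def by (force simp: case_prod_beta)
      have "continuous_on (U \<times> directions E)
        ((\<lambda>(y, w). iter_deriv g j w y) \<circ> (\<lambda>p. (f (fst p), \<lambda>i. W i (fst p) (snd p))))"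
      proof (rule continuous_on_compose)
        show "continuous_on (U \<times> directions E) (\<lambda>p. (f (fst p), \<lambda>i. W i (fst p) (snd p)))"
          by (intro continuous_on_Pair cf continuous_on_coordinatewise_then_product cW)
        show "continuous_on ((\<lambda>p. (f (fst p), \<lambda>i. W i (fst p) (snd p))) ` (U \<times> directions E))
          (\<lambda>(y, w). iter_deriv g j w y)"
          by (rule continuous_on_subset[OF smooth_on_iter_deriv_cont[OF g]])
             (use fU JF base in auto)
      qed
      then have c: "continuous_on (U \<times> directions E) (\<lambda>(x, v). iter_deriv g j (\<lambda>i. W i x v) (f x))"
        by (simp add: o_def case_prod_beta)
      have "\<exists>A'\<in>comp_jets g f. \<forall>x\<in>U. \<forall>v\<in>directions E.
        has_dir_deriv (\<lambda>x. iter_deriv g j (\<lambda>i. W i x v) (f x)) x (v n) (A' x v)" for n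
      proof -
        have "\<forall>i. \<exists>W'. W' \<in> jets f \<and> (\<forall>x\<in>U. \<forall>v\<in>directions E. has_dir_deriv (\<lambda>x. W i x v) x (v n) (W' x v))"
          using J base unfolding jet_closed_def by blast
        then obtain W' where W': "\<And>i. W' i \<in> jets f"
          "\<And>i x v. x \<in> U \<Longrightarrow> v \<in> directions E \<Longrightarrow> has_dir_deriv (\<lambda>x. W i x v) x (v n) (W' i x v)" by metis
        obtain f' where f': "f' \<in> jets f"
          "\<And>x v. x \<in> U \<Longrightarrow> v \<in> directions E \<Longrightarrow> has_dir_deriv f x (v n) (f' x v)"
          using bspec[OF J[unfolded jet_closed_def] jets_base] by blast
        \<comment> \<open>The length \<open>m\<close> of the sum is a parameter so that membership
          can be proved by induction on it; the derivative is the case \<open>m = j\<close>.\<close>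
        let ?A = "\<lambda>m x v. iter_deriv g (Suc j) (\<lambda>i. (W(j := f')) i x v) (f x) +
            (\<Sum>i<m. iter_deriv g j (\<lambda>l. (W(i := W' i)) l x v) (f x))"
        have memb: "?A m \<in> comp_jets g f" for m
        proof (induction m)
          case 0
          show ?case
            using comp_jets.base[of "W(j := f')" f g "Suc j"] base f' by (simp del: iter_deriv.simps)
        next
          case (Suc m)
          have "(\<lambda>x v. iter_deriv g j (\<lambda>l. (W(m := W' m)) l x v) (f x)) \<in> comp_jets g f"
            using base W'(1) by (intro comp_jets.base) simp
          from comp_jets.add[OF Suc this] show ?case by (simp add: add.assoc)
        qed
        have dd: "has_dir_deriv (\<lambda>x. iter_deriv g j (\<lambda>i. W i x v) (f x)) x (v n) (?A j x v)"
          if x: "x \<in> U" and v: "v \<in> directions E" for x v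
        proof -
          have vn: "v n \<in> E" using v by auto
          have ev: "eventually (\<lambda>t. x + t *\<^sub>R v n \<in> U) (at 0)" by (rule eventually_ray[OF E x vn])
          have "curve_deriv (\<lambda>t. iter_deriv g j (\<lambda>i. W i (x + t *\<^sub>R v n) v) (f (x + t *\<^sub>R v n)))
            (iter_deriv g (Suc j) ((\<lambda>i. W i (x + 0 *\<^sub>R v n) v)(j := f' x v)) (f (x + 0 *\<^sub>R v n)) +
              (\<Sum>i<j. iter_deriv g j ((\<lambda>l. W l (x + 0 *\<^sub>R v n) v)(i := W' i x v)) (f (x + 0 *\<^sub>R v n))))"
          proof (rule iter_deriv_curve[OF g F, where w' = "\<lambda>i. W' i x v"])
            show "curve_deriv (\<lambda>t. f (x + t *\<^sub>R v n)) (f' x v)"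
              using f'(2)[OF x v] by (simp add: curve_deriv_ray)
            show "curve_deriv (\<lambda>t. W i (x + t *\<^sub>R v n) v) (W' i x v)" for i
              by (rule curve_deriv_ray[THEN iffD1, OF W'(2)[OF x v]])
            show "\<forall>\<^sub>F t in at 0. f (x + t *\<^sub>R v n) \<in> F"
              using ev by eventually_elim (use fF in auto)
            show "\<forall>\<^sub>F t in at 0. (\<lambda>i. W i (x + t *\<^sub>R v n) v) \<in> directions F"
              using ev by eventually_elim (use JF[OF _ v base] in auto)
            show "f' x v \<in> F" using JF[OF x v] f'(1) by simp
            show "(\<lambda>i. W' i x v) \<in> directions F" using JF[OF x v] W'(1) by simp
            show "(\<lambda>i. W i (x + 0 *\<^sub>R v n) v) \<in> directions F" using JF[OF x v] base by simp
            show "f (x + 0 *\<^sub>R v n) \<in> V" using fU x by auto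
          qed
          moreover have "(\<lambda>i. (W(j := f')) i x v) = (\<lambda>i. W i x v)(j := f' x v)"
            "(\<lambda>l. (W(i := W' i)) l x v) = (\<lambda>l. W l x v)(i := W' i x v)" for i
            by (auto simp: fun_eq_iff)
          ultimately show ?thesis by (simp add: curve_deriv_ray del: iter_deriv.simps)
        qed
        show ?thesis by (intro bexI[of _ "?A j"] ballI memb dd)
      qed
      with c show ?case by blast
    next
      case (add A B)
      have "continuous_on (U \<times> directions E) (\<lambda>(x, v). A x v + B x v)"
        using add by (auto simp: case_prod_beta intro: continuous_on_plus_lcs)
      moreover have "\<exists>C\<in>comp_jets g f. \<forall>x\<in>U. \<forall>v\<in>directions E.
          has_dir_deriv (\<lambda>x. A x v + B x v) x (v n) (C x v)" for n
      proof -
        obtain A' where A': "A' \<in> comp_jets g f"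
          "\<And>x v. x \<in> U \<Longrightarrow> v \<in> directions E \<Longrightarrow> has_dir_deriv (\<lambda>x. A x v) x (v n) (A' x v)"
          using add by blast
        obtain B' where B': "B' \<in> comp_jets g f"
          "\<And>x v. x \<in> U \<Longrightarrow> v \<in> directions E \<Longrightarrow> has_dir_deriv (\<lambda>x. B x v) x (v n) (B' x v)"
          using add by blast
        have "has_dir_deriv (\<lambda>x. A x v + B x v) x (v n) (A' x v + B' x v)" if "x \<in> U" "v \<in> directions E" for x v
          using tendsto_add[OF A'(2)[OF that, unfolded has_dir_deriv_def] B'(2)[OF that, unfolded has_dir_deriv_def]]
          unfolding has_dir_deriv_def scaleR_add_right[symmetric] by (simp add: algebra_simps)
        then show ?thesis using comp_jets.add[OF A'(1) B'(1)]
          by (intro bexI[of _ "\<lambda>x v. A' x v + B' x v"]) auto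
      qed
      ultimately show ?case by blast
    qed
  qed
  moreover have "(\<lambda>x v. iter_deriv g 0 (\<lambda>i. (\<lambda>i x v. f x) i x v) (f x)) \<in> comp_jets g f"
    by (rule comp_jets.base) (rule jets_base)
  ultimately show ?thesis by (rule smooth_on_jet[OF E]) simp
qed

section \<open>Elementary smooth maps and locality\<close>

lemma smooth_on_const:
  fixes c :: "'f::locally_convex_space"
  assumes "model_space E" "openin (top_of_set E) U"
  shows "smooth_on E U (\<lambda>x. c)"
proof (rule smooth_on_jet[OF assms, where \<Phi> = "{(\<lambda>x v. c), (\<lambda>x v. 0)}"])
  show "jet_closed E U {\<lambda>x v. c, \<lambda>x v. 0}"
    unfolding jet_closed_def by (auto simp: has_dir_deriv_def)
qed auto

lemma smooth_on_linear:
  fixes L :: "'a::locally_convex_space \<Rightarrow> 'b::locally_convex_space"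
  assumes "model_space E" "openin (top_of_set E) U"
    and L: "\<And>x y. L (x + y) = L x + L y" "\<And>r x. L (r *\<^sub>R x) = r *\<^sub>R L x" "continuous_on UNIV L"
  shows "smooth_on E U L"
proof (rule smooth_on_jet[OF assms(1,2), where \<Phi> = "{(\<lambda>x v. L x), (\<lambda>x v. 0)} \<union> range (\<lambda>n x v. L (v n))"])
  have "has_dir_deriv L x v (L v)" for x v
    unfolding has_dir_deriv_def
    by (rule Lim_transform_eventually[OF tendsto_const]) (auto simp: L eventually_at intro!: exI[of _ 1])
  moreover have "continuous_on S (\<lambda>p. L (fst p))" "continuous_on S (\<lambda>p. L (snd p n))" for S n
    by (auto intro!: continuous_on_compose2[OF L(3)] continuous_intros
        continuous_on_product_then_coordinatewise[OF continuous_on_snd])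
  moreover have "has_dir_deriv (\<lambda>x. c) x v 0" for c :: 'b and x v :: 'a by (simp add: has_dir_deriv_def)
  ultimately show "jet_closed E U ({(\<lambda>x v. L x), (\<lambda>x v. 0)} \<union> range (\<lambda>n x v. L (v n)))" (is "jet_closed E U ?\<Phi>")
    unfolding jet_closed_def
  proof (intro ballI conjI allI)
    fix A n assume d: "\<And>x v. has_dir_deriv L x v (L v)" "\<And>(c :: 'b) (x :: 'a) v. has_dir_deriv (\<lambda>x. c) x v 0"
      and "A \<in> ?\<Phi>"
    then consider "A = (\<lambda>x v. L x)" | "A = (\<lambda>x v. 0)" | m where "A = (\<lambda>x v. L (v m))" by auto
    then show "\<exists>A'\<in>?\<Phi>. \<forall>x\<in>U. \<forall>v\<in>directions E. has_dir_deriv (\<lambda>x. A x v) x (v n) (A' x v)"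
    proof cases
      case 1
      then show ?thesis using d(1) by (intro bexI[of _ "\<lambda>x v. L (v n)"]) auto
    next
      case 2
      then show ?thesis using d(2) by (intro bexI[of _ "\<lambda>x v. 0"]) auto
    next
      case 3
      then show ?thesis using d(2) by (intro bexI[of _ "\<lambda>x v. 0"]) auto
    qed
  qed (auto simp: case_prod_beta)
qed auto

lemma smooth_on_Pair:
  assumes "model_space E" "openin (top_of_set E) U" "smooth_on E U f" "smooth_on E U g"
  shows "smooth_on E U (\<lambda>x. (f x, g x))"
proof (rule smooth_on_jet[OF assms(1,2), where \<Phi> = "{\<lambda>x v. (A x v, B x v) | A B. A \<in> jets f \<and> B \<in> jets g}"])
  show "jet_closed E U {\<lambda>x v. (A x v, B x v) | A B. A \<in> jets f \<and> B \<in> jets g}"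
    unfolding jet_closed_def
  proof (intro ballI conjI allI)
    fix C assume "C \<in> {\<lambda>x v. (A x v, B x v) | A B. A \<in> jets f \<and> B \<in> jets g}"
    then obtain A B where C: "C = (\<lambda>x v. (A x v, B x v))" "A \<in> jets f" "B \<in> jets g" by blast
    show "continuous_on (U \<times> directions E) (\<lambda>(x, v). C x v)"
      using jet_closed_jets[OF assms(3)] jet_closed_jets[OF assms(4)] C(2,3)
      unfolding C(1) jet_closed_def by (auto simp: case_prod_beta intro!: continuous_on_Pair)
    fix n
    obtain A' where A': "A' \<in> jets f"
      "\<And>x v. x \<in> U \<Longrightarrow> v \<in> directions E \<Longrightarrow> has_dir_deriv (\<lambda>x. A x v) x (v n) (A' x v)"
      using jet_closed_jets[OF assms(3)] C(2) unfolding jet_closed_def by blast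
    obtain B' where B': "B' \<in> jets g"
      "\<And>x v. x \<in> U \<Longrightarrow> v \<in> directions E \<Longrightarrow> has_dir_deriv (\<lambda>x. B x v) x (v n) (B' x v)"
      using jet_closed_jets[OF assms(4)] C(3) unfolding jet_closed_def by blast
    have "has_dir_deriv (\<lambda>x. C x v) x (v n) (A' x v, B' x v)" if "x \<in> U" "v \<in> directions E" for x v
      using tendsto_Pair[OF A'(2)[OF that, unfolded has_dir_deriv_def] B'(2)[OF that, unfolded has_dir_deriv_def]]
      unfolding has_dir_deriv_def C(1) by simp
    then show "\<exists>C'\<in>{\<lambda>x v. (A x v, B x v) | A B. A \<in> jets f \<and> B \<in> jets g}. \<forall>x\<in>U. \<forall>v\<in>directions E.
        has_dir_deriv (\<lambda>x. C x v) x (v n) (C' x v)"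
      using A'(1) B'(1) by (intro bexI[of _ "\<lambda>x v. (A' x v, B' x v)"]) auto
  qed
  show "(\<lambda>x v. (f x, g x)) \<in> {\<lambda>x v. (A x v, B x v) | A B. A \<in> jets f \<and> B \<in> jets g}"
    using jets_base[of f] jets_base[of g]
    by (intro CollectI exI[of _ "\<lambda>x v. f x"] exI[of _ "\<lambda>x v. g x"]) auto
qed auto

lemma smooth_on_fst: "model_space E \<Longrightarrow> openin (top_of_set E) U \<Longrightarrow> smooth_on E U fst"
  by (rule smooth_on_linear) (auto intro: continuous_on_fst continuous_on_id)

lemma smooth_on_snd: "model_space E \<Longrightarrow> openin (top_of_set E) U \<Longrightarrow> smooth_on E U snd"
  by (rule smooth_on_linear) (auto intro: continuous_on_snd continuous_on_id)

lemma smooth_on_subspace: "smooth_on E U f \<Longrightarrow> F \<subseteq> E \<Longrightarrow> W \<subseteq> U \<Longrightarrow> smooth_on F W f"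
  unfolding smooth_on_def
  by (intro allI conjI ballI) (blast, rule continuous_on_subset, blast, blast)

text \<open>A directional derivative is a limit along a ray that eventually stays in
  \<open>W\<close>, so all iterated derivatives at a point depend only on the germ there. This is
  the gluing principle behind the chart computations.\<close>

lemma smooth_on_local:
  assumes E: "model_space E" and loc: "\<And>x. x \<in> U \<Longrightarrow> \<exists>W g. openin (top_of_set E) W \<and> x \<in> W \<and>
      smooth_on E W g \<and> (\<forall>y\<in>W. f y = g y)"
  shows "smooth_on E U f"
proof -
  have *: "iter_deriv f k v y = iter_deriv g k v y"
    if "openin (top_of_set E) W" "smooth_on E W g" "\<And>y. y \<in> W \<Longrightarrow> f y = g y" "y \<in> W" "v \<in> directions E"
    for W g k v y
    using that(4)
  proof (induction k arbitrary: y)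
    case (Suc k)
    have "has_dir_deriv (iter_deriv f k v) y (v k) (iter_deriv g (Suc k) v y)"
      by (rule has_dir_deriv_cong[OF E that(1) Suc.prems _ Suc.IH smooth_on_has_dir_deriv[OF that(2) Suc.prems that(5)]])
         (use that(5) in auto)
    then show ?case using has_dir_deriv_dir_deriv by auto
  qed (use that in simp)
  show ?thesis unfolding smooth_on_def
  proof (intro allI conjI ballI)
    fix k x v assume x: "x \<in> U" and v: "v \<in> directions E"
    obtain W g where W: "openin (top_of_set E) W" "x \<in> W" "smooth_on E W g" "\<And>y. y \<in> W \<Longrightarrow> f y = g y"
      using loc[OF x] by blast
    have "has_dir_deriv (iter_deriv f k v) x (v k) (iter_deriv g (Suc k) v x)"
      by (rule has_dir_deriv_cong[OF E W(1,2) _ *[OF W(1,3,4) _ v] smooth_on_has_dir_deriv[OF W(3,2) v]])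
         (use v in auto)
    then show "dir_differentiable (iter_deriv f k v) x (v k)"
      unfolding dir_differentiable_def has_dir_deriv_def by blast
  next
    fix k
    show "continuous_on (U \<times> directions E) (\<lambda>(x, v). iter_deriv f k v x)"
      unfolding continuous_on_def
    proof (rule ballI, clarsimp)
      fix x and v :: "nat \<Rightarrow> 'a" assume x: "x \<in> U" and v: "v \<in> directions E"
      obtain W g where W: "openin (top_of_set E) W" "x \<in> W" "smooth_on E W g" "\<And>y. y \<in> W \<Longrightarrow> f y = g y"
        using loc[OF x] by blast
      obtain T where T: "open T" "W = E \<inter> T" using W(1) by (auto simp: openin_open)
      have UE: "U \<subseteq> E" using loc openin_imp_subset by blast
      have "((\<lambda>(x, v). iter_deriv g k v x) \<longlongrightarrow> iter_deriv g k v x) (at (x, v) within W \<times> directions E)"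
        using smooth_on_iter_deriv_cont[OF W(3)] W(2) v unfolding continuous_on_def by fastforce
      then have "((\<lambda>(x, v). iter_deriv f k v x) \<longlongrightarrow> iter_deriv f k v x) (at (x, v) within W \<times> directions E)"
        using *[OF W(1,3,4)] W(2) v
        by (subst Lim_cong_within[where g = "\<lambda>(x, v). iter_deriv g k v x"]) auto
      \<comment> \<open>Continuity is first known within \<open>W\<close>. As \<open>W\<close> is
        the trace on \<open>E\<close> of the open set \<open>T\<close>, the limit persists within
        \<open>E\<close>, and therefore within \<open>U\<close>.\<close>
      then have "((\<lambda>(x, v). iter_deriv f k v x) \<longlongrightarrow> iter_deriv f k v x) (at (x, v) within (E \<times> directions E) \<inter> (T \<times> UNIV))"
        by (rule tendsto_within_subset) (use T in auto)
      moreover have "at (x, v) within (E \<times> directions E) \<inter> (T \<times> UNIV) = at (x, v) within E \<times> directions E"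
        by (rule at_within_nhd[of _ "T \<times> UNIV"]) (use T W(2) in \<open>auto simp: open_Times\<close>)
      ultimately have "((\<lambda>(x, v). iter_deriv f k v x) \<longlongrightarrow> iter_deriv f k v x) (at (x, v) within E \<times> directions E)"
        by simp
      then show "((\<lambda>(x, v). iter_deriv f k v x) \<longlongrightarrow> iter_deriv f k v x) (at (x, v) within U \<times> directions E)"
        by (rule tendsto_within_subset) (use UE in auto)
    qed
  qed
qed

section \<open>Locally compact spaces and compact Lie groups\<close>

lemma convex_scale_down:
  assumes "convex N" "0 \<in> N" "x \<in> N" "0 \<le> s" "s \<le> (1::real)"
  shows "s *\<^sub>R x \<in> N"
  using convexD[OF assms(1,2,3), of "1 - s" s] assms by simp

lemma open_scale_preimage:
  fixes N :: "'e::locally_convex_space set"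
  assumes "open N"
  shows "open {x. r *\<^sub>R (x - a) \<in> N}"
proof -
  have "continuous_on UNIV (\<lambda>x. r *\<^sub>R (x - a))"
    by (intro continuous_on_scaleR_lcs continuous_on_const continuous_on_diff_lcs continuous_on_id)
  from open_vimage[OF assms this] show ?thesis by (simp add: vimage_def)
qed

text \<open>Boundedness of compact sets. The multiples \<open>x / r\<close> tend to 0, so the
  dilates of \<open>N\<close> cover \<open>K\<close> and finitely many suffice; convexity of
  \<open>N\<close> around 0 extends the conclusion from one scale to all smaller ones.\<close>

lemma compact_absorbed:
  fixes N :: "'e::locally_convex_space set"
  assumes "compact K" "open N" "convex N" "0 \<in> N"
  obtains r :: nat where "r > 0" "\<And>x (s::real). x \<in> K \<Longrightarrow> 0 \<le> s \<Longrightarrow> s * r \<le> 1 \<Longrightarrow> s *\<^sub>R x \<in> N"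
proof -
  define U where "U = (\<lambda>r::nat. {x. (1 / Suc r) *\<^sub>R (x - 0) \<in> N})"
  have "open (U r)" for r unfolding U_def by (rule open_scale_preimage[OF assms(2)])
  moreover have "K \<subseteq> (\<Union>r\<in>UNIV. U r)"
  proof
    fix x :: 'e
    have "((\<lambda>r. (1 / real (Suc r)) *\<^sub>R x) \<longlongrightarrow> 0 *\<^sub>R x) sequentially"
      using LIMSEQ_inverse_real_of_nat[unfolded inverse_eq_divide]
      by (rule tendsto_scaleR_lcs[OF _ tendsto_const])
    then have "eventually (\<lambda>r. (1 / real (Suc r)) *\<^sub>R x \<in> N) sequentially"
      using assms(2,4) by (intro topological_tendstoD) auto
    then obtain r where "(1 / real (Suc r)) *\<^sub>R x \<in> N" by (meson eventually_sequentially order_refl)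
    then show "x \<in> (\<Union>r\<in>UNIV. U r)" by (auto simp: U_def)
  qed
  ultimately obtain I where I: "finite I" "K \<subseteq> (\<Union>r\<in>I. U r)"
    using assms(1) by (meson compactE_image)
  define r where "r = Suc (Max (insert 0 I))"
  show ?thesis
  proof
    show "r > 0" by (simp add: r_def)
    fix x and s :: real assume x: "x \<in> K" and s: "0 \<le> s" "s * r \<le> 1"
    obtain i where i: "i \<in> I" "(1 / Suc i) *\<^sub>R x \<in> N" using I x by (auto simp: U_def)
    have "Suc i \<le> r" using I(1) i(1) by (simp add: r_def)
    then have "s * Suc i \<le> s * r" using s(1) by (intro mult_left_mono) auto
    then have "s * Suc i \<le> 1" using s(2) by linarith
    then have "(s * Suc i) *\<^sub>R ((1 / Suc i) *\<^sub>R x) \<in> N"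
      using s(1) by (intro convex_scale_down[OF assms(3,4) i(2)]) auto
    then show "s *\<^sub>R x \<in> N" by (simp add: divide_simps split: if_splits)
  qed
qed

text \<open>The neighbourhood \<open>N\<close> encodes that the coordinate functionals are continuous.\<close>

lemma finite_dim_coordinates:
  fixes F :: "'e::locally_convex_space set"
  assumes "finite F"
  obtains n and T :: "(nat \<Rightarrow> real) \<Rightarrow> 'e" and N where
    "continuous_on UNIV T"
    "\<And>c d. T (\<lambda>i. c i - d i) = T c - T d" "\<And>r c. T (\<lambda>i. r * c i) = r *\<^sub>R T c"
    "T ` topspace (Euclidean_space n) = span F"
    "open N" "convex N" "0 \<in> N"
    "\<And>c i. c \<in> topspace (Euclidean_space n) \<Longrightarrow> T c \<in> N \<Longrightarrow> \<bar>c i\<bar> \<le> 1"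
proof -
  obtain B where B: "B \<subseteq> F" "independent B" "F \<subseteq> span B"
    using maximal_independent_subset by metis
  then have fB: "finite B" using assms finite_subset by blast
  have sB: "span B = span F" using B by (metis span_mono span_span subset_antisym span_minimal subspace_span)
  obtain b where b: "bij_betw b {0..<card B} B" using ex_bij_betw_nat_finite[OF fB] by blast
  define n where "n = card B"
  define T :: "(nat \<Rightarrow> real) \<Rightarrow> 'e" where "T = (\<lambda>c. \<Sum>i<n. c i *\<^sub>R b i)"
  have bij: "bij_betw b {..<n} B" using b by (simp add: n_def lessThan_atLeast0)
  define b' where "b' = inv_into {..<n} b"
  have b'b: "b' (b i) = i" if "i < n" for i
    using bij that by (simp add: b'_def bij_betw_inv_into_left)
  have TB: "(\<Sum>v\<in>B. u v *\<^sub>R v) = T (\<lambda>i. u (b i))" for u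
    unfolding T_def by (rule sum.reindex_bij_betw[OF bij, symmetric])
  have Tcong: "T c = T d" if "\<And>i. i < n \<Longrightarrow> c i = d i" for c d
    using that by (simp add: T_def)
  have cont: "continuous_on UNIV T"
    unfolding T_def continuous_on_def
    by (intro ballI tendsto_sum tendsto_scaleR_lcs tendsto_const tendsto_coordinate[OF tendsto_ident_at])
  have minus: "T (\<lambda>i. c i - d i) = T c - T d" for c d
    by (simp add: T_def scaleR_diff_left sum_subtractf)
  have scale: "T (\<lambda>i. r * c i) = r *\<^sub>R T c" for r c
    by (simp add: T_def scaleR_sum_right)
  have img: "T ` topspace (Euclidean_space n) = span F"
  proof
    show "T ` topspace (Euclidean_space n) \<subseteq> span F"
      unfolding sB[symmetric] T_def using bij
      by (intro image_subsetI span_sum span_scale span_base) (auto simp: bij_betw_def)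
    show "span F \<subseteq> T ` topspace (Euclidean_space n)"
    proof
      fix x assume "x \<in> span F"
      then have "x \<in> range (\<lambda>u. \<Sum>v\<in>B. u v *\<^sub>R v)"
        unfolding sB[symmetric] span_finite[OF fB] .
      then obtain u where "x = (\<Sum>v\<in>B. u v *\<^sub>R v)" by (rule imageE)
      moreover have "T (\<lambda>i. u (b i)) = T (\<lambda>i. if i < n then u (b i) else 0)" by (rule Tcong) simp
      ultimately have "x = T (\<lambda>i. if i < n then u (b i) else 0)" unfolding TB by simp
      then show "x \<in> T ` topspace (Euclidean_space n)" by (auto simp: topspace_Euclidean_space)
    qed
  qed
  have inj: "c i = 0" if "T c = 0" "i < n" for c i
  proof -
    have "(\<Sum>v\<in>B. c (b' v) *\<^sub>R v) = T c"
      unfolding TB by (rule Tcong) (simp add: b'b)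
    then have "c (b' (b i)) = 0"
      using independentD[OF B(2) fB subset_refl, of "\<lambda>v. c (b' v)" "b i"] that bij
      by (auto simp: bij_betw_def)
    then show ?thesis using b'b that by simp
  qed
  define Q where "Q = PiE (UNIV :: nat set) (\<lambda>i. if i < n then {-1..1} else {0::real})"
  have "compactin (product_topology (\<lambda>_. euclidean) UNIV) Q"
    unfolding Q_def compactin_PiE by auto
  then have cQ: "compact Q" by (simp add: euclidean_product_topology)
  \<comment> \<open>The unit sphere of the maximum norm. Its image under \<open>T\<close> is
    compact, hence closed, and avoids 0 because the basis is independent; \<open>N\<close> is a
    convex neighbourhood of 0 missing it.\<close>
  define Sph where "Sph = Q \<inter> (\<Union>i<n. {c. \<bar>c i\<bar> = 1})"
  have "closed {c::nat\<Rightarrow>real. \<bar>c i\<bar> = 1}" for i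
    by (rule closed_Collect_eq) (intro continuous_intros continuous_on_product_coordinates)+
  then have "compact Sph" unfolding Sph_def by (intro compact_Int_closed cQ closed_UN) auto
  then have "compact (T ` Sph)" by (rule compact_continuous_image[OF continuous_on_subset[OF cont subset_UNIV]])
  then have cl: "open (- T ` Sph)" by (simp add: compact_imp_closed open_Compl)
  have "0 \<notin> T ` Sph" using inj by (fastforce simp: Sph_def)
  then obtain N where N: "open N" "convex N" "0 \<in> N" "N \<subseteq> - T ` Sph"
    using convex_nbhd[OF cl, of 0] by auto
  have "\<bar>c i\<bar> \<le> 1" if c: "c \<in> topspace (Euclidean_space n)" "T c \<in> N" for c i
  proof (rule ccontr)
    assume "\<not> \<bar>c i\<bar> \<le> 1"
    then have i: "i < n" "\<bar>c i\<bar> > 1" using c(1) by (cases "i < n"; simp add: topspace_Euclidean_space)+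
    \<comment> \<open>The maximum norm of \<open>c\<close>. If it exceeded 1, dividing by it would
      stay inside the convex set \<open>N\<close> but land on the image of the sphere.\<close>
    define r where "r = Max ((\<lambda>i. \<bar>c i\<bar>) ` {..<n})"
    have r: "\<bar>c j\<bar> \<le> r" if "j < n" for j unfolding r_def using that by (intro Max_ge) auto
    have "r \<in> (\<lambda>i. \<bar>c i\<bar>) ` {..<n}" unfolding r_def using i by (intro Max_in) auto
    then obtain j where j: "j < n" "\<bar>c j\<bar> = r" by auto
    have r1: "r > 1" using r[OF i(1)] i(2) by simp
    have "(\<lambda>i. (1 / r) * c i) \<in> Sph"
      using c(1) r r1 j by (auto simp: Sph_def Q_def topspace_Euclidean_space abs_le_iff divide_simps not_less minus_le_iff
          intro!: bexI[of _ j])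
    then have "T (\<lambda>i. (1 / r) * c i) \<in> T ` Sph" by (rule imageI)
    then have "(1 / r) *\<^sub>R T c \<in> T ` Sph" by (simp only: scale)
    moreover have "(1 / r) *\<^sub>R T c \<in> N"
      using r1 by (intro convex_scale_down[OF N(2,3) c(2)]) auto
    ultimately show False using N(4) by blast
  qed
  then show ?thesis using that[OF cont minus scale img N(1-3)] by blast
qed

text \<open>The theorem of Riesz without a norm. Finitely many translates of half of
  \<open>V\<close> cover \<open>K\<close>; iterating, every \<open>v\<close> in
  \<open>V \<inter> E\<close> equals an element of \<open>span F\<close> plus \<open>(1/2)^k\<close>
  times an element of \<open>V\<close>. The elements of \<open>span F\<close> so obtained have
  bounded coordinates, hence stay in a compact subset of the span, and the limit \<open>v\<close>
  cannot leave it. Finally \<open>V \<inter> E\<close> absorbs \<open>E\<close>.\<close>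

lemma locally_compact_finite_dim:
  fixes E :: "'e::locally_convex_space set"
  assumes E: "subspace E" and K: "compact K" "K \<subseteq> E" and O: "open W" "0 \<in> W" "W \<inter> E \<subseteq> K"
  obtains F where "finite F" "E = span F"
proof -
  obtain V where V: "open V" "convex V" "0 \<in> V" "V \<subseteq> W" using convex_nbhd[OF O(1,2)] .
  have VK: "V \<inter> E \<subseteq> K" using V(4) O(3) by auto
  have "K \<subseteq> (\<Union>x\<in>K. {y. 2 *\<^sub>R (y - x) \<in> V})" using V(3) by auto
  then obtain F where F: "F \<subseteq> K" "finite F" "K \<subseteq> (\<Union>x\<in>F. {y. 2 *\<^sub>R (y - x) \<in> V})"
    by (rule compactE_image[OF K(1) open_scale_preimage[OF V(1)]])
  have FE: "F \<subseteq> E" using F(1) K(2) by auto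
  have half: "\<exists>f\<in>span F. \<exists>v'\<in>V \<inter> E. v = f + (1/2) *\<^sub>R v'" if v: "v \<in> V \<inter> E" for v
  proof -
    obtain x where x: "x \<in> F" "2 *\<^sub>R (v - x) \<in> V" using v VK F(3) by blast
    have "v = x + (1/2) *\<^sub>R (2 *\<^sub>R (v - x))" by simp
    moreover have "2 *\<^sub>R (v - x) \<in> E" using v x(1) FE by (intro subspace_scale[OF E] subspace_diff[OF E]) auto
    ultimately show ?thesis using x by (intro bexI[of _ x] bexI[of _ "2 *\<^sub>R (v - x)"]) (auto simp: span_base)
  qed
  have approx: "\<exists>f\<in>span F. \<exists>v'\<in>V \<inter> E. v = f + (1/2)^k *\<^sub>R v'" if "v \<in> V \<inter> E" for v k
  proof (induction k)
    case 0
    show ?case using that by (intro bexI[of _ 0] bexI[of _ v]) (auto simp: span_zero)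
  next
    case (Suc k)
    then obtain f v' where f: "f \<in> span F" "v' \<in> V \<inter> E" "v = f + (1/2)^k *\<^sub>R v'" by blast
    obtain f' v'' where f': "f' \<in> span F" "v'' \<in> V \<inter> E" "v' = f' + (1/2) *\<^sub>R v''" using half[OF f(2)] by blast
    have "v = (f + (1/2)^k *\<^sub>R f') + (1/2)^Suc k *\<^sub>R v''" by (simp add: f(3) f'(3) scaleR_add_right add.assoc)
    then show ?case using span_add[OF f(1) span_scale[OF f'(1)]] f'(2) by (intro bexI)
  qed
  obtain n and T :: "(nat \<Rightarrow> real) \<Rightarrow> 'e" and N where T: "continuous_on UNIV T"
    "\<And>c d. T (\<lambda>i. c i - d i) = T c - T d" "\<And>r c. T (\<lambda>i. r * c i) = r *\<^sub>R T c"
    "T ` topspace (Euclidean_space n) = span F" "open N" "convex N" "0 \<in> N"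
    "\<And>c i. c \<in> topspace (Euclidean_space n) \<Longrightarrow> T c \<in> N \<Longrightarrow> \<bar>c i\<bar> \<le> 1"
    by (rule finite_dim_coordinates[OF F(2)]) (rule that, assumption+)
  \<comment> \<open>All approximants \<open>v - (1/2)^k *\<^sub>R v'\<close> lie in the image of
    this compact set, so one coordinate bound \<open>r\<close> serves every
    \<open>k\<close>.\<close>
  have "continuous_on (K \<times> K \<times> {0..1}) (\<lambda>(a, b, s::real). a - s *\<^sub>R b)"
    unfolding case_prod_beta by (intro continuous_on_diff_lcs continuous_intros)
  then have "compact ((\<lambda>(a, b, s::real). a - s *\<^sub>R b) ` (K \<times> K \<times> {0..1}))"
    by (intro compact_continuous_image compact_Times K(1)) auto
  then obtain r :: nat where r: "r > 0"
    "\<And>x (s::real). x \<in> (\<lambda>(a, b, s::real). a - s *\<^sub>R b) ` (K \<times> K \<times> {0..1}) \<Longrightarrow> 0 \<le> s \<Longrightarrow> s * r \<le> 1 \<Longrightarrow> s *\<^sub>R x \<in> N"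
    by (rule compact_absorbed[OF _ T(5-7)]) (rule that, assumption+)
  define Q where "Q = PiE (UNIV :: nat set) (\<lambda>i. if i < n then {- real r..real r} else {0::real})"
  have "compactin (product_topology (\<lambda>_. euclidean) UNIV) Q"
    unfolding Q_def compactin_PiE by auto
  then have "compact Q" by (simp add: euclidean_product_topology)
  then have "compact (T ` Q)" by (rule compact_continuous_image[OF continuous_on_subset[OF T(1) subset_UNIV]])
  then have clQ: "open (- T ` Q)" by (simp add: compact_imp_closed open_Compl)
  have QF: "T ` Q \<subseteq> span F" unfolding T(4)[symmetric] by (auto simp: Q_def topspace_Euclidean_space PiE_def Pi_def split: if_splits)
  have VF: "v \<in> span F" if v: "v \<in> V \<inter> E" for v
  proof (rule ccontr)
    assume "v \<notin> span F"
    then have "v \<in> - T ` Q" using QF by auto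
    have "continuous_on UNIV (\<lambda>x. v - x)" by (intro continuous_on_diff_lcs continuous_on_const continuous_on_id)
    from open_vimage[OF clQ this] have "open ((\<lambda>x. v - x) -` (- T ` Q))" .
    then obtain C where C: "open C" "convex C" "0 \<in> C" "C \<subseteq> (\<lambda>x. v - x) -` (- T ` Q)"
      using convex_nbhd[of _ 0] \<open>v \<in> - T ` Q\<close> by (metis diff_zero vimageI)
    obtain R :: nat where R: "R > 0" "\<And>x (s::real). x \<in> K \<Longrightarrow> 0 \<le> s \<Longrightarrow> s * R \<le> 1 \<Longrightarrow> s *\<^sub>R x \<in> C"
      by (rule compact_absorbed[OF K(1) C(1-3)]) (rule that, assumption+)
    \<comment> \<open>This makes the remainder \<open>(1/2)^k *\<^sub>R v'\<close> lie in
      \<open>C\<close>, so the approximant \<open>f\<close> misses the image of the cube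
      \<open>Q\<close>; yet its coordinates are bounded by \<open>r\<close>.\<close>
    obtain k where k: "(1/2)^k < 1 / real R" using R(1) real_arch_pow_inv[of "1 / real R" "1/2"] by auto
    obtain f v' where f: "f \<in> span F" "v' \<in> V \<inter> E" "v = f + (1/2)^k *\<^sub>R v'" using approx[OF v] by blast
    have "(1/2)^k *\<^sub>R v' \<in> C" using R k f(2) VK by (intro R(2)) (auto simp: field_simps)
    then have "f \<notin> T ` Q" using C(4) f(3) by auto
    moreover have "f \<in> T ` Q"
    proof -
      obtain c where c: "c \<in> topspace (Euclidean_space n)" "f = T c" using f(1) T(4) by blast
      have "f = (\<lambda>(a, b, s::real). a - s *\<^sub>R b) (v, v', (1/2)^k)" using f(3) by simp
      then have "f \<in> (\<lambda>(a, b, s::real). a - s *\<^sub>R b) ` (K \<times> K \<times> {0..1})"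
        by (rule image_eqI) (use v f(2) VK in \<open>auto simp: power_le_one\<close>)
      then have "(1 / real r) *\<^sub>R f \<in> N" using r by (intro r(2)) auto
      then have "T (\<lambda>i. (1 / real r) * c i) \<in> N" using c(2) by (simp only: T(3))
      moreover have "(\<lambda>i. (1 / real r) * c i) \<in> topspace (Euclidean_space n)"
        using c(1) by (simp add: topspace_Euclidean_space)
      ultimately have "\<bar>(1 / real r) * c i\<bar> \<le> 1" for i using T(8) by blast
      then have "\<bar>c i\<bar> \<le> real r" for i using r(1) by (simp add: abs_mult divide_simps split: if_splits)
      then have "c \<in> Q" using c(1) by (auto simp: Q_def topspace_Euclidean_space abs_le_iff minus_le_iff)
      then show ?thesis using c(2) by blast
    qed
    ultimately show False by blast
  qed
  have "E \<subseteq> span F"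
  proof
    fix e assume e: "e \<in> E"
    obtain r :: nat where r: "r > 0" "\<And>x (s::real). x \<in> {e} \<Longrightarrow> 0 \<le> s \<Longrightarrow> s * r \<le> 1 \<Longrightarrow> s *\<^sub>R x \<in> V"
      by (rule compact_absorbed[OF compact_sing V(1-3)]) (rule that, assumption+)
    have "(1 / real r) *\<^sub>R e \<in> V" using r by (intro r(2)) auto
    then have "(1 / real r) *\<^sub>R e \<in> span F" using e E by (intro VF) (simp add: subspace_scale)
    then have "real r *\<^sub>R ((1 / real r) *\<^sub>R e) \<in> span F" by (rule span_scale)
    then show "e \<in> span F" using r(1) by simp
  qed
  moreover have "span F \<subseteq> E" using FE E by (rule span_minimal)
  ultimately show ?thesis using that F(2) by blast
qed

text \<open>The linear parametrization of the span has a continuous inverse. The target is the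
  topology \<open>Euclidean_space n\<close> because \<open>n\<close> arises inside the proof and
  cannot index a type; invariance of domain is applied in this form.\<close>

lemma locally_compact_homeomorphic_Euclidean:
  fixes E :: "'e::locally_convex_space set"
  assumes E: "subspace E" and K: "compact K" "K \<subseteq> E" and W: "open W" "0 \<in> W" "W \<inter> E \<subseteq> K"
  obtains n where "top_of_set E homeomorphic_space Euclidean_space n"
proof -
  obtain F where F: "finite F" "E = span F" using locally_compact_finite_dim[OF assms] .
  obtain n and T :: "(nat \<Rightarrow> real) \<Rightarrow> 'e" and N where T: "continuous_on UNIV T"
    "\<And>c d. T (\<lambda>i. c i - d i) = T c - T d" "\<And>r c. T (\<lambda>i. r * c i) = r *\<^sub>R T c"
    "T ` topspace (Euclidean_space n) = E" "open N" "convex N" "0 \<in> N"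
    "\<And>c i. c \<in> topspace (Euclidean_space n) \<Longrightarrow> T c \<in> N \<Longrightarrow> \<bar>c i\<bar> \<le> 1"
    by (rule finite_dim_coordinates[OF F(1), folded F(2)]) (rule that, assumption+)
  \<comment> \<open>Rescaling turns the unit bound on \<open>N\<close> into continuity of the
    coordinates: a difference in \<open>e\<close> times \<open>N\<close> has coordinates of size at
    most \<open>e\<close>.\<close>
  have bound: "\<bar>c i - d i\<bar> \<le> e"
    if "c \<in> topspace (Euclidean_space n)" "d \<in> topspace (Euclidean_space n)" "(1 / e) *\<^sub>R (T c - T d) \<in> N" "e > 0"
    for c d e i
  proof -
    have "\<bar>(1 / e) * (c i - d i)\<bar> \<le> 1"
    proof (rule T(8))
      show "T (\<lambda>i. (1 / e) * (c i - d i)) \<in> N" using that(3) by (simp only: T(2,3))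
    qed (use that in \<open>auto simp: topspace_Euclidean_space\<close>)
    then show ?thesis using that(4) by (simp add: abs_mult divide_simps)
  qed
  have inj: "inj_on T (topspace (Euclidean_space n))"
  proof (rule inj_onI)
    fix c d assume cd: "c \<in> topspace (Euclidean_space n)" "d \<in> topspace (Euclidean_space n)" "T c = T d"
    have "\<bar>c i - d i\<bar> \<le> 0" for i
      by (rule field_le_epsilon) (use bound[OF cd(1,2)] cd(3) T(7) in auto)
    then show "c = d" by (auto simp: fun_eq_iff)
  qed
  define C where "C = inv_into (topspace (Euclidean_space n)) T"
  have C: "C e \<in> topspace (Euclidean_space n)" "T (C e) = e" if "e \<in> E" for e
  proof -
    have "e \<in> T ` topspace (Euclidean_space n)" using that T(4) by simp
    then show "C e \<in> topspace (Euclidean_space n)" "T (C e) = e"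
      unfolding C_def by (rule inv_into_into, rule f_inv_into_f)
  qed
  have Ceq: "(\<lambda>i. if i < n then C e i else 0) = C e" if "e \<in> E" for e
    using C(1)[OF that] by (auto simp: topspace_Euclidean_space)
  have "continuous_on E (\<lambda>e. C e i)" for i
    unfolding continuous_on_def
  proof (intro ballI tendstoI)
    fix e0 and e :: real assume e0: "e0 \<in> E" and "e > 0"
    have "eventually (\<lambda>x. x \<in> {x. (1 / (e / 2)) *\<^sub>R (x - e0) \<in> N}) (nhds e0)"
      using T(7) by (intro eventually_nhds_in_open open_scale_preimage T(5)) simp
    then have "eventually (\<lambda>x. x \<in> E \<longrightarrow> dist (C x i) (C e0 i) < e) (nhds e0)"
    proof eventually_elim
      case (elim x)
      show ?case
      proof
        assume "x \<in> E"
        then have "\<bar>C x i - C e0 i\<bar> \<le> e / 2"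
          using bound[of "C x" "C e0" "e / 2" i] C e0 elim \<open>e > 0\<close> by simp
        then show "dist (C x i) (C e0 i) < e" using \<open>e > 0\<close> by (simp add: dist_real_def)
      qed
    qed
    then show "\<forall>\<^sub>F x in at e0 within E. dist (C x i) (C e0 i) < e"
      by (simp add: eventually_at_filter eventually_mono)
  qed
  then have "continuous_map (top_of_set E) (Euclidean_space n) (\<lambda>e i. if i < n then C e i else 0)"
    unfolding continuous_map_componentwise_Euclidean_space by auto
  then have c1: "continuous_map (top_of_set E) (Euclidean_space n) C"
    by (rule continuous_map_eq) (use Ceq in auto)
  have c2: "continuous_map (Euclidean_space n) (top_of_set E) T"
    unfolding continuous_map_in_subtopology continuous_map_Euclidean_space_iff
    using T(1,4) by (auto intro: continuous_on_subset)
  have "homeomorphic_maps (top_of_set E) (Euclidean_space n) C T"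
    unfolding homeomorphic_maps_def using c1 c2 C(2) inj by (auto simp: C_def)
  then show ?thesis using that unfolding homeomorphic_space_def by blast
qed

text \<open>Only topology is left of the Lie group: a Euclidean neighbourhood \<open>D\<close> of
  the identity, on which invariance of domain makes \<open>c\<close> open, and a connected one,
  \<open>D2\<close>, contained in every open and closed subgroup. The second is required because an
  open image might still miss components of the group.\<close>

lemma compact_group_endomorphism_surj:
  fixes H :: "'g monoid" and X :: "'g topology"
  assumes H: "group H" and X: "topspace X = carrier H" "compact_space X" "Hausdorff_space X"
    and mult: "continuous_map (prod_topology X X) X (\<lambda>(g, h). g \<otimes>\<^bsub>H\<^esub> h)"
    and D: "openin X D" "\<one>\<^bsub>H\<^esub> \<in> D" "openin (Euclidean_space n) D'"
      "homeomorphic_map (subtopology X D) (subtopology (Euclidean_space n) D') d"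
    and D2: "openin X D2" "\<one>\<^bsub>H\<^esub> \<in> D2" "connectedin X D2"
    and c: "c \<in> hom H H" "continuous_map X X c" "inj_on c (carrier H)"
  shows "c ` carrier H = carrier H"
proof -
  interpret group H by (rule H)
  interpret ch: group_hom H H c by unfold_locales (rule c(1))
  have DX: "D \<subseteq> carrier H" using D(1) X(1) openin_subset by metis
  have cc: "c ` carrier H \<subseteq> carrier H" by auto
  have ltrans: "continuous_map X X (\<lambda>x. a \<otimes>\<^bsub>H\<^esub> x)" if "a \<in> carrier H" for a
  proof -
    have "continuous_map X (prod_topology X X) (\<lambda>x. (a, x))"
      using that X(1) by (intro continuous_map_pairedI) auto
    from continuous_map_compose[OF this mult] show ?thesis by (simp add: o_def)
  qed
  have lopen: "openin X ((\<lambda>x. a \<otimes>\<^bsub>H\<^esub> x) ` O')" if a: "a \<in> carrier H" and O: "openin X O'" for a O'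
  proof -
    have OX: "O' \<subseteq> carrier H" using O X(1) openin_subset by metis
    have "(\<lambda>x. a \<otimes>\<^bsub>H\<^esub> x) ` O' = {x \<in> topspace X. inv\<^bsub>H\<^esub> a \<otimes>\<^bsub>H\<^esub> x \<in> O'}"
    proof (intro subset_antisym subsetI)
      fix x assume "x \<in> (\<lambda>x. a \<otimes>\<^bsub>H\<^esub> x) ` O'"
      then obtain y where y: "y \<in> O'" "x = a \<otimes>\<^bsub>H\<^esub> y" by auto
      then have "inv\<^bsub>H\<^esub> a \<otimes>\<^bsub>H\<^esub> x = y" using a OX inv_solve_left' by (metis subsetD m_closed)
      then show "x \<in> {x \<in> topspace X. inv\<^bsub>H\<^esub> a \<otimes>\<^bsub>H\<^esub> x \<in> O'}" using y OX a X(1) by auto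
    next
      fix x assume "x \<in> {x \<in> topspace X. inv\<^bsub>H\<^esub> a \<otimes>\<^bsub>H\<^esub> x \<in> O'}"
      then show "x \<in> (\<lambda>x. a \<otimes>\<^bsub>H\<^esub> x) ` O'"
        using a X(1) by (intro image_eqI[of _ _ "inv\<^bsub>H\<^esub> a \<otimes>\<^bsub>H\<^esub> x"]) (auto simp: m_assoc[symmetric])
    qed
    then show ?thesis using openin_continuous_map_preimage[OF ltrans[of "inv\<^bsub>H\<^esub> a"] O] a by simp
  qed
  \<comment> \<open>On \<open>D1\<close> both a point and its image lie in \<open>D\<close>, so
    \<open>c\<close> becomes an injective map between subsets of the same Euclidean space, read in
    the single chart \<open>d\<close>.\<close>
  define D1 where "D1 = {x \<in> D. c x \<in> D}"
  have D1: "openin X D1" "\<one>\<^bsub>H\<^esub> \<in> D1"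
  proof -
    have "D1 = D \<inter> {x \<in> topspace X. c x \<in> D}" using DX X(1) by (auto simp: D1_def)
    then show "openin X D1" using openin_continuous_map_preimage[OF c(2) D(1)] D(1) by auto
    show "\<one>\<^bsub>H\<^esub> \<in> D1" using D(2) by (simp add: D1_def)
  qed
  obtain d' where d': "homeomorphic_maps (subtopology X D) (subtopology (Euclidean_space n) D') d d'"
    using D(4) unfolding homeomorphic_map_maps by blast
  have tD: "topspace (subtopology X D) = D" using D(1) by (simp add: inf.absorb2 openin_subset)
  have tD': "topspace (subtopology (Euclidean_space n) D') = D'"
    using D(3) by (simp add: inf.absorb2 openin_subset)
  have dd: "d' (d x) = x" "d x \<in> D'" if "x \<in> D" for x
    using d' that tD tD' unfolding homeomorphic_maps_def continuous_map_def by auto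
  have dd': "d (d' y) = y" "d' y \<in> D" if "y \<in> D'" for y
    using d' that tD tD' unfolding homeomorphic_maps_def continuous_map_def by auto
  have opn1: "openin X (c ` O')" if O: "openin X O'" "O' \<subseteq> D1" for O'
  proof -
    have OD: "O' \<subseteq> D" "c ` O' \<subseteq> D" using O(2) by (auto simp: D1_def)
    have "openin (subtopology X D) O'" using O(1) OD(1) by (simp add: subset_openin_subtopology)
    then have "openin (subtopology (Euclidean_space n) D') (d ` O')"
      using D(4) homeomorphic_map_openness_eq homeomorphic_imp_open_map open_map_def by blast
    then have o1: "openin (Euclidean_space n) (d ` O')" using D(3) by (simp add: openin_open_subtopology)
    have sub: "d ` O' \<subseteq> D'" using dd OD by auto
    have "continuous_map (subtopology (Euclidean_space n) (d ` O')) X d'"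
      using d' sub unfolding homeomorphic_maps_def
      by (meson continuous_map_from_subtopology_mono continuous_map_in_subtopology)
    then have "continuous_map (subtopology (Euclidean_space n) (d ` O')) X (c \<circ> d')"
      by (rule continuous_map_compose[OF _ c(2)])
    moreover have "(c \<circ> d') ` (d ` O') \<subseteq> D" using OD dd by (auto simp: subset_iff)
    ultimately have "continuous_map (subtopology (Euclidean_space n) (d ` O')) (subtopology X D) (c \<circ> d')"
      by (auto simp: continuous_map_in_subtopology)
    moreover have "continuous_map (subtopology X D) (Euclidean_space n) d"
      using d' unfolding homeomorphic_maps_def by (simp add: continuous_map_in_subtopology)
    ultimately have "continuous_map (subtopology (Euclidean_space n) (d ` O')) (Euclidean_space n) (d \<circ> (c \<circ> d'))"
      by (rule continuous_map_compose)
    moreover have "inj_on (d \<circ> (c \<circ> d')) (d ` O')"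
    proof (rule inj_onI)
      fix x y assume "x \<in> d ` O'" "y \<in> d ` O'" and eq: "(d \<circ> (c \<circ> d')) x = (d \<circ> (c \<circ> d')) y"
      then obtain x' y' where xy: "x' \<in> O'" "x = d x'" "y' \<in> O'" "y = d y'" by auto
      then have "d (c x') = d (c y')" using eq OD dd(1) by (auto simp: subset_iff)
      then have "c x' = c y'" using dd(1) xy OD by (metis imageI subsetD)
      then have "x' = y'" using c(3) xy OD DX by (auto dest: inj_onD)
      then show "x = y" using xy by simp
    qed
    ultimately have "openin (Euclidean_space n) ((d \<circ> (c \<circ> d')) ` (d ` O'))"
      using invariance_of_domain_Euclidean_space[OF o1] by blast
    moreover have im: "(d \<circ> (c \<circ> d')) ` (d ` O') = d ` (c ` O')"
      using OD dd(1) by (force simp: image_iff)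
    ultimately have "openin (subtopology (Euclidean_space n) D') (d ` (c ` O'))"
      using OD dd(2) by (intro subset_openin_subtopology) auto
    then have "openin (subtopology X D) (c ` O')"
      using homeomorphic_map_openness[OF D(4), of "c ` O'"] OD tD by auto
    then show ?thesis using D(1) by (simp add: openin_open_subtopology)
  qed
  have opn: "openin X (c ` O')" if O: "openin X O'" for O'
  proof (subst openin_subopen, intro ballI)
    fix y assume "y \<in> c ` O'"
    then obtain h where h: "h \<in> O'" "y = c h" by auto
    have OX: "O' \<subseteq> carrier H" using O X(1) openin_subset by metis
    then have hH: "h \<in> carrier H" using h by auto
    define O1 where "O1 = D1 \<inter> {x \<in> topspace X. h \<otimes>\<^bsub>H\<^esub> x \<in> O'}"
    have "openin X O1" unfolding O1_def
      using D1(1) openin_continuous_map_preimage[OF ltrans[OF hH] O] by blast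
    then have "openin X (c ` O1)" by (rule opn1) (simp add: O1_def)
    then have "openin X ((\<lambda>x. c h \<otimes>\<^bsub>H\<^esub> x) ` (c ` O1))" using hH by (intro lopen) auto
    moreover have "(\<lambda>x. c h \<otimes>\<^bsub>H\<^esub> x) ` (c ` O1) \<subseteq> c ` O'"
    proof
      fix z assume "z \<in> (\<lambda>x. c h \<otimes>\<^bsub>H\<^esub> x) ` (c ` O1)"
      then obtain x where x: "x \<in> O1" "z = c h \<otimes>\<^bsub>H\<^esub> c x" by auto
      then have "z = c (h \<otimes>\<^bsub>H\<^esub> x)" using hH X(1) by (simp add: O1_def)
      then show "z \<in> c ` O'" using x by (auto simp: O1_def)
    qed
    moreover have "y \<in> (\<lambda>x. c h \<otimes>\<^bsub>H\<^esub> x) ` (c ` O1)"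
    proof (rule image_eqI)
      show "y = c h \<otimes>\<^bsub>H\<^esub> c \<one>\<^bsub>H\<^esub>" using h hH by simp
      show "c \<one>\<^bsub>H\<^esub> \<in> c ` O1" using D1(2) h hH X(1) by (intro imageI) (simp add: O1_def)
    qed
    ultimately show "\<exists>T. openin X T \<and> y \<in> T \<and> T \<subseteq> c ` O'" by blast
  qed
  \<comment> \<open>The subgroups \<open>I k\<close> are open and closed, so each contains the connected set \<open>D2\<close>, and finitely
    many translates of \<open>D2\<close> cover the group. If \<open>h\<close> is not in the image of \<open>c\<close>, two iterates of \<open>h\<close> lie in
    the same translate, although they differ modulo some \<open>I k\<close>.\<close>
  define I where "I = (\<lambda>k. (c ^^ k) ` carrier H)"
  have ckc: "(c ^^ k) x \<in> carrier H" if "x \<in> carrier H" for k x using that by (induction k) auto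
  have ckm: "(c ^^ k) (x \<otimes>\<^bsub>H\<^esub> y) = (c ^^ k) x \<otimes>\<^bsub>H\<^esub> (c ^^ k) y" if "x \<in> carrier H" "y \<in> carrier H" for k x y
    using that ckc by (induction k) auto
  have cki: "inj_on (c ^^ k) (carrier H)" for k
  proof (induction k)
    case (Suc k)
    have "inj_on (c \<circ> (c ^^ k)) (carrier H)"
      by (rule comp_inj_on[OF Suc inj_on_subset[OF c(3)]]) (use ckc in auto)
    then show ?case by (simp add: o_def)
  qed auto
  have sub: "subgroup (I k) H" for k
  proof -
    have "group_hom H H (c ^^ k)"
      by unfold_locales (use ckc ckm in \<open>auto simp: hom_def\<close>)
    then show ?thesis unfolding I_def by (rule group_hom.img_is_subgroup)
  qed
  have Iopen: "openin X (I k)" for k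
  proof (induction k)
    case 0
    then show ?case using X(1) openin_topspace[of X] by (simp add: I_def)
  next
    case (Suc k)
    then have "openin X (c ` I k)" by (rule opn)
    then show ?case by (simp add: I_def image_comp)
  qed
  have Icomp: "compactin X (I k)" for k
  proof (induction k)
    case 0
    then show ?case using X by (simp add: I_def compact_space_def)
  next
    case (Suc k)
    then have "compactin X (c ` I k)" using c(2) image_compactin by blast
    then show ?case by (simp add: I_def image_comp)
  qed
  have Iclosed: "closedin X (I k)" for k using Icomp X(3) compactin_imp_closedin by blast
  have D2I: "D2 \<subseteq> I k" for k
  proof -
    have "\<one>\<^bsub>H\<^esub> \<in> D2 \<inter> I k" using D2(2) sub subgroup.one_closed by blast
    then show ?thesis using connectedin_clopen_cases[OF D2(3) Iclosed[of k] Iopen[of k]]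
      by (auto simp: disjnt_def)
  qed
  have D2H: "D2 \<subseteq> carrier H" using D2(1) X(1) openin_subset by metis
  have "\<exists>\<F>. finite \<F> \<and> \<F> \<subseteq> (\<lambda>a. (\<lambda>x. a \<otimes>\<^bsub>H\<^esub> x) ` D2) ` carrier H \<and> topspace X \<subseteq> \<Union>\<F>"
  proof (rule X(2)[unfolded compact_space_alt, rule_format], intro conjI ballI)
    show "topspace X \<subseteq> \<Union> ((\<lambda>a. (\<lambda>x. a \<otimes>\<^bsub>H\<^esub> x) ` D2) ` carrier H)"
    proof
      fix x assume "x \<in> topspace X"
      then have "x \<in> carrier H" "x = x \<otimes>\<^bsub>H\<^esub> \<one>\<^bsub>H\<^esub>" using X(1) by auto
      then show "x \<in> \<Union> ((\<lambda>a. (\<lambda>x. a \<otimes>\<^bsub>H\<^esub> x) ` D2) ` carrier H)" using D2(2) by blast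
    qed
  qed (use lopen[OF _ D2(1)] in auto)
  then obtain \<F> where \<F>: "finite \<F>" "\<F> \<subseteq> (\<lambda>a. (\<lambda>x. a \<otimes>\<^bsub>H\<^esub> x) ` D2) ` carrier H" "carrier H \<subseteq> \<Union>\<F>"
    unfolding X(1) by blast
  obtain A where A: "A \<subseteq> carrier H" "finite A" "\<F> = (\<lambda>a. (\<lambda>x. a \<otimes>\<^bsub>H\<^esub> x) ` D2) ` A"
    using finite_subset_image[OF \<F>(1,2)] by blast
  have A: "finite A" "A \<subseteq> carrier H" "carrier H \<subseteq> (\<Union>a\<in>A. (\<lambda>x. a \<otimes>\<^bsub>H\<^esub> x) ` D2)"
    using A \<F>(3) by auto
  show ?thesis
  proof (rule ccontr)
    assume "c ` carrier H \<noteq> carrier H"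
    then obtain h where h: "h \<in> carrier H" "h \<notin> c ` carrier H" using cc by blast
    have "\<forall>k. \<exists>a\<in>A. (c ^^ k) h \<in> (\<lambda>x. a \<otimes>\<^bsub>H\<^esub> x) ` D2" using A(3) ckc[OF h(1)] by blast
    then obtain a where a: "\<And>k. a k \<in> A" "\<And>k::nat. (c ^^ k) h \<in> (\<lambda>x. a k \<otimes>\<^bsub>H\<^esub> x) ` D2" by metis
    have "\<not> inj a" using A(1) a(1) by (meson finite_subset image_subset_iff infinite_UNIV_nat finite_imageD)
    then obtain m k where mk: "m < k" "a m = a k" by (metis linorder_injI)
    obtain u v where uv: "u \<in> D2" "v \<in> D2" "(c ^^ m) h = a k \<otimes>\<^bsub>H\<^esub> u" "(c ^^ k) h = a k \<otimes>\<^bsub>H\<^esub> v"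
      using a(2)[of m] a(2)[of k] mk(2) by auto
    have car: "a k \<in> carrier H" "u \<in> carrier H" "v \<in> carrier H" using uv D2H a(1) A(2) by auto
    \<comment> \<open>The strict inequality \<open>m < k\<close> is what leaves at least
      \<open>Suc m\<close> applications of \<open>c\<close>.\<close>
    have "(c ^^ k) h \<in> I (Suc m)"
    proof -
      have "k = Suc m + (k - Suc m)" using mk(1) by simp
      then have "(c ^^ k) h = (c ^^ Suc m) ((c ^^ (k - Suc m)) h)"
        by (metis comp_apply funpow_add)
      then show ?thesis using ckc[OF h(1)] unfolding I_def by blast
    qed
    moreover have "(c ^^ m) h = (c ^^ k) h \<otimes>\<^bsub>H\<^esub> (inv\<^bsub>H\<^esub> v \<otimes>\<^bsub>H\<^esub> u)"
      unfolding uv using car by (simp add: m_assoc[symmetric]) (simp add: m_assoc)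
    moreover have "u \<in> I (Suc m)" "v \<in> I (Suc m)" using D2I uv by auto
    ultimately have "(c ^^ m) h \<in> I (Suc m)"
      using subgroup.m_closed[OF sub] subgroup.m_inv_closed[OF sub] by metis
    then obtain x where x: "x \<in> carrier H" "(c ^^ m) h = (c ^^ Suc m) x" unfolding I_def by auto
    then have "(c ^^ m) h = (c ^^ m) (c x)" by (simp add: funpow_swap1)
    then have "h = c x" using inj_onD[OF cki[of m]] h(1) x(1) by auto
    then show False using h(2) x(1) by auto
  qed
qed

lemma convex_connected_lcs:
  fixes S :: "'e::locally_convex_space set"
  assumes "convex S"
  shows "connected S"
proof (cases "S = {}")
  case False
  then obtain x where x: "x \<in> S" by blast
  let ?seg = "\<lambda>y. (\<lambda>t::real. (1 - t) *\<^sub>R x + t *\<^sub>R y) ` {0..1}"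
  have "S = \<Union>(?seg ` S)"
  proof (intro subset_antisym subsetI)
    fix y assume "y \<in> S"
    moreover have "y \<in> ?seg y" by (intro image_eqI[of _ _ 1]) auto
    ultimately show "y \<in> \<Union>(?seg ` S)" by blast
  next
    fix y assume "y \<in> \<Union>(?seg ` S)"
    then show "y \<in> S" using assms x by (auto intro!: convexD)
  qed
  moreover have "connected (\<Union>(?seg ` S))"
  proof (rule connected_Union)
    have "x \<in> ?seg y" for y by (intro image_eqI[of _ _ 0]) auto
    then show "\<Inter>(?seg ` S) \<noteq> {}" by blast
    fix s assume "s \<in> ?seg ` S"
    then obtain y where "s = ?seg y" by auto
    moreover have "connected (?seg y)"
      by (rule connected_continuous_image) (intro continuous_intros, simp)
    ultimately show "connected s" by simp
  qed
  ultimately show ?thesis by simp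
qed auto

text \<open>A chart at the identity supplies both neighbourhoods. It carries a compact neighbourhood
  of the identity to one in the model space \<open>E\<close>, which is thereby locally compact and
  homeomorphic to some Euclidean space; a convex neighbourhood in the chart supplies the connected
  one.\<close>

lemma compact_lie_group_endomorphism_surj:
  fixes H :: "'g monoid" and HM :: "('g, 'e::locally_convex_space) manifold"
  assumes H: "lie_group H HM" and comp: "compact_space (mtop HM)"
    and c: "c \<in> hom H H" "continuous_map (mtop HM) (mtop HM) c" "inj_on c (carrier H)"
  shows "c ` carrier H = carrier H"
proof -
  define X where "X = mtop HM"
  have grp: "group H" and sm: "smooth_manifold HM" and tX: "topspace X = carrier H"
    and mult: "continuous_map (prod_topology X X) X (\<lambda>(g, h). g \<otimes>\<^bsub>H\<^esub> h)"
    using H by (auto simp: lie_group_def smooth_map_def prod_manifold_def X_def)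
  interpret group H by (rule grp)
  have haus: "Hausdorff_space X" using sm by (simp add: smooth_manifold_def X_def)
  obtain ch where ch: "ch \<in> matlas HM" "\<one>\<^bsub>H\<^esub> \<in> cdom ch"
    using sm tX unfolding smooth_manifold_def X_def by (metis UN_iff one_closed)
  define D where "D = cdom ch"
  define h where "h = cmap ch"
  define E where "E = cspace ch"
  have D: "openin X D" and mE: "model_space E" and hD: "openin (top_of_set E) (h ` D)"
    and hom: "homeomorphic_map (subtopology X D) (top_of_set (h ` D)) h"
    using sm ch(1) unfolding smooth_manifold_def is_chart_def X_def D_def h_def E_def by auto
  have sE: "subspace E" using mE by (simp add: model_space_def)
  have tD: "topspace (subtopology X D) = D" using D by (simp add: inf.absorb2 openin_subset)
  have oneD: "\<one>\<^bsub>H\<^esub> \<in> D" using ch(2) by (simp add: D_def)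
  have hE: "h ` D \<subseteq> E" using hD openin_imp_subset by blast
  obtain g where g: "homeomorphic_maps (subtopology X D) (top_of_set (h ` D)) h g"
    using hom unfolding homeomorphic_map_maps by blast
  have gh: "g (h x) = x" if "x \<in> D" for x using g that tD unfolding homeomorphic_maps_def by auto
  have reg: "regular_space X"
    using comp haus compact_Hausdorff_imp_regular_space by (simp add: X_def)
  \<comment> \<open>Regularity separates the identity from the complement of the chart domain and so
    gives a closed, hence compact, neighbourhood \<open>C\<close> of the identity inside
    \<open>D\<close>.\<close>
  have "closedin X (topspace X - D) \<and> \<one>\<^bsub>H\<^esub> \<in> topspace X - (topspace X - D)"
    using closedin_diff[OF closedin_topspace D] oneD tX by simp
  from reg[unfolded regular_space_def, rule_format, OF this]
  obtain U V where UV: "openin X U" "openin X V" "\<one>\<^bsub>H\<^esub> \<in> U" "topspace X - D \<subseteq> V" "disjnt U V"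
    by auto
  define C where "C = topspace X - V"
  have UC: "openin X U" "closedin X C" "\<one>\<^bsub>H\<^esub> \<in> U" "U \<subseteq> C" "C \<subseteq> D"
    using UV openin_subset[OF UV(1)] by (auto simp: C_def disjnt_iff)
  have "compactin X C" using UC(2) comp closedin_compact_space by (auto simp: X_def)
  then have "compactin (subtopology X D) C" using UC(5) by (simp add: compactin_subtopology)
  then have "compactin (top_of_set (h ` D)) (h ` C)"
    using hom homeomorphic_imp_continuous_map image_compactin by blast
  then have hC: "compact (h ` C)" by (simp add: compactin_subtopology)
  have "openin (subtopology X D) U" using UC by (intro subset_openin_subtopology) auto
  then have "openin (top_of_set (h ` D)) (h ` U)"
    using hom homeomorphic_imp_open_map open_map_def by blast
  then have "openin (top_of_set E) (h ` U)" using hD by (rule openin_trans)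
  then obtain O1 where O1: "open O1" "h ` U = E \<inter> O1" by (auto simp: openin_open)
  let ?a = "h \<one>\<^bsub>H\<^esub>"
  have aE: "?a \<in> E" using hE oneD by auto
  obtain n where "top_of_set E homeomorphic_space Euclidean_space n"
  proof (rule locally_compact_homeomorphic_Euclidean[OF sE])
    show "compact ((\<lambda>x. x - ?a) ` (h ` C))"
      by (rule compact_continuous_image[OF _ hC])
         (intro continuous_on_diff_lcs continuous_on_const continuous_on_id)
    show "(\<lambda>x. x - ?a) ` (h ` C) \<subseteq> E" using hE UC(5) aE sE by (auto intro!: subspace_diff)
    have "continuous_on UNIV (\<lambda>x. x + ?a)"
      by (intro continuous_on_plus_lcs continuous_on_const continuous_on_id)
    from open_vimage[OF O1(1) this] show "open ((\<lambda>x. x + ?a) -` O1)" .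
    show "0 \<in> (\<lambda>x. x + ?a) -` O1" using O1(2) UC(3) by auto
    show "(\<lambda>x. x + ?a) -` O1 \<inter> E \<subseteq> (\<lambda>x. x - ?a) ` (h ` C)"
    proof
      fix x assume x: "x \<in> (\<lambda>x. x + ?a) -` O1 \<inter> E"
      then have "x + ?a \<in> h ` U" using O1(2) aE sE by (auto intro: subspace_add)
      then have "x + ?a \<in> h ` C" using UC(4) by auto
      then show "x \<in> (\<lambda>x. x - ?a) ` (h ` C)" by (rule rev_image_eqI) simp
    qed
  qed
  then obtain q where q: "homeomorphic_map (top_of_set E) (Euclidean_space n) q"
    using homeomorphic_space by blast
  have hq: "openin (Euclidean_space n) (q ` (h ` D))"
    using q hD homeomorphic_imp_open_map open_map_def by blast
  have "homeomorphic_map (subtopology (top_of_set E) (h ` D)) (subtopology (Euclidean_space n) (q ` (h ` D))) q"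
    by (rule homeomorphic_map_subtopologies[OF q]) (use hE homeomorphic_imp_surjective_map[OF q] in auto)
  moreover have "subtopology (top_of_set E) (h ` D) = top_of_set (h ` D)"
    using hE by (simp add: subtopology_subtopology inf.absorb2)
  ultimately have qh: "homeomorphic_map (subtopology X D) (subtopology (Euclidean_space n) (q ` (h ` D))) (q \<circ> h)"
    using homeomorphic_map_compose[OF hom] by simp
  obtain O2 where O2: "open O2" "h ` D = E \<inter> O2" using hD by (auto simp: openin_open)
  obtain N where N: "open N" "convex N" "?a \<in> N" "N \<subseteq> O2" using convex_nbhd[OF O2(1), of ?a] O2(2) oneD by blast
  have NE: "N \<inter> E \<subseteq> h ` D" using N(4) O2(2) by auto
  have gN: "g ` (N \<inter> E) = {x \<in> D. h x \<in> N}"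
    using NE gh hE by (force simp: image_iff)
  have "connected (N \<inter> E)" using N(2) subspace_imp_convex[OF sE] by (intro convex_connected_lcs convex_Int)
  then have "connectedin (top_of_set (h ` D)) (N \<inter> E)" using NE by (simp add: connectedin_subtopology)
  moreover have "continuous_map (top_of_set (h ` D)) X g"
    using g unfolding homeomorphic_maps_def by (simp add: continuous_map_in_subtopology)
  ultimately have "connectedin X (g ` (N \<inter> E))" by (rule connectedin_continuous_map_image[rotated])
  moreover have "openin X (g ` (N \<inter> E))"
  proof -
    have "continuous_map (subtopology X D) euclidean h"
      using homeomorphic_imp_continuous_map[OF hom] by (simp add: continuous_map_in_subtopology)
    then have "openin (subtopology X D) {x \<in> topspace (subtopology X D). h x \<in> N}"
      by (rule openin_continuous_map_preimage) (use N(1) in simp)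
    then show ?thesis unfolding gN tD using D openin_open_subtopology by blast
  qed
  moreover have "\<one>\<^bsub>H\<^esub> \<in> g ` (N \<inter> E)" unfolding gN using oneD N(3) by simp
  ultimately show ?thesis
    using compact_group_endomorphism_surj[OF grp tX comp[folded X_def] haus mult D oneD hq qh _ _ _ c(1) c(2)[folded X_def] c(3)]
    by blast
qed

section \<open>Smooth maps into manifolds\<close>

abbreviation chart_inv :: "('a, 'e) chart \<Rightarrow> 'e \<Rightarrow> 'a" where
  "chart_inv c \<equiv> inv_into (cdom c) (cmap c)"

lemma topspace_open_subtopology: "openin X D \<Longrightarrow> topspace (subtopology X D) = D"
  by (simp add: inf.absorb2 openin_subset)

lemma is_chart_maps:
  assumes "is_chart X c"
  shows "homeomorphic_maps (subtopology X (cdom c)) (top_of_set (cmap c ` cdom c)) (cmap c) (chart_inv c)"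
proof -
  have op: "openin X (cdom c)" and hom: "homeomorphic_map (subtopology X (cdom c)) (top_of_set (cmap c ` cdom c)) (cmap c)"
    using assms by (auto simp: is_chart_def)
  note top = topspace_open_subtopology[OF op]
  obtain g where g: "homeomorphic_maps (subtopology X (cdom c)) (top_of_set (cmap c ` cdom c)) (cmap c) g"
    using hom unfolding homeomorphic_map_maps by blast
  have inj: "inj_on (cmap c) (cdom c)" using homeomorphic_imp_injective_map[OF hom] top by simp
  have "g y = chart_inv c y" if "y \<in> cmap c ` cdom c" for y
    using that g inj top unfolding homeomorphic_maps_def by auto
  then show ?thesis
    using homeomorphic_maps_eq[OF g, of "cmap c" "chart_inv c"] by simp
qed

lemma is_chart_inj: "is_chart X c \<Longrightarrow> inj_on (cmap c) (cdom c)"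
  unfolding is_chart_def using homeomorphic_imp_injective_map topspace_open_subtopology by metis

lemma chart_inv_cmap: "is_chart X c \<Longrightarrow> x \<in> cdom c \<Longrightarrow> chart_inv c (cmap c x) = x"
  by (simp add: is_chart_inj)

lemma is_chart_cspace: "is_chart X c \<Longrightarrow> cmap c ` cdom c \<subseteq> cspace c"
  unfolding is_chart_def using openin_imp_subset by blast

lemma chart_image_open:
  assumes "is_chart X c" "openin X D"
  shows "openin (top_of_set (cspace c)) (cmap c ` (cdom c \<inter> D))"
proof -
  have c: "openin X (cdom c)" "openin (top_of_set (cspace c)) (cmap c ` cdom c)"
    "homeomorphic_map (subtopology X (cdom c)) (top_of_set (cmap c ` cdom c)) (cmap c)"
    using assms(1) by (auto simp: is_chart_def)
  have "openin (subtopology X (cdom c)) (cdom c \<inter> D)"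
    using c(1) assms(2) by (intro subset_openin_subtopology) auto
  then have "openin (top_of_set (cmap c ` cdom c)) (cmap c ` (cdom c \<inter> D))"
    using c(3) homeomorphic_imp_open_map open_map_def by blast
  then show ?thesis using c(2) by (rule openin_trans)
qed

lemma is_chartI:
  assumes "openin X D" "model_space F" "openin (top_of_set F) V"
    "homeomorphic_maps (subtopology X D) (top_of_set V) h k"
  shows "is_chart X \<lparr>cdom = D, cmap = h, cspace = F\<rparr>" "h ` D = V"
proof -
  have hom: "homeomorphic_map (subtopology X D) (top_of_set V) h"
    using assms(4) homeomorphic_map_maps by blast
  show hV: "h ` D = V"
    using homeomorphic_imp_surjective_map[OF hom] topspace_open_subtopology[OF assms(1)] by simp
  show "is_chart X \<lparr>cdom = D, cmap = h, cspace = F\<rparr>"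
    using assms hom by (simp add: is_chart_def hV)
qed

text \<open>The part of \<open>smooth_manifold\<close> on which composition with
  \<open>smooth_into\<close> rests. With it, submanifolds and products enter compositions before
  smoothness of their transition maps has been examined.\<close>

definition chart_cover :: "('a, 'e::locally_convex_space) manifold \<Rightarrow> bool" where
  "chart_cover M \<longleftrightarrow> (\<forall>c\<in>matlas M. is_chart (mtop M) c) \<and> (\<Union>c\<in>matlas M. cdom c) = topspace (mtop M)"

lemma chart_cover_is_chart: "chart_cover M \<Longrightarrow> c \<in> matlas M \<Longrightarrow> is_chart (mtop M) c"
  by (simp add: chart_cover_def)

lemma chart_cover_openin: "chart_cover M \<Longrightarrow> c \<in> matlas M \<Longrightarrow> openin (mtop M) (cdom c)"
  by (simp add: chart_cover_def is_chart_def)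

lemma chart_cover_obtain:
  assumes "chart_cover M" "x \<in> topspace (mtop M)"
  obtains c where "c \<in> matlas M" "x \<in> cdom c"
  using assms unfolding chart_cover_def by (metis UN_iff)

lemma smooth_manifold_chart_cover: "smooth_manifold M \<Longrightarrow> chart_cover M"
  by (simp add: smooth_manifold_def chart_cover_def)

lemma smooth_manifold_max_atlas: "smooth_manifold M \<Longrightarrow> c \<in> matlas M \<Longrightarrow> c \<in> max_atlas M"
  by (simp add: smooth_manifold_def max_atlas_def)

lemma max_atlas_is_chart: "c \<in> max_atlas M \<Longrightarrow> is_chart (mtop M) c"
  by (simp add: max_atlas_def)

lemma smooth_on_cong:
  assumes "model_space E" "openin (top_of_set E) U" "smooth_on E U g" "\<And>x. x \<in> U \<Longrightarrow> f x = g x"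
  shows "smooth_on E U f"
  using assms by (intro smooth_on_local[OF assms(1)] exI[of _ U] exI[of _ g]) auto

section \<open>Smoothness along maps from model spaces\<close>

lemma openin_preimage:
  assumes "openin (top_of_set E) U" "continuous_map (top_of_set U) X k" "openin X D"
  shows "openin (top_of_set E) (U \<inter> k -` D)"
proof -
  have "openin (top_of_set U) {x \<in> topspace (top_of_set U). k x \<in> D}"
    by (rule openin_continuous_map_preimage[OF assms(2,3)])
  moreover have "{x \<in> topspace (top_of_set U). k x \<in> D} = U \<inter> k -` D" by auto
  ultimately show ?thesis using assms(1) openin_trans by metis
qed

text \<open>Testing smoothness on maps that start in a model space avoids all charts of the source.\<close>

definition smooth_into ::
    "'e::locally_convex_space set \<Rightarrow> 'e set \<Rightarrow> ('a, 'f::locally_convex_space) manifold \<Rightarrow> ('e \<Rightarrow> 'a) \<Rightarrow> bool" where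
  "smooth_into E U M k \<longleftrightarrow> model_space E \<and> openin (top_of_set E) U \<and>
     continuous_map (top_of_set U) (mtop M) k \<and>
     (\<forall>c\<in>matlas M. smooth_on E (U \<inter> k -` cdom c) (\<lambda>x. cmap c (k x)))"

lemma smooth_intoD:
  assumes "smooth_into E U M k"
  shows "model_space E" "openin (top_of_set E) U" "continuous_map (top_of_set U) (mtop M) k"
    "c \<in> matlas M \<Longrightarrow> smooth_on E (U \<inter> k -` cdom c) (\<lambda>x. cmap c (k x))"
    "x \<in> U \<Longrightarrow> k x \<in> topspace (mtop M)"
  using assms by (auto simp: smooth_into_def continuous_map_def)

text \<open>Near a point, \<open>g\<close> after \<open>k\<close> factors through any chart
  \<open>c\<close> around its image as \<open>g \<circ> chart_inv c\<close> after
  \<open>cmap c \<circ> k\<close>. The chain rule and locality are used once here and inherited by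
  the facts on \<open>smooth_into\<close> below.\<close>

lemma smooth_on_through_charts:
  assumes k: "smooth_into E U M k" and M: "chart_cover M" and D: "openin (mtop M) D"
    and g: "\<And>c. c \<in> matlas M \<Longrightarrow> smooth_on (cspace c) (cmap c ` (cdom c \<inter> D)) (\<lambda>y. g (chart_inv c y))"
  shows "smooth_on E (U \<inter> k -` D) (\<lambda>x. g (k x))"
proof (rule smooth_on_local)
  show E: "model_space E" using smooth_intoD(1)[OF k] .
  fix x assume x: "x \<in> U \<inter> k -` D"
  obtain c where c: "c \<in> matlas M" "k x \<in> cdom c"
    using chart_cover_obtain[OF M] smooth_intoD(5)[OF k] x by blast
  note ic = chart_cover_is_chart[OF M c(1)]
  let ?W = "U \<inter> k -` (cdom c \<inter> D)"
  have W: "openin (top_of_set E) ?W"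
    using openin_preimage[OF smooth_intoD(2,3)[OF k]] chart_cover_openin[OF M c(1)] D by blast
  have 1: "smooth_on E ?W (\<lambda>x. cmap c (k x))"
    by (rule smooth_on_subspace[OF smooth_intoD(4)[OF k c(1)]]) auto
  have "smooth_on E ?W (\<lambda>x. g (chart_inv c (cmap c (k x))))"
    by (rule smooth_on_compose[OF E W 1 _ chart_image_open[OF ic D] g[OF c(1)]])
       (use ic in \<open>auto simp: is_chart_def\<close>)
  moreover have "\<forall>y\<in>?W. g (k y) = g (chart_inv c (cmap c (k y)))"
    using chart_inv_cmap[OF ic] by auto
  ultimately show "\<exists>W h. openin (top_of_set E) W \<and> x \<in> W \<and> smooth_on E W h \<and> (\<forall>y\<in>W. g (k y) = h y)"
    using W x c(2) by (intro exI[of _ ?W] exI[of _ "\<lambda>x. g (chart_inv c (cmap c (k x)))"]) auto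
qed

lemma smooth_into_compose:
  assumes k: "smooth_into E U M k" and M: "chart_cover M" and N: "chart_cover N" and f: "smooth_map M N f"
  shows "smooth_into E U N (\<lambda>x. f (k x))"
  unfolding smooth_into_def
proof (intro conjI ballI)
  have cf: "continuous_map (mtop M) (mtop N) f" using f by (simp add: smooth_map_def)
  show "continuous_map (top_of_set U) (mtop N) (\<lambda>x. f (k x))"
    using continuous_map_compose[OF smooth_intoD(3)[OF k] cf] by (simp add: o_def)
  fix d assume d: "d \<in> matlas N"
  let ?D = "{x \<in> topspace (mtop M). f x \<in> cdom d}"
  have D: "openin (mtop M) ?D"
    by (rule openin_continuous_map_preimage[OF cf chart_cover_openin[OF N d]])
  have "smooth_on E (U \<inter> k -` ?D) (\<lambda>x. (\<lambda>y. cmap d (f y)) (k x))"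
  proof (rule smooth_on_through_charts[OF k M D])
    fix c assume c: "c \<in> matlas M"
    have "cdom c \<inter> ?D = cdom c \<inter> f -` cdom d"
      using openin_subset[OF chart_cover_openin[OF M c]] by auto
    then show "smooth_on (cspace c) (cmap c ` (cdom c \<inter> ?D)) (\<lambda>y. cmap d (f (chart_inv c y)))"
      using f c d by (simp add: smooth_map_def o_def)
  qed
  moreover have "U \<inter> k -` ?D = U \<inter> (\<lambda>x. f (k x)) -` cdom d" using smooth_intoD(5)[OF k] by auto
  ultimately show "smooth_on E (U \<inter> (\<lambda>x. f (k x)) -` cdom d) (\<lambda>x. cmap d (f (k x)))" by simp
qed (use smooth_intoD[OF k] in auto)

lemma smooth_into_max_atlas:
  assumes k: "smooth_into E U M k" and M: "chart_cover M" and c: "c \<in> max_atlas M"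
  shows "smooth_on E (U \<inter> k -` cdom c) (\<lambda>x. cmap c (k x))"
proof (rule smooth_on_through_charts[OF k M])
  show "openin (mtop M) (cdom c)" using max_atlas_is_chart[OF c] by (simp add: is_chart_def)
  fix d assume "d \<in> matlas M"
  then show "smooth_on (cspace d) (cmap d ` (cdom d \<inter> cdom c)) (\<lambda>y. cmap c (chart_inv d y))"
    using c by (simp add: max_atlas_def smooth_transition_def o_def)
qed

lemma smooth_into_chart_inv:
  assumes c: "c \<in> max_atlas M"
  shows "smooth_into (cspace c) (cmap c ` cdom c) M (chart_inv c)"
  unfolding smooth_into_def
proof (intro conjI ballI)
  note ic = max_atlas_is_chart[OF c]
  show "model_space (cspace c)" "openin (top_of_set (cspace c)) (cmap c ` cdom c)"
    using ic by (auto simp: is_chart_def)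
  show "continuous_map (top_of_set (cmap c ` cdom c)) (mtop M) (chart_inv c)"
    using is_chart_maps[OF ic] by (simp add: homeomorphic_maps_def continuous_map_in_subtopology)
  fix d assume d: "d \<in> matlas M"
  have "cmap c ` cdom c \<inter> chart_inv c -` cdom d = cmap c ` (cdom c \<inter> cdom d)"
    using chart_inv_cmap[OF ic] by auto
  then show "smooth_on (cspace c) (cmap c ` cdom c \<inter> chart_inv c -` cdom d) (\<lambda>x. cmap d (chart_inv c x))"
    using c d by (simp add: max_atlas_def smooth_transition_def o_def)
qed

lemma smooth_into_restrict:
  assumes "smooth_into E U M k" "model_space F" "F \<subseteq> E" "openin (top_of_set F) W" "W \<subseteq> U"
  shows "smooth_into F W M k"
  unfolding smooth_into_def
proof (intro conjI ballI)
  show "continuous_map (top_of_set W) (mtop M) k"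
    by (rule continuous_map_from_subtopology_mono[OF smooth_intoD(3)[OF assms(1)] assms(5)])
  fix c assume "c \<in> matlas M"
  from smooth_intoD(4)[OF assms(1) this]
  show "smooth_on F (W \<inter> k -` cdom c) (\<lambda>x. cmap c (k x))"
    by (rule smooth_on_subspace[OF _ assms(3)]) (use assms(5) in auto)
qed (use assms in auto)

lemma smooth_into_const:
  assumes "model_space E" "openin (top_of_set E) U" "x \<in> topspace (mtop M)" "chart_cover M"
  shows "smooth_into E U M (\<lambda>_. x)"
  unfolding smooth_into_def
proof (intro conjI ballI)
  show cont: "continuous_map (top_of_set U) (mtop M) (\<lambda>_. x)" using assms(3) by simp
  fix c assume "c \<in> matlas M"
  then have "openin (top_of_set E) (U \<inter> (\<lambda>_. x) -` cdom c)"
    using openin_preimage[OF assms(2) cont] chart_cover_openin[OF assms(4)] by blast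
  then show "smooth_on E (U \<inter> (\<lambda>_. x) -` cdom c) (\<lambda>_. cmap c x)"
    by (rule smooth_on_const[OF assms(1)])
qed (use assms in auto)

section \<open>Products\<close>

lemma mtop_prod_manifold [simp]: "mtop (prod_manifold M N) = prod_topology (mtop M) (mtop N)"
  by (simp add: prod_manifold_def)

lemma mtop_submanifold_of [simp]: "mtop (submanifold_of M A) = subtopology (mtop M) A"
  by (simp add: submanifold_of_def)

lemma model_space_Times: "model_space E \<Longrightarrow> model_space F \<Longrightarrow> model_space (E \<times> F)"
  by (simp add: model_space_def closed_Times subspace_Times)

lemma model_space_UNIV [simp]: "model_space UNIV"
  by (simp add: model_space_def)

lemma openin_Times_top_of_set:
  assumes "openin (top_of_set E) U" "openin (top_of_set F) V"
  shows "openin (top_of_set (E \<times> F)) (U \<times> V)"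
  using assms by (simp add: openin_prod_Times_iff flip: prod_topology_subtopology_eu)

lemma is_chart_Times:
  assumes "is_chart X c" "is_chart Y d"
  shows "is_chart (prod_topology X Y)
    \<lparr>cdom = cdom c \<times> cdom d, cmap = map_prod (cmap c) (cmap d), cspace = cspace c \<times> cspace d\<rparr>"
proof (rule is_chartI(1))
  show "openin (prod_topology X Y) (cdom c \<times> cdom d)" "model_space (cspace c \<times> cspace d)"
    using assms by (auto simp: is_chart_def openin_prod_Times_iff model_space_Times)
  show "openin (top_of_set (cspace c \<times> cspace d)) ((cmap c ` cdom c) \<times> (cmap d ` cdom d))"
    using assms by (intro openin_Times_top_of_set) (auto simp: is_chart_def)
  show "homeomorphic_maps (subtopology (prod_topology X Y) (cdom c \<times> cdom d))
     (top_of_set (cmap c ` cdom c \<times> cmap d ` cdom d)) (map_prod (cmap c) (cmap d)) (map_prod (chart_inv c) (chart_inv d))"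
    using is_chart_maps[OF assms(1)] is_chart_maps[OF assms(2)]
    unfolding map_prod_def subtopology_Times prod_topology_subtopology_eu[symmetric] homeomorphic_maps_prod by blast
qed

lemma chart_cover_prod:
  assumes "chart_cover M" "chart_cover N"
  shows "chart_cover (prod_manifold M N)"
  unfolding chart_cover_def
proof
  show "\<forall>c\<in>matlas (prod_manifold M N). is_chart (mtop (prod_manifold M N)) c"
    using assms unfolding chart_cover_def by (auto simp: prod_manifold_def intro!: is_chart_Times)
  show "(\<Union>c\<in>matlas (prod_manifold M N). cdom c) = topspace (mtop (prod_manifold M N))"
  proof -
    have "(\<Union>c\<in>matlas (prod_manifold M N). cdom c) = (\<Union>c\<in>matlas M. cdom c) \<times> (\<Union>d\<in>matlas N. cdom d)"
      by (force simp: prod_manifold_def)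
    then show ?thesis using assms by (simp add: chart_cover_def)
  qed
qed

lemma smooth_into_Pair:
  assumes k: "smooth_into E U M k" and l: "smooth_into E U N l" and M: "chart_cover M" and N: "chart_cover N"
  shows "smooth_into E U (prod_manifold M N) (\<lambda>x. (k x, l x))"
  unfolding smooth_into_def
proof (intro conjI ballI)
  show "continuous_map (top_of_set U) (mtop (prod_manifold M N)) (\<lambda>x. (k x, l x))"
    using smooth_intoD(3)[OF k] smooth_intoD(3)[OF l] by (simp add: continuous_map_pairedI)
  fix e assume "e \<in> matlas (prod_manifold M N)"
  then obtain c d where cd: "c \<in> matlas M" "d \<in> matlas N"
    "e = \<lparr>cdom = cdom c \<times> cdom d, cmap = map_prod (cmap c) (cmap d), cspace = cspace c \<times> cspace d\<rparr>"
    by (auto simp: prod_manifold_def)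
  let ?W = "(U \<inter> k -` cdom c) \<inter> (U \<inter> l -` cdom d)"
  have W: "openin (top_of_set E) ?W"
    by (intro openin_Int openin_preimage[OF smooth_intoD(2,3)[OF k]] openin_preimage[OF smooth_intoD(2,3)[OF l]]
        chart_cover_openin M N cd)
  have "smooth_on E ?W (\<lambda>x. (cmap c (k x), cmap d (l x)))"
    by (intro smooth_on_Pair[OF smooth_intoD(1)[OF k] W])
       (rule smooth_on_subspace[OF smooth_intoD(4)[OF k cd(1)]] smooth_on_subspace[OF smooth_intoD(4)[OF l cd(2)]]; auto)+
  moreover have "?W = U \<inter> (\<lambda>x. (k x, l x)) -` cdom e" by (auto simp: cd(3))
  ultimately show "smooth_on E (U \<inter> (\<lambda>x. (k x, l x)) -` cdom e) (\<lambda>x. cmap e (k x, l x))"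
    by (simp add: cd(3))
qed (use smooth_intoD[OF k] in auto)

text \<open>The atlas of the product consists of product charts, so a chart of \<open>N\<close>
  around the second component has to be fixed before the first one can be projected out.\<close>

lemma smooth_into_fst:
  assumes k: "smooth_into E U (prod_manifold M N) k" and M: "chart_cover M" and N: "chart_cover N"
  shows "smooth_into E U M (\<lambda>x. fst (k x))"
  unfolding smooth_into_def
proof (intro conjI ballI)
  note E = smooth_intoD(1)[OF k]
  show "continuous_map (top_of_set U) (mtop M) (\<lambda>x. fst (k x))"
    using continuous_map_compose[OF smooth_intoD(3)[OF k, simplified] continuous_map_fst] by (simp add: o_def)
  fix c assume c: "c \<in> matlas M"
  show "smooth_on E (U \<inter> (\<lambda>x. fst (k x)) -` cdom c) (\<lambda>x. cmap c (fst (k x)))"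
  proof (rule smooth_on_local[OF E])
    fix x assume x: "x \<in> U \<inter> (\<lambda>x. fst (k x)) -` cdom c"
    have "snd (k x) \<in> topspace (mtop N)" using smooth_intoD(5)[OF k] x by (force simp: mem_Times_iff)
    then obtain d where d: "d \<in> matlas N" "snd (k x) \<in> cdom d" by (rule chart_cover_obtain[OF N])
    let ?e = "\<lparr>cdom = cdom c \<times> cdom d, cmap = map_prod (cmap c) (cmap d), cspace = cspace c \<times> cspace d\<rparr>"
    have e: "?e \<in> matlas (prod_manifold M N)" using c d by (auto simp: prod_manifold_def)
    let ?W = "U \<inter> k -` (cdom c \<times> cdom d)"
    have W: "openin (top_of_set E) ?W"
      using openin_preimage[OF smooth_intoD(2,3)[OF k] chart_cover_openin[OF chart_cover_prod[OF M N] e]] by simp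
    have s: "smooth_on E ?W (\<lambda>x. map_prod (cmap c) (cmap d) (k x))"
      using smooth_intoD(4)[OF k e] by simp
    have "smooth_on E ?W (\<lambda>x. fst (map_prod (cmap c) (cmap d) (k x)))"
      by (rule smooth_on_compose[OF E W s model_space_UNIV _ smooth_on_fst[of UNIV UNIV]]) auto
    then show "\<exists>W g. openin (top_of_set E) W \<and> x \<in> W \<and> smooth_on E W g \<and> (\<forall>y\<in>W. cmap c (fst (k y)) = g y)"
      using W x d by (intro exI[of _ ?W] exI[of _ "\<lambda>x. fst (map_prod (cmap c) (cmap d) (k x))"]) (auto simp: mem_Times_iff)
  qed
qed (use smooth_intoD[OF k] in auto)

lemma smooth_into_snd:
  assumes k: "smooth_into E U (prod_manifold M N) k" and M: "chart_cover M" and N: "chart_cover N"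
  shows "smooth_into E U N (\<lambda>x. snd (k x))"
  unfolding smooth_into_def
proof (intro conjI ballI)
  note E = smooth_intoD(1)[OF k]
  show "continuous_map (top_of_set U) (mtop N) (\<lambda>x. snd (k x))"
    using continuous_map_compose[OF smooth_intoD(3)[OF k, simplified] continuous_map_snd] by (simp add: o_def)
  fix d assume d: "d \<in> matlas N"
  show "smooth_on E (U \<inter> (\<lambda>x. snd (k x)) -` cdom d) (\<lambda>x. cmap d (snd (k x)))"
  proof (rule smooth_on_local[OF E])
    fix x assume x: "x \<in> U \<inter> (\<lambda>x. snd (k x)) -` cdom d"
    have "fst (k x) \<in> topspace (mtop M)" using smooth_intoD(5)[OF k] x by (force simp: mem_Times_iff)
    then obtain c where c: "c \<in> matlas M" "fst (k x) \<in> cdom c" by (rule chart_cover_obtain[OF M])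
    let ?e = "\<lparr>cdom = cdom c \<times> cdom d, cmap = map_prod (cmap c) (cmap d), cspace = cspace c \<times> cspace d\<rparr>"
    have e: "?e \<in> matlas (prod_manifold M N)" using c d by (auto simp: prod_manifold_def)
    let ?W = "U \<inter> k -` (cdom c \<times> cdom d)"
    have W: "openin (top_of_set E) ?W"
      using openin_preimage[OF smooth_intoD(2,3)[OF k] chart_cover_openin[OF chart_cover_prod[OF M N] e]] by simp
    have s: "smooth_on E ?W (\<lambda>x. map_prod (cmap c) (cmap d) (k x))"
      using smooth_intoD(4)[OF k e] by simp
    have "smooth_on E ?W (\<lambda>x. snd (map_prod (cmap c) (cmap d) (k x)))"
      by (rule smooth_on_compose[OF E W s model_space_UNIV _ smooth_on_snd[of UNIV UNIV]]) auto
    then show "\<exists>W g. openin (top_of_set E) W \<and> x \<in> W \<and> smooth_on E W g \<and> (\<forall>y\<in>W. cmap d (snd (k y)) = g y)"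
      using W x c by (intro exI[of _ ?W] exI[of _ "\<lambda>x. snd (map_prod (cmap c) (cmap d) (k x))"]) (auto simp: mem_Times_iff)
  qed
qed (use smooth_intoD[OF k] in auto)

section \<open>Submanifolds and open subsets\<close>

lemma adapted_chart_is_chart:
  assumes c: "is_chart X c" and ad: "adapted_chart c A F" and "A \<subseteq> topspace X"
  shows "is_chart (subtopology X A) \<lparr>cdom = cdom c \<inter> A, cmap = cmap c, cspace = F\<rparr>"
proof -
  have F: "model_space F" "F \<subseteq> cspace c" "cmap c ` (cdom c \<inter> A) = cmap c ` cdom c \<inter> F"
    using ad by (auto simp: adapted_chart_def)
  have o: "openin X (cdom c)" using c by (simp add: is_chart_def)
  have "openin (top_of_set F) (cmap c ` (cdom c \<inter> A))"
  proof -
    obtain T where "open T" "cmap c ` cdom c = cspace c \<inter> T"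
      using c by (auto simp: is_chart_def openin_open)
    then show ?thesis using F by (auto simp: openin_open)
  qed
  moreover have "homeomorphic_map (subtopology (subtopology X A) (cdom c \<inter> A)) (top_of_set (cmap c ` (cdom c \<inter> A))) (cmap c)"
  proof -
    have "homeomorphic_map (subtopology (subtopology X (cdom c)) A)
       (subtopology (top_of_set (cmap c ` cdom c)) (cmap c ` (cdom c \<inter> A))) (cmap c)"
    proof (rule homeomorphic_map_subtopologies)
      show "homeomorphic_map (subtopology X (cdom c)) (top_of_set (cmap c ` cdom c)) (cmap c)"
        using c by (simp add: is_chart_def)
    qed (use topspace_open_subtopology[OF o] in auto)
    moreover have "cmap c ` cdom c \<inter> cmap c ` (cdom c \<inter> A) = cmap c ` (cdom c \<inter> A)" by auto
    moreover have "A \<inter> (cdom c \<inter> A) = cdom c \<inter> A" by auto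
    ultimately show ?thesis by (simp add: subtopology_subtopology)
  qed
  moreover have "openin (subtopology X A) (cdom c \<inter> A)" using o by (auto simp: openin_subtopology)
  ultimately show ?thesis using F(1) by (simp add: is_chart_def)
qed

lemma chart_cover_submanifold:
  assumes "submanifold M A"
  shows "chart_cover (submanifold_of M A)"
  unfolding chart_cover_def
proof
  have A: "A \<subseteq> topspace (mtop M)" using assms by (simp add: submanifold_def)
  show "\<forall>c\<in>matlas (submanifold_of M A). is_chart (mtop (submanifold_of M A)) c"
    using adapted_chart_is_chart[OF max_atlas_is_chart _ A] by (auto simp: submanifold_of_def)
  have "(\<Union>c\<in>matlas (submanifold_of M A). cdom c) = A"
  proof
    show "A \<subseteq> (\<Union>c\<in>matlas (submanifold_of M A). cdom c)"
    proof
      fix a assume "a \<in> A"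
      then obtain c F where "c \<in> max_atlas M" "a \<in> cdom c" "adapted_chart c A F"
        using assms unfolding submanifold_def by blast
      then show "a \<in> (\<Union>c\<in>matlas (submanifold_of M A). cdom c)"
        using \<open>a \<in> A\<close> unfolding submanifold_of_def
        by (intro UN_I[of "\<lparr>cdom = cdom c \<inter> A, cmap = cmap c, cspace = F\<rparr>"]) auto
    qed
  qed (auto simp: submanifold_of_def)
  then show "(\<Union>c\<in>matlas (submanifold_of M A). cdom c) = topspace (mtop (submanifold_of M A))"
    using A by auto
qed

lemma smooth_into_submanifold:
  assumes k: "smooth_into E U M k" and M: "chart_cover M" and A: "k ` U \<subseteq> A"
  shows "smooth_into E U (submanifold_of M A) k"
  unfolding smooth_into_def
proof (intro conjI ballI)
  show "continuous_map (top_of_set U) (mtop (submanifold_of M A)) k"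
    using smooth_intoD(3)[OF k] A by (auto simp: continuous_map_in_subtopology)
  fix e assume "e \<in> matlas (submanifold_of M A)"
  then obtain c F where c: "c \<in> max_atlas M" "e = \<lparr>cdom = cdom c \<inter> A, cmap = cmap c, cspace = F\<rparr>"
    by (auto simp: submanifold_of_def)
  have "U \<inter> k -` cdom e = U \<inter> k -` cdom c" using A c(2) by auto
  then show "smooth_on E (U \<inter> k -` cdom e) (\<lambda>x. cmap e (k x))"
    using smooth_into_max_atlas[OF k M c(1)] c(2) by simp
qed (use smooth_intoD[OF k] in auto)

text \<open>Smoothness of the inclusion: in adapted charts it is a transition map of
  \<open>M\<close> restricted from \<open>cspace c\<close> to the closed subspace \<open>F\<close>,
  and restricting the directions preserves smoothness.\<close>

lemma smooth_into_from_submanifold: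
  assumes k: "smooth_into E U (submanifold_of M A) k" and M: "chart_cover M" and A: "submanifold M A"
  shows "smooth_into E U M k"
  unfolding smooth_into_def
proof (intro conjI ballI)
  have kA: "k ` U \<subseteq> A" using smooth_intoD(5)[OF k] by auto
  show "continuous_map (top_of_set U) (mtop M) k"
    using smooth_intoD(3)[OF k] by (simp add: continuous_map_in_subtopology)
  fix d assume d: "d \<in> matlas M"
  have "smooth_on E (U \<inter> k -` (cdom d \<inter> A)) (\<lambda>x. cmap d (k x))"
  proof (rule smooth_on_through_charts[OF k chart_cover_submanifold[OF A]])
    show o: "openin (mtop (submanifold_of M A)) (cdom d \<inter> A)"
      using chart_cover_openin[OF M d] by (auto simp: openin_subtopology)
    fix e assume e: "e \<in> matlas (submanifold_of M A)"
    then obtain c F where c: "c \<in> max_atlas M" "adapted_chart c A F"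
      "e = \<lparr>cdom = cdom c \<inter> A, cmap = cmap c, cspace = F\<rparr>"
      by (auto simp: submanifold_of_def)
    note ic = max_atlas_is_chart[OF c(1)]
    note ie = chart_cover_is_chart[OF chart_cover_submanifold[OF A] e]
    have F: "F \<subseteq> cspace c" using c(2) by (simp add: adapted_chart_def)
    show "smooth_on (cspace e) (cmap e ` (cdom e \<inter> (cdom d \<inter> A))) (\<lambda>y. cmap d (chart_inv e y))"
    proof (rule smooth_on_cong[OF _ chart_image_open[OF ie o]])
      have "smooth_on (cspace c) (cmap c ` (cdom c \<inter> cdom d)) (\<lambda>y. cmap d (chart_inv c y))"
        using c(1) d by (simp add: max_atlas_def smooth_transition_def o_def)
      then show "smooth_on (cspace e) (cmap e ` (cdom e \<inter> (cdom d \<inter> A))) (\<lambda>y. cmap d (chart_inv c y))"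
        by (rule smooth_on_subspace) (use F in \<open>auto simp: c(3)\<close>)
      show "model_space (cspace e)" using ie by (simp add: is_chart_def)
      fix y assume "y \<in> cmap e ` (cdom e \<inter> (cdom d \<inter> A))"
      then obtain x where x: "x \<in> cdom e" "y = cmap e x" by auto
      then have "chart_inv e y = x" using chart_inv_cmap[OF ie] by simp
      moreover have "chart_inv c y = x" using chart_inv_cmap[OF ic, of x] x by (simp add: c(3))
      ultimately show "cmap d (chart_inv e y) = cmap d (chart_inv c y)" by simp
    qed
  qed
  moreover have "U \<inter> k -` (cdom d \<inter> A) = U \<inter> k -` cdom d" using kA by auto
  ultimately show "smooth_on E (U \<inter> k -` cdom d) (\<lambda>x. cmap d (k x))" by simp
qed (use smooth_intoD[OF k] in auto)

text \<open>A chart cut down to \<open>W\<close> remains compatible with the atlas and is adapted to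
  \<open>W\<close> with the whole model space as its subspace.\<close>

lemma submanifold_open:
  assumes M: "smooth_manifold M" and W: "openin (mtop M) W"
  shows "submanifold M W"
  unfolding submanifold_def
proof (intro conjI ballI)
  note cM = smooth_manifold_chart_cover[OF M]
  show "W \<subseteq> topspace (mtop M)" using W openin_subset by blast
  fix a assume a: "a \<in> W"
  then obtain c where c: "c \<in> matlas M" "a \<in> cdom c"
    using chart_cover_obtain[OF cM] W openin_subset by blast
  note ic = chart_cover_is_chart[OF cM c(1)]
  define c' where "c' = \<lparr>cdom = cdom c \<inter> W, cmap = cmap c, cspace = cspace c\<rparr>"
  have "openin (mtop M) (cdom c \<inter> W)" using chart_cover_openin[OF cM c(1)] W by blast
  moreover have "homeomorphic_map (subtopology (mtop M) (cdom c \<inter> W)) (top_of_set (cmap c ` (cdom c \<inter> W))) (cmap c)"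
  proof -
    have "homeomorphic_map (subtopology (subtopology (mtop M) (cdom c)) W)
       (subtopology (top_of_set (cmap c ` cdom c)) (cmap c ` (cdom c \<inter> W))) (cmap c)"
    proof (rule homeomorphic_map_subtopologies)
      show "homeomorphic_map (subtopology (mtop M) (cdom c)) (top_of_set (cmap c ` cdom c)) (cmap c)"
        using ic by (simp add: is_chart_def)
    qed (use topspace_open_subtopology[OF chart_cover_openin[OF cM c(1)]] in auto)
    moreover have "cmap c ` cdom c \<inter> cmap c ` (cdom c \<inter> W) = cmap c ` (cdom c \<inter> W)" by auto
    ultimately show ?thesis by (simp add: subtopology_subtopology)
  qed
  ultimately have ic': "is_chart (mtop M) c'"
    using ic chart_image_open[OF ic W] by (simp add: is_chart_def c'_def)
  have tr: "smooth_transition c d" "smooth_transition d c" if "d \<in> matlas M" for d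
    using M c(1) that by (auto simp: smooth_manifold_def)
  have "c' \<in> max_atlas M"
    unfolding max_atlas_def
  proof (intro CollectI conjI ballI ic')
    fix d assume d: "d \<in> matlas M"
    note od = chart_cover_openin[OF cM d]
    have "smooth_on (cspace d) (cmap d ` (cdom d \<inter> cdom c')) (cmap c \<circ> chart_inv d)"
      using tr(2)[OF d] unfolding smooth_transition_def
      by (rule smooth_on_subspace) (auto simp: c'_def)
    then show "smooth_transition d c'" by (simp add: smooth_transition_def c'_def)
    show "smooth_transition c' d"
      unfolding smooth_transition_def
    proof (rule smooth_on_cong)
      show "model_space (cspace c')" using ic' by (simp add: is_chart_def)
      show "openin (top_of_set (cspace c')) (cmap c' ` (cdom c' \<inter> cdom d))"
        by (rule chart_image_open[OF ic' od])
      show "smooth_on (cspace c') (cmap c' ` (cdom c' \<inter> cdom d)) (cmap d \<circ> chart_inv c)"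
        using tr(1)[OF d] unfolding smooth_transition_def
        by (rule smooth_on_subspace) (auto simp: c'_def)
      fix y assume "y \<in> cmap c' ` (cdom c' \<inter> cdom d)"
      then obtain x where x: "x \<in> cdom c'" "y = cmap c' x" by auto
      then have "chart_inv c' y = x" using chart_inv_cmap[OF ic'] by simp
      moreover have "chart_inv c y = x" using chart_inv_cmap[OF ic, of x] x by (simp add: c'_def)
      ultimately show "(cmap d \<circ> chart_inv c') y = (cmap d \<circ> chart_inv c) y" by simp
    qed
  qed
  moreover have "adapted_chart c' W (cspace c)"
    using ic is_chart_cspace[OF ic] by (auto simp: adapted_chart_def c'_def is_chart_def)
  ultimately show "\<exists>c\<in>max_atlas M. a \<in> cdom c \<and> (\<exists>F. adapted_chart c W F)"
    using a c(2) by (intro bexI[of _ c']) (auto simp: c'_def)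
qed

text \<open>For \<open>p\<close> the identity or an orbit map. Smoothness of the transition maps of a quotient is thus
  reduced to maps into \<open>M\<close>.\<close>

lemma smooth_manifold_from_lifts:
  fixes M :: "('m, 'f::locally_convex_space) manifold" and \<A> :: "('a, 'e::locally_convex_space) chart set"
  assumes "Hausdorff_space X" and ch: "\<And>c. c \<in> \<A> \<Longrightarrow> is_chart X c"
    and cov: "(\<Union>c\<in>\<A>. cdom c) = topspace X"
    and lift: "\<And>c. c \<in> \<A> \<Longrightarrow> \<exists>K. smooth_into (cspace c) (cmap c ` cdom c) M K \<and>
      (\<forall>y\<in>cmap c ` cdom c. K y \<in> Y \<and> p (K y) = chart_inv c y)"
    and smooth: "\<And>c (E :: 'e set) U k. c \<in> \<A> \<Longrightarrow> smooth_into E U M k \<Longrightarrow> k ` U \<subseteq> Y \<Longrightarrow>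
      (\<And>x. x \<in> U \<Longrightarrow> p (k x) \<in> cdom c) \<Longrightarrow> smooth_on E U (\<lambda>x. cmap c (p (k x)))"
  shows "smooth_manifold \<lparr>mtop = X, matlas = \<A>\<rparr>"
proof -
  have "smooth_transition c d" if c: "c \<in> \<A>" and d: "d \<in> \<A>" for c d
  proof -
    note ic = ch[OF c] and id = ch[OF d]
    obtain K where K: "smooth_into (cspace c) (cmap c ` cdom c) M K"
      "\<And>y. y \<in> cmap c ` cdom c \<Longrightarrow> K y \<in> Y \<and> p (K y) = chart_inv c y" using lift[OF c] by blast
    let ?W = "cmap c ` (cdom c \<inter> cdom d)"
    have od: "openin X (cdom d)" using id by (simp add: is_chart_def)
    have E: "model_space (cspace c)" using ic by (simp add: is_chart_def)
    have W: "openin (top_of_set (cspace c)) ?W" by (rule chart_image_open[OF ic od])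
    have inv: "p (K y) \<in> cdom d" "p (K y) = chart_inv c y" "K y \<in> Y" if y: "y \<in> ?W" for y
    proof -
      obtain x where x: "x \<in> cdom c" "x \<in> cdom d" "y = cmap c x" using y by auto
      then have "chart_inv c y = x" using chart_inv_cmap[OF ic] by simp
      then show "p (K y) \<in> cdom d" "p (K y) = chart_inv c y" "K y \<in> Y" using K(2) x by auto
    qed
    \<comment> \<open>On the overlap the transition map is
      \<open>cmap d \<circ> p \<circ> K\<close>, that is, a chart read along a lift to
      \<open>M\<close>.\<close>
    have "smooth_into (cspace c) ?W M K"
      by (rule smooth_into_restrict[OF K(1) E _ W]) auto
    then have "smooth_on (cspace c) ?W (\<lambda>y. cmap d (p (K y)))"
      by (rule smooth[OF d]) (use inv in auto)
    then show ?thesis unfolding smooth_transition_def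
      by (rule smooth_on_cong[OF E W]) (use inv in auto)
  qed
  then show ?thesis using assms(1) ch cov by (simp add: smooth_manifold_def)
qed

section \<open>Strata of the level set\<close>

lemma smooth_into_precompose:
  assumes k: "smooth_into E U M k" and M: "chart_cover M"
    and g: "model_space E'" "openin (top_of_set E') U'" "smooth_on E' U' g" "continuous_on U' g" "g ` U' \<subseteq> U"
  shows "smooth_into E' U' M (\<lambda>x. k (g x))"
  unfolding smooth_into_def
proof (intro conjI ballI)
  have cg: "continuous_map (top_of_set U') (top_of_set U) g"
    using g(4,5) by (simp add: continuous_map_in_subtopology image_subset_iff Pi_iff)
  show cont: "continuous_map (top_of_set U') (mtop M) (\<lambda>x. k (g x))"
    using continuous_map_compose[OF cg smooth_intoD(3)[OF k]] by (simp add: o_def)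
  fix c assume c: "c \<in> matlas M"
  note oc = chart_cover_openin[OF M c]
  have W: "openin (top_of_set E') (U' \<inter> (\<lambda>x. k (g x)) -` cdom c)"
    by (rule openin_preimage[OF g(2) cont oc])
  show "smooth_on E' (U' \<inter> (\<lambda>x. k (g x)) -` cdom c) (\<lambda>x. cmap c (k (g x)))"
  proof (rule smooth_on_compose[OF g(1) W _ smooth_intoD(1)[OF k] openin_preimage[OF smooth_intoD(2,3)[OF k] oc] smooth_intoD(4)[OF k c]])
    show "smooth_on E' (U' \<inter> (\<lambda>x. k (g x)) -` cdom c) g"
      by (rule smooth_on_subspace[OF g(3)]) auto
  qed (use g(5) in auto)
qed (use g in auto)

lemma closure_of_meets: "z \<in> X closure_of A \<Longrightarrow> openin X B \<Longrightarrow> z \<in> B \<Longrightarrow> \<exists>y\<in>A. y \<in> B"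
  unfolding in_closure_of by blast

section \<open>Conjugates of stabilizers\<close>

lemma conjugate_set_iff: "k \<in> conjugate_set P g H \<longleftrightarrow> (\<exists>h\<in>H. k = g \<otimes>\<^bsub>P\<^esub> h \<otimes>\<^bsub>P\<^esub> inv\<^bsub>P\<^esub> g)"
  by (auto simp: conjugate_set_def l_coset_def r_coset_def)

lemma conjugate_set_mult:
  fixes P :: "'g monoid"
  assumes "group P" "g \<in> carrier P" "h \<in> carrier P" "H \<subseteq> carrier P"
  shows "conjugate_set P g (conjugate_set P h H) = conjugate_set P (g \<otimes>\<^bsub>P\<^esub> h) H"
proof -
  interpret group P by (rule assms(1))
  have "g \<otimes>\<^bsub>P\<^esub> (h \<otimes>\<^bsub>P\<^esub> k \<otimes>\<^bsub>P\<^esub> inv\<^bsub>P\<^esub> h) \<otimes>\<^bsub>P\<^esub> inv\<^bsub>P\<^esub> g = (g \<otimes>\<^bsub>P\<^esub> h) \<otimes>\<^bsub>P\<^esub> k \<otimes>\<^bsub>P\<^esub> inv\<^bsub>P\<^esub> (g \<otimes>\<^bsub>P\<^esub> h)"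
    if "k \<in> H" for k
    using that assms by (auto simp: m_assoc inv_mult_group subset_iff)
  then show ?thesis by (force simp: conjugate_set_iff)
qed

lemma conjugate_set_one:
  fixes P :: "'g monoid"
  assumes "group P" "H \<subseteq> carrier P"
  shows "conjugate_set P \<one>\<^bsub>P\<^esub> H = H"
proof -
  interpret group P by (rule assms(1))
  have "\<one>\<^bsub>P\<^esub> \<otimes>\<^bsub>P\<^esub> k \<otimes>\<^bsub>P\<^esub> inv\<^bsub>P\<^esub> \<one>\<^bsub>P\<^esub> = k" if "k \<in> H" for k using that assms by auto
  then show ?thesis by (force simp: conjugate_set_iff)
qed

lemma conjugate_set_mono:
  assumes "H \<subseteq> K"
  shows "conjugate_set P g H \<subseteq> conjugate_set P g K"
proof
  fix k assume "k \<in> conjugate_set P g H"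
  then obtain h where "h \<in> H" "k = g \<otimes>\<^bsub>P\<^esub> h \<otimes>\<^bsub>P\<^esub> inv\<^bsub>P\<^esub> g" unfolding conjugate_set_iff by blast
  then show "k \<in> conjugate_set P g K" using assms unfolding conjugate_set_iff by blast
qed

lemma stabilizer_action:
  fixes P :: "'g monoid"
  assumes "group_action P E \<phi>" "x \<in> E" "g \<in> carrier P"
  shows "stabilizer P \<phi> (\<phi> g x) = conjugate_set P g (stabilizer P \<phi> x)"
proof -
  interpret group_action P E \<phi> by (rule assms(1))
  interpret group P using group_hom group_hom.axioms(1) by blast
  have inv: "\<phi> (inv\<^bsub>P\<^esub> g) (\<phi> g x) = x" using orbit_sym_aux[OF assms(3,2) refl] .
  have gx: "\<phi> g x \<in> E" using element_image[OF assms(3,2) refl] .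
  show ?thesis
  proof (intro subset_antisym subsetI)
    fix k assume k: "k \<in> stabilizer P \<phi> (\<phi> g x)"
    then have kc: "k \<in> carrier P" "\<phi> k (\<phi> g x) = \<phi> g x" by (auto simp: stabilizer_def)
    have "\<phi> (inv\<^bsub>P\<^esub> g \<otimes>\<^bsub>P\<^esub> (k \<otimes>\<^bsub>P\<^esub> g)) x = x"
      using kc inv assms by (simp add: composition_rule)
    then have "inv\<^bsub>P\<^esub> g \<otimes>\<^bsub>P\<^esub> (k \<otimes>\<^bsub>P\<^esub> g) \<in> stabilizer P \<phi> x" using kc assms by (simp add: stabilizer_def)
    moreover have "k = g \<otimes>\<^bsub>P\<^esub> (inv\<^bsub>P\<^esub> g \<otimes>\<^bsub>P\<^esub> (k \<otimes>\<^bsub>P\<^esub> g)) \<otimes>\<^bsub>P\<^esub> inv\<^bsub>P\<^esub> g"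
    proof -
      have "g \<otimes>\<^bsub>P\<^esub> (inv\<^bsub>P\<^esub> g \<otimes>\<^bsub>P\<^esub> (k \<otimes>\<^bsub>P\<^esub> g)) = k \<otimes>\<^bsub>P\<^esub> g"
        using kc(1) assms(3) by (simp add: m_assoc[symmetric])
      then show ?thesis using kc(1) assms(3) by (simp add: m_assoc)
    qed
    ultimately show "k \<in> conjugate_set P g (stabilizer P \<phi> x)" unfolding conjugate_set_iff by blast
  next
    fix k assume "k \<in> conjugate_set P g (stabilizer P \<phi> x)"
    then obtain h where h: "h \<in> stabilizer P \<phi> x" "k = g \<otimes>\<^bsub>P\<^esub> h \<otimes>\<^bsub>P\<^esub> inv\<^bsub>P\<^esub> g" unfolding conjugate_set_iff by blast
    then have hc: "h \<in> carrier P" "\<phi> h x = x" by (auto simp: stabilizer_def)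
    have "\<phi> k (\<phi> g x) = \<phi> g (\<phi> h (\<phi> (inv\<^bsub>P\<^esub> g) (\<phi> g x)))"
      using hc gx assms element_image[OF inv_closed[OF assms(3)] gx refl]
      by (simp add: h(2) composition_rule)
    then show "k \<in> stabilizer P \<phi> (\<phi> g x)" using inv hc assms h(2) by (simp add: stabilizer_def)
  qed
qed

text \<open>The part of a normal form at \<open>m\<close> that the argument needs: the slice \<open>S\<close> and its tube around
  \<open>m\<close>, the two assumptions on the level set \<open>L\<close>, and the fact that no proper subgroup of the
  stabilizer is conjugate to it.\<close>

definition level_slice ::
    "'g monoid \<Rightarrow> ('m, 'em::locally_convex_space) manifold \<Rightarrow> ('g \<Rightarrow> 'm \<Rightarrow> 'm) \<Rightarrow> 'm set \<Rightarrow> 'm \<Rightarrow>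
     'm set \<Rightarrow> ('g set, 'eg::locally_convex_space) manifold \<Rightarrow> 'g set set \<Rightarrow> ('g set \<Rightarrow> 'g) \<Rightarrow> 'm set \<Rightarrow> bool" where
  "level_slice P M \<phi> L m S Q W \<kappa> T \<longleftrightarrow>
     (let H = stabilizer P \<phi> m; S\<^sub>H = orbit_type_subset P \<phi> S H in
      submanifold M S \<and> m \<in> S \<and>
      (\<forall>g\<in>carrier P. \<phi> g ` S \<inter> S \<noteq> {} \<longrightarrow> g \<in> H) \<and> (\<forall>h\<in>H. \<phi> h ` S \<subseteq> S) \<and>
      smooth_manifold Q \<and> openin (mtop Q) W \<and> H \<in> W \<and>
      (\<forall>w\<in>W. \<kappa> w \<in> carrier P \<and> \<kappa> w <#\<^bsub>P\<^esub> H = w) \<and>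
      openin (mtop M) T \<and>
      diffeomorphism (prod_manifold (submanifold_of Q W) (submanifold_of M S)) (submanifold_of M T)
        (\<lambda>(w, s). \<phi> (\<kappa> w) s) \<and>
      closedin (subtopology (mtop M) S) S\<^sub>H \<and> submanifold (submanifold_of M S) S\<^sub>H \<and>
      submanifold (submanifold_of (submanifold_of M S) S\<^sub>H) (L \<inter> S\<^sub>H) \<and>
      (\<forall>K\<in>stabilizer P \<phi> ` topspace (mtop M). orbit_type_le P K H \<longrightarrow>
        m \<in> subtopology (mtop M) S closure_of (L \<inter> orbit_type_subset P \<phi> S K)) \<and>
      (\<forall>g\<in>carrier P. conjugate_set P g H \<subseteq> H \<longrightarrow> conjugate_set P g H = H))"

text \<open>Slice, coset manifold, section and tube are functions of the point, so that local data
  at different points can be compared. Properness of the action is represented by closedness of the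
  orbit relation, and smoothness of the action by its single translations.\<close>

locale level_stratification =
  fixes P :: "'g monoid" and M :: "('m, 'em::locally_convex_space) manifold" and \<phi> :: "'g \<Rightarrow> 'm \<Rightarrow> 'm"
    and L :: "'m set" and S :: "'m \<Rightarrow> 'm set" and Q :: "'m \<Rightarrow> ('g set, 'eg::locally_convex_space) manifold"
    and W :: "'m \<Rightarrow> 'g set set" and \<kappa> :: "'m \<Rightarrow> 'g set \<Rightarrow> 'g" and T :: "'m \<Rightarrow> 'm set"
  assumes action: "group_action P (topspace (mtop M)) \<phi>"
    and manifold: "smooth_manifold M"
    and smooth_translation: "\<And>g. g \<in> carrier P \<Longrightarrow> smooth_map M M (\<phi> g)"
    and level_subset: "L \<subseteq> topspace (mtop M)"
    and level_invariant: "\<And>g x. g \<in> carrier P \<Longrightarrow> x \<in> L \<Longrightarrow> \<phi> g x \<in> L"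
    and level_slice: "\<And>m. m \<in> L \<Longrightarrow> level_slice P M \<phi> L m (S m) (Q m) (W m) (\<kappa> m) (T m)"
    and orbit_relation_closed: "closedin (prod_topology (mtop M) (mtop M))
      {(x, y). x \<in> topspace (mtop M) \<and> y \<in> topspace (mtop M) \<and> orbit P \<phi> x = orbit P \<phi> y}"
begin

abbreviation X where "X \<equiv> mtop M"
abbreviation stab where "stab \<equiv> stabilizer P \<phi>"
abbreviation \<pi> where "\<pi> \<equiv> orbit P \<phi>"
abbreviation Z where "Z \<equiv> subtopology X L"

definition stratum where "stratum x = orbit_type_subset P \<phi> L (stab x)"
definition S\<^sub>H where "S\<^sub>H m = orbit_type_subset P \<phi> (S m) (stab m)"
definition L\<^sub>H where "L\<^sub>H m = L \<inter> S\<^sub>H m"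
text \<open>The tube map trivialized over \<open>W m\<close>: the section \<open>\<kappa> m\<close>
  picks a group element for each coset, which makes the source a product.\<close>

definition tube where "tube m = (\<lambda>(w, s). \<phi> (\<kappa> m w) s)"
definition untube where "untube m = inv_into (W m \<times> S m) (tube m)"

section \<open>Orbits and strata of the invariant level set\<close>

lemma group_P: "group P"
  using action group_action.group_hom group_hom.axioms(1) by blast

lemma act_in: "g \<in> carrier P \<Longrightarrow> x \<in> topspace X \<Longrightarrow> \<phi> g x \<in> topspace X"
  using group_action.element_image[OF action] by blast

lemma act_mult: "x \<in> topspace X \<Longrightarrow> g \<in> carrier P \<Longrightarrow> h \<in> carrier P \<Longrightarrow> \<phi> (g \<otimes>\<^bsub>P\<^esub> h) x = \<phi> g (\<phi> h x)"
  using group_action.composition_rule[OF action] by blast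

lemma act_inv: "x \<in> topspace X \<Longrightarrow> g \<in> carrier P \<Longrightarrow> \<phi> (inv\<^bsub>P\<^esub> g) (\<phi> g x) = x"
  using group_action.orbit_sym_aux[OF action] by blast

lemma inv_in: "g \<in> carrier P \<Longrightarrow> inv\<^bsub>P\<^esub> g \<in> carrier P"
  using group.inv_closed[OF group_P] .

lemma act_inv': "x \<in> topspace X \<Longrightarrow> g \<in> carrier P \<Longrightarrow> \<phi> g (\<phi> (inv\<^bsub>P\<^esub> g) x) = x"
  using act_inv[of x "inv\<^bsub>P\<^esub> g"] group.inv_inv[OF group_P] inv_in by simp

lemma mult_in: "g \<in> carrier P \<Longrightarrow> h \<in> carrier P \<Longrightarrow> g \<otimes>\<^bsub>P\<^esub> h \<in> carrier P"
  using group_P group.is_monoid monoid.m_closed by metis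

lemma stab_subset: "stab x \<subseteq> carrier P"
  by (auto simp: stabilizer_def)

lemma stab_act: "x \<in> topspace X \<Longrightarrow> g \<in> carrier P \<Longrightarrow> stab (\<phi> g x) = conjugate_set P g (stab x)"
  by (rule stabilizer_action[OF action])

lemma conj_mult:
  "g \<in> carrier P \<Longrightarrow> h \<in> carrier P \<Longrightarrow>
    conjugate_set P g (conjugate_set P h (stab x)) = conjugate_set P (g \<otimes>\<^bsub>P\<^esub> h) (stab x)"
  using conjugate_set_mult[OF group_P] stab_subset by blast

lemma level_act_iff: "x \<in> topspace X \<Longrightarrow> g \<in> carrier P \<Longrightarrow> \<phi> g x \<in> L \<longleftrightarrow> x \<in> L"
  using level_invariant act_inv inv_in by metis

lemma orbit_eq_iff:
  assumes "x \<in> topspace X" "y \<in> topspace X"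
  shows "\<pi> x = \<pi> y \<longleftrightarrow> (\<exists>g\<in>carrier P. y = \<phi> g x)"
proof
  assume "\<pi> x = \<pi> y"
  then have "y \<in> \<pi> x" using group_action.orbit_refl[OF action assms(2)] by simp
  then show "\<exists>g\<in>carrier P. y = \<phi> g x" by (auto simp: orbit_def)
next
  assume "\<exists>g\<in>carrier P. y = \<phi> g x"
  then obtain g where g: "g \<in> carrier P" "y = \<phi> g x" by blast
  show "\<pi> x = \<pi> y"
  proof (intro subset_antisym subsetI)
    fix z assume "z \<in> \<pi> x"
    then obtain h where h: "h \<in> carrier P" "z = \<phi> h x" by (auto simp: orbit_def)
    then have "z = \<phi> (h \<otimes>\<^bsub>P\<^esub> inv\<^bsub>P\<^esub> g) y"
      using g assms act_inv act_mult[OF assms(2) h(1) inv_in[OF g(1)]] by simp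
    then show "z \<in> \<pi> y" using mult_in[OF h(1) inv_in[OF g(1)]] by (auto simp: orbit_def)
  next
    fix z assume "z \<in> \<pi> y"
    then obtain h where h: "h \<in> carrier P" "z = \<phi> h y" by (auto simp: orbit_def)
    then have "z = \<phi> (h \<otimes>\<^bsub>P\<^esub> g) x" using g assms act_mult by simp
    then show "z \<in> \<pi> x" using mult_in[OF h(1) g(1)] by (auto simp: orbit_def)
  qed
qed

lemma stratum_iff: "y \<in> stratum x \<longleftrightarrow> y \<in> L \<and> (\<exists>g\<in>carrier P. stab y = conjugate_set P g (stab x))"
  by (simp add: stratum_def orbit_type_subset_def)

lemma stratum_level: "stratum x \<subseteq> L"
  by (auto simp: stratum_iff)

lemma conj_sym:
  assumes "g \<in> carrier P" "stab y = conjugate_set P g (stab x)"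
  shows "stab x = conjugate_set P (inv\<^bsub>P\<^esub> g) (stab y)"
  using assms conj_mult[OF inv_in[OF assms(1)] assms(1), of x] group.l_inv[OF group_P assms(1)]
    conjugate_set_one[OF group_P stab_subset, of x] by simp

lemma stratum_refl: "x \<in> L \<Longrightarrow> x \<in> stratum x"
  using conjugate_set_one[OF group_P stab_subset, of x] group.is_monoid[OF group_P] monoid.one_closed
  unfolding stratum_iff by metis

lemma stratum_eq:
  assumes "y \<in> stratum x"
  shows "stratum y = stratum x"
proof -
  obtain g where g: "g \<in> carrier P" "stab y = conjugate_set P g (stab x)" using assms stratum_iff by blast
  note g' = conj_sym[OF g]
  show ?thesis
  proof (intro subset_antisym subsetI)
    fix z assume "z \<in> stratum y"
    then obtain h where h: "z \<in> L" "h \<in> carrier P" "stab z = conjugate_set P h (stab y)" using stratum_iff by blast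
    then have "stab z = conjugate_set P (h \<otimes>\<^bsub>P\<^esub> g) (stab x)" using g conj_mult by simp
    then show "z \<in> stratum x" using h(1) mult_in[OF h(2) g(1)] stratum_iff by blast
  next
    fix z assume "z \<in> stratum x"
    then obtain h where h: "z \<in> L" "h \<in> carrier P" "stab z = conjugate_set P h (stab x)" using stratum_iff by blast
    have "conjugate_set P h (stab x) = conjugate_set P h (conjugate_set P (inv\<^bsub>P\<^esub> g) (stab y))" using g' by simp
    then have "stab z = conjugate_set P (h \<otimes>\<^bsub>P\<^esub> inv\<^bsub>P\<^esub> g) (stab y)" using h(3) conj_mult[OF h(2) inv_in[OF g(1)]] by simp
    then show "z \<in> stratum y" using h(1) mult_in[OF h(2) inv_in[OF g(1)]] stratum_iff by blast
  qed
qed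

lemma stratum_act:
  assumes "y \<in> stratum x" "g \<in> carrier P"
  shows "\<phi> g y \<in> stratum x"
proof -
  have y: "y \<in> L" using assms(1) stratum_level by blast
  then have "y \<in> topspace X" using level_subset by blast
  then have "\<phi> g y \<in> stratum y"
    unfolding stratum_iff using level_invariant[OF assms(2) y] stab_act[OF _ assms(2)] assms(2) by blast
  then show ?thesis using stratum_eq[OF assms(1)] by simp
qed

lemma stratum_orbit:
  assumes "y \<in> stratum x" "z \<in> topspace X" "\<pi> y = \<pi> z"
  shows "z \<in> stratum x"
proof -
  have "y \<in> topspace X" using assms(1) stratum_level level_subset by blast
  then obtain g where "g \<in> carrier P" "z = \<phi> g y" using orbit_eq_iff[OF _ assms(2)] assms(3) by blast
  then show ?thesis using stratum_act assms(1) by blast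
qed

lemma orbit_type_partition_eq: "orbit_type_partition P \<phi> L = stratum ` L"
  by (simp add: orbit_type_partition_def stratum_def)

lemma strata_disjoint: "stratum x \<noteq> stratum y \<Longrightarrow> disjnt (stratum x) (stratum y)"
  using stratum_eq by (metis disjnt_iff)

section \<open>Slices, tubes and the frontier condition\<close>

lemma slice_facts:
  assumes "m \<in> L"
  shows "submanifold M (S m)" "m \<in> S m"
    "\<And>g s. g \<in> carrier P \<Longrightarrow> s \<in> S m \<Longrightarrow> \<phi> g s \<in> S m \<Longrightarrow> g \<in> stab m"
    "\<And>h s. h \<in> stab m \<Longrightarrow> s \<in> S m \<Longrightarrow> \<phi> h s \<in> S m"
    "smooth_manifold (Q m)" "openin (mtop (Q m)) (W m)" "stab m \<in> W m"
    "\<And>w. w \<in> W m \<Longrightarrow> \<kappa> m w \<in> carrier P" "\<And>w. w \<in> W m \<Longrightarrow> \<kappa> m w <#\<^bsub>P\<^esub> stab m = w"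
    "openin X (T m)"
    "diffeomorphism (prod_manifold (submanifold_of (Q m) (W m)) (submanifold_of M (S m))) (submanifold_of M (T m)) (tube m)"
    "closedin (subtopology X (S m)) (S\<^sub>H m)" "submanifold (submanifold_of M (S m)) (S\<^sub>H m)"
    "submanifold (submanifold_of (submanifold_of M (S m)) (S\<^sub>H m)) (L\<^sub>H m)"
    "\<And>x. x \<in> topspace X \<Longrightarrow> orbit_type_le P (stab x) (stab m) \<Longrightarrow>
        m \<in> subtopology X (S m) closure_of (L \<inter> orbit_type_subset P \<phi> (S m) (stab x))"
    "\<And>g. g \<in> carrier P \<Longrightarrow> conjugate_set P g (stab m) \<subseteq> stab m \<Longrightarrow> conjugate_set P g (stab m) = stab m"
proof -
  note f = level_slice[OF assms, unfolded level_slice_def Let_def]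
  show "submanifold M (S m)" "m \<in> S m" "smooth_manifold (Q m)" "openin (mtop (Q m)) (W m)" "stab m \<in> W m"
    "openin X (T m)"
    "diffeomorphism (prod_manifold (submanifold_of (Q m) (W m)) (submanifold_of M (S m))) (submanifold_of M (T m)) (tube m)"
    "closedin (subtopology X (S m)) (S\<^sub>H m)" "submanifold (submanifold_of M (S m)) (S\<^sub>H m)"
    "submanifold (submanifold_of (submanifold_of M (S m)) (S\<^sub>H m)) (L\<^sub>H m)"
    unfolding S\<^sub>H_def L\<^sub>H_def tube_def using f by - (elim conjE, assumption)+
  have 1: "\<forall>g\<in>carrier P. \<phi> g ` S m \<inter> S m \<noteq> {} \<longrightarrow> g \<in> stab m"
    and 2: "\<forall>h\<in>stab m. \<phi> h ` S m \<subseteq> S m"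
    and 3: "\<forall>w\<in>W m. \<kappa> m w \<in> carrier P \<and> \<kappa> m w <#\<^bsub>P\<^esub> stab m = w"
    and 4: "\<forall>K\<in>stab ` topspace X. orbit_type_le P K (stab m) \<longrightarrow>
        m \<in> subtopology X (S m) closure_of (L \<inter> orbit_type_subset P \<phi> (S m) K)"
    and 5: "\<forall>g\<in>carrier P. conjugate_set P g (stab m) \<subseteq> stab m \<longrightarrow> conjugate_set P g (stab m) = stab m"
    using f by - (elim conjE, assumption)+
  show "g \<in> stab m" if "g \<in> carrier P" "s \<in> S m" "\<phi> g s \<in> S m" for g s
    using 1 that by blast
  show "\<phi> h s \<in> S m" if "h \<in> stab m" "s \<in> S m" for h s using 2 that by blast
  show "\<kappa> m w \<in> carrier P" "\<kappa> m w <#\<^bsub>P\<^esub> stab m = w" if "w \<in> W m" for w using 3 that by auto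
  show "m \<in> subtopology X (S m) closure_of (L \<inter> orbit_type_subset P \<phi> (S m) (stab x))"
    if "x \<in> topspace X" "orbit_type_le P (stab x) (stab m)" for x using 4 that by blast
  show "conjugate_set P g (stab m) = stab m" if "g \<in> carrier P" "conjugate_set P g (stab m) \<subseteq> stab m" for g
    using 5 that by blast
qed

lemma slice_subset: "m \<in> L \<Longrightarrow> S m \<subseteq> topspace X"
  using slice_facts(1) by (simp add: submanifold_def)

lemma tube_topspace:
  assumes "m \<in> L"
  shows "topspace (mtop (prod_manifold (submanifold_of (Q m) (W m)) (submanifold_of M (S m)))) = W m \<times> S m"
    "topspace (mtop (submanifold_of M (T m))) = T m"
  using slice_subset[OF assms] openin_subset[OF slice_facts(6)[OF assms]] openin_subset[OF slice_facts(10)[OF assms]]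
  by auto

lemma tube_bij:
  assumes "m \<in> L"
  shows "bij_betw (tube m) (W m \<times> S m) (T m)"
  using slice_facts(11)[OF assms] unfolding diffeomorphism_def tube_topspace[OF assms] by blast

lemma smooth_tube:
  "m \<in> L \<Longrightarrow> smooth_map (prod_manifold (submanifold_of (Q m) (W m)) (submanifold_of M (S m))) (submanifold_of M (T m)) (tube m)"
  using slice_facts(11)[of m] unfolding diffeomorphism_def by blast

lemma smooth_untube:
  assumes "m \<in> L"
  shows "smooth_map (submanifold_of M (T m)) (prod_manifold (submanifold_of (Q m) (W m)) (submanifold_of M (S m))) (untube m)"
  using slice_facts(11)[OF assms] unfolding diffeomorphism_def tube_topspace[OF assms] untube_def by blast

lemma untube_tube: "m \<in> L \<Longrightarrow> w \<in> W m \<Longrightarrow> s \<in> S m \<Longrightarrow> untube m (tube m (w, s)) = (w, s)"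
  unfolding untube_def using tube_bij by (intro bij_betw_inv_into_left) auto

lemma tube_untube:
  assumes "m \<in> L" "x \<in> T m"
  shows "tube m (untube m x) = x" "untube m x \<in> W m \<times> S m"
  using bij_betw_inv_into_right[OF tube_bij[OF assms(1)] assms(2)]
    bij_betw_imp_surj_on[OF tube_bij[OF assms(1)]] assms(2)
  unfolding untube_def by (auto intro: inv_into_into)

lemma tube_in: "m \<in> L \<Longrightarrow> w \<in> W m \<Longrightarrow> s \<in> S m \<Longrightarrow> tube m (w, s) \<in> T m"
  using bij_betw_imp_surj_on[OF tube_bij] by blast

lemma tube_homeomorphic:
  assumes "m \<in> L"
  shows "homeomorphic_maps (prod_topology (subtopology (mtop (Q m)) (W m)) (subtopology X (S m))) (subtopology X (T m)) (tube m) (untube m)"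
  unfolding homeomorphic_maps_def
proof (intro conjI ballI)
  show "continuous_map (prod_topology (subtopology (mtop (Q m)) (W m)) (subtopology X (S m))) (subtopology X (T m)) (tube m)"
    using smooth_tube[OF assms] by (simp add: smooth_map_def)
  show "continuous_map (subtopology X (T m)) (prod_topology (subtopology (mtop (Q m)) (W m)) (subtopology X (S m))) (untube m)"
    using smooth_untube[OF assms] by (simp add: smooth_map_def)
qed (use untube_tube[OF assms] tube_untube[OF assms] in auto)

lemma tube_open:
  assumes m: "m \<in> L" and D: "openin (mtop (Q m)) D" and B: "openin X B"
  shows "openin X (tube m ` ((D \<inter> W m) \<times> (B \<inter> S m)))"
proof -
  have "openin (prod_topology (subtopology (mtop (Q m)) (W m)) (subtopology X (S m))) ((D \<inter> W m) \<times> (B \<inter> S m))"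
    using D B by (auto simp: openin_prod_Times_iff openin_subtopology)
  then have "openin (subtopology X (T m)) (tube m ` ((D \<inter> W m) \<times> (B \<inter> S m)))"
    using homeomorphic_maps_imp_map[OF tube_homeomorphic[OF m]] homeomorphic_imp_open_map open_map_def by blast
  then show ?thesis using slice_facts(10)[OF m] openin_open_subtopology by blast
qed

lemma stab_fixes: "h \<in> stab x \<Longrightarrow> \<phi> h x = x"
  by (simp add: stabilizer_def)

lemma slice_in_tube:
  assumes m: "m \<in> L" and s: "s \<in> S m"
  shows "s \<in> T m"
proof -
  note W = slice_facts(7,8,9)[OF m]
  let ?k = "\<kappa> m (stab m)"
  have sub: "subgroup (stab m) P" using group_action.stabilizer_subgroup[OF action] m level_subset by blast
  have "?k \<in> ?k <#\<^bsub>P\<^esub> stab m" using group.lcos_self[OF group_P W(2)[OF W(1)] sub] .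
  then have k: "?k \<in> stab m" using W(3)[OF W(1)] by simp
  then have ik: "inv\<^bsub>P\<^esub> ?k \<in> stab m" using sub subgroup.m_inv_closed by metis
  have "tube m (stab m, \<phi> (inv\<^bsub>P\<^esub> ?k) s) = s"
    unfolding tube_def using act_inv' slice_subset[OF m] s W(1,2) by auto
  then show ?thesis using tube_in[OF m W(1) slice_facts(4)[OF m ik s]] by simp
qed

text \<open>An element fixing \<open>s\<close> keeps it in the slice, and only \<open>stab m\<close>
  can move a point of the slice into the slice.\<close>

lemma stab_slice:
  assumes "m \<in> L" "s \<in> S m"
  shows "stab s \<subseteq> stab m"
  using slice_facts(3)[OF assms(1) _ assms(2)] assms(2) by (auto simp: stabilizer_def)

text \<open>Here compactness of the stabilizer enters: without it, the points of \<open>S\<^sub>H m\<close> could have a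
  stabilizer that is a proper subgroup of the stabilizer of \<open>m\<close>.\<close>

lemma stab_S\<^sub>H:
  assumes "m \<in> L" "s \<in> S\<^sub>H m"
  shows "stab s = stab m"
proof -
  obtain g where g: "g \<in> carrier P" "stab s = conjugate_set P g (stab m)" "s \<in> S m"
    using assms(2) by (auto simp: S\<^sub>H_def orbit_type_subset_def)
  then show ?thesis using slice_facts(16)[OF assms(1) g(1)] stab_slice[OF assms(1) g(3)] by simp
qed

lemma L\<^sub>H_iff: "s \<in> L\<^sub>H m \<longleftrightarrow> s \<in> S m \<and> s \<in> stratum m"
  by (auto simp: L\<^sub>H_def S\<^sub>H_def orbit_type_subset_def stratum_iff)

lemma L\<^sub>H_subset: "L\<^sub>H m \<subseteq> S\<^sub>H m" "S\<^sub>H m \<subseteq> S m" "L\<^sub>H m \<subseteq> S m"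
  by (auto simp: L\<^sub>H_def S\<^sub>H_def orbit_type_subset_def)

lemma m_in_L\<^sub>H: "m \<in> L \<Longrightarrow> m \<in> L\<^sub>H m"
  by (simp add: L\<^sub>H_iff slice_facts(2) stratum_refl)

text \<open>Strata are invariant under translation, so in tube coordinates the stratum of
  \<open>m\<close> is the product of \<open>W m\<close> with \<open>L\<^sub>H m\<close>.\<close>

lemma tube_stratum_iff:
  assumes m: "m \<in> L" and w: "w \<in> W m" and s: "s \<in> S m"
  shows "tube m (w, s) \<in> stratum m \<longleftrightarrow> s \<in> L\<^sub>H m"
proof -
  note k = slice_facts(8)[OF m w]
  have sX: "s \<in> topspace X" using slice_subset[OF m] s by blast
  have "\<phi> (\<kappa> m w) s \<in> stratum m \<longleftrightarrow> s \<in> stratum m"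
    using stratum_act[OF _ k, of s] stratum_act[OF _ inv_in[OF k], of "\<phi> (\<kappa> m w) s"] act_inv[OF sX k] by auto
  then show ?thesis using s by (simp add: tube_def L\<^sub>H_iff)
qed

text \<open>The element carrying \<open>s\<close> to \<open>s'\<close> belongs to
  \<open>stab m\<close> by the slice property, and this group is the stabilizer of \<open>s\<close>
  itself. Thus \<open>L\<^sub>H m\<close> meets each orbit at most once and can parametrize the
  quotient.\<close>

lemma L\<^sub>H_unique:
  assumes m: "m \<in> L" and s: "s \<in> L\<^sub>H m" "s' \<in> L\<^sub>H m" "\<pi> s = \<pi> s'"
  shows "s = s'"
proof -
  have sS: "s \<in> S m" "s' \<in> S m" using s L\<^sub>H_iff by auto
  then have sX: "s \<in> topspace X" "s' \<in> topspace X" using slice_subset[OF m] by auto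
  then obtain g where g: "g \<in> carrier P" "s' = \<phi> g s" using s(3) orbit_eq_iff[OF sX] by blast
  then have "g \<in> stab m" using slice_facts(3)[OF m g(1) sS(1)] sS by simp
  then have "g \<in> stab s" using stab_S\<^sub>H[OF m] s(1) L\<^sub>H_subset by blast
  then show ?thesis using g(2) stab_fixes by simp
qed

text \<open>The tubes around points of the stratum form an open set, and in it the stratum is
  relatively closed: a point of \<open>L\<close> in the tube of \<open>m\<close> but outside the
  stratum has its slice component outside \<open>S\<^sub>H m\<close>, which is closed in the slice,
  so a whole box of the tube around the point avoids the stratum.\<close>

lemma stratum_locally_closed:
  assumes x: "x \<in> L"
  shows "stratum x = (\<Union>y\<in>stratum x. T y \<inter> L) \<inter> Z closure_of stratum x"
    "openin Z (\<Union>y\<in>stratum x. T y \<inter> L)"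
proof -
  have sZ: "stratum x \<subseteq> topspace Z" using stratum_level level_subset by auto
  show "openin Z (\<Union>y\<in>stratum x. T y \<inter> L)"
    using slice_facts(10) stratum_level by (intro openin_Union) (auto simp: openin_subtopology)
  show "stratum x = (\<Union>y\<in>stratum x. T y \<inter> L) \<inter> Z closure_of stratum x"
  proof (intro subset_antisym subsetI)
    fix y assume y: "y \<in> stratum x"
    then have "y \<in> T y" using slice_in_tube slice_facts(2) stratum_level by blast
    then show "y \<in> (\<Union>y\<in>stratum x. T y \<inter> L) \<inter> Z closure_of stratum x"
      using y stratum_level closure_of_subset[OF sZ] by blast
  next
    fix z assume "z \<in> (\<Union>y\<in>stratum x. T y \<inter> L) \<inter> Z closure_of stratum x"
    then obtain m where m: "m \<in> stratum x" "z \<in> T m" "z \<in> L" "z \<in> Z closure_of stratum x" by blast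
    have mL: "m \<in> L" using m(1) stratum_level by blast
    have st: "stratum x = stratum m" using stratum_eq[OF m(1)] by simp
    obtain w s where ws: "untube m z = (w, s)" by (cases "untube m z")
    have ws': "w \<in> W m" "s \<in> S m" "z = tube m (w, s)" using tube_untube[OF mL m(2)] ws by auto
    show "z \<in> stratum x"
    proof (rule ccontr)
      assume "z \<notin> stratum x"
      then have "s \<notin> L\<^sub>H m" using tube_stratum_iff[OF mL ws'(1,2)] ws'(3) st by simp
      moreover have "s \<in> L"
        using m(3) ws' level_act_iff slice_subset[OF mL] slice_facts(8)[OF mL] by (auto simp: tube_def)
      ultimately have s: "s \<notin> S\<^sub>H m" by (simp add: L\<^sub>H_def)
      have "openin (subtopology X (S m)) (topspace (subtopology X (S m)) - S\<^sub>H m)"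
        using slice_facts(12)[OF mL] by blast
      then obtain B where B: "openin X B" "topspace (subtopology X (S m)) - S\<^sub>H m = B \<inter> S m"
        by (auto simp: openin_subtopology)
      have BS: "B \<inter> S m = S m - S\<^sub>H m" using B(2) slice_subset[OF mL] by auto
      let ?O = "tube m ` ((topspace (mtop (Q m)) \<inter> W m) \<times> (B \<inter> S m))"
      have "openin X ?O" by (rule tube_open[OF mL openin_topspace B(1)])
      then have "openin Z (?O \<inter> L)" by (auto simp: openin_subtopology)
      moreover have "(w, s) \<in> (topspace (mtop (Q m)) \<inter> W m) \<times> (B \<inter> S m)"
        using ws'(1,2) s BS openin_subset[OF slice_facts(6)[OF mL]] by auto
      then have "z \<in> ?O \<inter> L" using ws'(3) m(3) by blast
      ultimately obtain y where y: "y \<in> stratum x" "y \<in> ?O" using closure_of_meets[OF m(4)] by blast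
      then obtain w' s' where y': "w' \<in> W m" "s' \<in> S m - S\<^sub>H m" "y = tube m (w', s')" unfolding BS by blast
      then have "s' \<in> L\<^sub>H m" using tube_stratum_iff[OF mL] y(1) st by auto
      then show False using y'(2) L\<^sub>H_subset by blast
    qed
  qed
qed

text \<open>Some point \<open>z\<close> of the stratum of \<open>y\<close> lies in the tube around
  \<open>m\<close>. Moving it into the slice conjugates its stabilizer into that of
  \<open>m\<close>.\<close>

lemma closure_meets_tube:
  assumes m: "m \<in> L" and cl: "m \<in> Z closure_of stratum y"
  shows "\<exists>z\<in>stratum y. \<exists>g\<in>carrier P. conjugate_set P g (stab z) \<subseteq> stab m"
proof -
  have "openin Z (T m \<inter> L)" using slice_facts(10)[OF m] by (auto simp: openin_subtopology)
  moreover have "m \<in> T m \<inter> L" using slice_in_tube[OF m] slice_facts(2)[OF m] m by blast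
  ultimately obtain z where z: "z \<in> stratum y" "z \<in> T m" using closure_of_meets[OF cl] by blast
  obtain w s where ws: "untube m z = (w, s)" by (cases "untube m z")
  have ws': "w \<in> W m" "s \<in> S m" "z = \<phi> (\<kappa> m w) s" using tube_untube[OF m z(2)] ws by (auto simp: tube_def)
  note k = slice_facts(8)[OF m ws'(1)]
  have sX: "s \<in> topspace X" using slice_subset[OF m] ws'(2) by blast
  have "stab s = conjugate_set P (inv\<^bsub>P\<^esub> (\<kappa> m w)) (stab z)"
    using conj_sym[OF k] stab_act[OF sX k] ws'(3) by simp
  then show ?thesis using z(1) inv_in[OF k] stab_slice[OF m ws'(2)] by blast
qed

text \<open>Closeness is known only at \<open>m\<close>, but the comparison of orbit types it
  entails is invariant under conjugation. It therefore holds at every \<open>m'\<close> of the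
  stratum, where the approximation property is applied in the slice at \<open>m'\<close>.\<close>

lemma frontier_subset:
  assumes m: "m \<in> L" "m \<in> Z closure_of stratum y"
  shows "stratum m \<subseteq> Z closure_of stratum y"
proof
  fix m' assume m': "m' \<in> stratum m"
  then have m'L: "m' \<in> L" using stratum_level by blast
  obtain h where h: "h \<in> carrier P" "stab m' = conjugate_set P h (stab m)" using m' stratum_iff by blast
  obtain z g where z: "z \<in> stratum y" "g \<in> carrier P" "conjugate_set P g (stab z) \<subseteq> stab m"
    using closure_meets_tube[OF m] by blast
  have "conjugate_set P (h \<otimes>\<^bsub>P\<^esub> g) (stab z) \<subseteq> stab m'"
    using conjugate_set_mono[OF z(3), of P h] h(2) conj_mult[OF h(1) z(2)] by simp
  then have "orbit_type_le P (stab z) (stab m')"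
    unfolding orbit_type_le_def using mult_in[OF h(1) z(2)] by blast
  moreover have "z \<in> topspace X" using z(1) stratum_level level_subset by blast
  ultimately have "m' \<in> subtopology X (S m') closure_of (L \<inter> orbit_type_subset P \<phi> (S m') (stab z))"
    using slice_facts(15)[OF m'L] by blast
  then have "m' \<in> X closure_of (L \<inter> orbit_type_subset P \<phi> (S m') (stab z))"
    using closure_of_subtopology_subset by fastforce
  \<comment> \<open>Since \<open>z\<close> lies in the stratum of \<open>y\<close>, points of
    \<open>L\<close> with the orbit type of \<open>z\<close> do too.\<close>
  moreover have "L \<inter> orbit_type_subset P \<phi> (S m') (stab z) \<subseteq> L \<inter> stratum y"
    using stratum_eq[OF z(1)] stratum_iff[of _ z] by (auto simp: orbit_type_subset_def)
  ultimately have "m' \<in> X closure_of (L \<inter> stratum y)" using closure_of_mono by blast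
  then show "m' \<in> Z closure_of stratum y" using m'L by (simp add: closure_of_subtopology)
qed

lemma frontier:
  assumes x: "x \<in> L" and y: "y \<in> L" and dis: "disjnt (stratum x) (stratum y)"
    and meet: "stratum x \<inter> Z closure_of stratum y \<noteq> {}"
  shows "stratum x \<subseteq> Z closure_of stratum y - stratum y" "stratum y \<inter> Z closure_of stratum x = {}"
proof -
  obtain m where m: "m \<in> stratum x" "m \<in> Z closure_of stratum y" using meet by blast
  have mL: "m \<in> L" using m(1) stratum_level by blast
  have st: "stratum x = stratum m" using stratum_eq[OF m(1)] by simp
  show "stratum x \<subseteq> Z closure_of stratum y - stratum y"
    using frontier_subset[OF mL m(2)] st dis by (auto simp: disjnt_iff)
  show "stratum y \<inter> Z closure_of stratum x = {}"
  proof (rule ccontr)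
    assume "stratum y \<inter> Z closure_of stratum x \<noteq> {}"
    then obtain n where n: "n \<in> stratum y" "n \<in> Z closure_of stratum x" by blast
    have nL: "n \<in> L" using n(1) stratum_level by blast
    have sub: "stratum y \<subseteq> Z closure_of stratum x"
      using frontier_subset[OF nL n(2)] stratum_eq[OF n(1)] by simp
    let ?A = "\<Union>y\<in>stratum x. T y \<inter> L"
    have "m \<in> ?A" using m(1) stratum_locally_closed(1)[OF x] by blast
    then obtain z where "z \<in> stratum y" "z \<in> ?A"
      using closure_of_meets[OF m(2) stratum_locally_closed(2)[OF x]] by blast
    then have "z \<in> stratum x" using sub stratum_locally_closed(1)[OF x] by blast
    then show False using dis \<open>z \<in> stratum y\<close> by (auto simp: disjnt_iff)
  qed
qed

section \<open>Charts of the strata\<close>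

abbreviation slice_manifold where "slice_manifold m \<equiv> submanifold_of M (S m)"
abbreviation coset_manifold where "coset_manifold m \<equiv> submanifold_of (Q m) (W m)"

lemma chart_cover_M: "chart_cover M"
  by (rule smooth_manifold_chart_cover[OF manifold])

lemma chart_covers:
  assumes "m \<in> L"
  shows "chart_cover (slice_manifold m)" "chart_cover (coset_manifold m)" "chart_cover (submanifold_of M (T m))"
    "submanifold (Q m) (W m)" "submanifold M (T m)" "chart_cover (Q m)"
proof -
  show 1: "submanifold (Q m) (W m)" "submanifold M (T m)"
    using submanifold_open slice_facts(5,6,10)[OF assms] manifold by blast+
  show "chart_cover (slice_manifold m)" "chart_cover (coset_manifold m)" "chart_cover (submanifold_of M (T m))"
    using slice_facts(1)[OF assms] 1 by (auto intro: chart_cover_submanifold)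
  show "chart_cover (Q m)" using slice_facts(5)[OF assms] by (rule smooth_manifold_chart_cover)
qed

text \<open>There are three nested submanifolds, the slice, its orbit type part and the trace of
  \<open>L\<close>. The chart belongs to the second and is adapted to the third; \<open>F\<close>
  models the third, and \<open>ldom\<close> is the domain after restriction to it.\<close>

definition level_chart where
  "level_chart m e F \<longleftrightarrow> m \<in> L \<and> e \<in> max_atlas (submanifold_of (slice_manifold m) (S\<^sub>H m)) \<and> adapted_chart e (L\<^sub>H m) F"

abbreviation ldom where "ldom m e \<equiv> cdom e \<inter> L\<^sub>H m"

lemma level_chart_facts:
  assumes "level_chart m e F"
  shows "m \<in> L" "is_chart (subtopology (subtopology X (S m)) (S\<^sub>H m)) e" "model_space F" "F \<subseteq> cspace e"
    "cmap e ` ldom m e = cmap e ` cdom e \<inter> F" "openin (top_of_set F) (cmap e ` ldom m e)"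
    "cdom e \<subseteq> S\<^sub>H m"
proof -
  show m: "m \<in> L" using assms by (simp add: level_chart_def)
  show ic: "is_chart (subtopology (subtopology X (S m)) (S\<^sub>H m)) e"
    using assms max_atlas_is_chart unfolding level_chart_def by fastforce
  show F: "model_space F" "F \<subseteq> cspace e" "cmap e ` ldom m e = cmap e ` cdom e \<inter> F"
    using assms by (auto simp: level_chart_def adapted_chart_def)
  obtain B where "open B" "cmap e ` cdom e = cspace e \<inter> B" using ic by (auto simp: is_chart_def openin_open)
  then show "openin (top_of_set F) (cmap e ` ldom m e)" using F by (auto simp: openin_open)
  show "cdom e \<subseteq> S\<^sub>H m" using ic openin_subset unfolding is_chart_def by fastforce
qed

lemma level_chart_exists:
  assumes "m \<in> L"
  obtains e F where "level_chart m e F" "m \<in> ldom m e"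
  using slice_facts(14)[OF assms] m_in_L\<^sub>H[OF assms] assms unfolding submanifold_def level_chart_def by blast

lemma level_chart_inv:
  assumes "level_chart m e F" "y \<in> cmap e ` ldom m e"
  shows "chart_inv e y \<in> ldom m e" "cmap e (chart_inv e y) = y"
  using assms(2) chart_inv_cmap[OF level_chart_facts(2)[OF assms(1)]] by auto

text \<open>The inverse chart is smooth into \<open>S\<^sub>H m\<close>, hence by inclusion into the
  slice; restricting it to the subspace \<open>F\<close> leaves the part over
  \<open>L\<^sub>H m\<close>.\<close>

lemma smooth_into_level_inv:
  assumes "level_chart m e F"
  shows "smooth_into F (cmap e ` ldom m e) (slice_manifold m) (chart_inv e)"
proof -
  note f = level_chart_facts[OF assms]
  have "smooth_into (cspace e) (cmap e ` cdom e) (submanifold_of (slice_manifold m) (S\<^sub>H m)) (chart_inv e)"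
    using assms by (intro smooth_into_chart_inv) (simp add: level_chart_def)
  then have "smooth_into (cspace e) (cmap e ` cdom e) (slice_manifold m) (chart_inv e)"
    by (rule smooth_into_from_submanifold[OF _ chart_covers(1)[OF f(1)] slice_facts(13)[OF f(1)]])
  then show ?thesis by (rule smooth_into_restrict[OF _ f(3,4,6)]) auto
qed

text \<open>Smoothness of \<open>k\<close> is given into the slice, while \<open>e\<close> is a
  chart of \<open>S\<^sub>H m\<close> only. As \<open>k\<close> takes its values there, it is also
  smooth into that submanifold.\<close>

lemma smooth_on_level_chart:
  assumes e: "level_chart m e F" and k: "smooth_into E U (slice_manifold m) k" "k ` U \<subseteq> cdom e"
  shows "smooth_on E U (\<lambda>x. cmap e (k x))"
proof -
  note f = level_chart_facts[OF e]
  have "smooth_into E U (submanifold_of (slice_manifold m) (S\<^sub>H m)) k"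
    by (rule smooth_into_submanifold[OF k(1) chart_covers(1)[OF f(1)]]) (use k(2) f(7) in auto)
  then have "smooth_on E (U \<inter> k -` cdom e) (\<lambda>x. cmap e (k x))"
    by (rule smooth_into_max_atlas[OF _ chart_cover_submanifold[OF slice_facts(13)[OF f(1)]]])
       (use e in \<open>simp add: level_chart_def\<close>)
  moreover have "U \<inter> k -` cdom e = U" using k(2) by auto
  ultimately show ?thesis by simp
qed

text \<open>Open sets of the chart are expressed as traces of open sets \<open>B\<close> of the
  ambient space, because both the openness of tubes and that of orbit images are stated for such
  sets.\<close>

lemma level_chart_open:
  assumes "level_chart m e F" "openin (top_of_set (cmap e ` cdom e)) V"
  obtains B where "openin X B" "{s \<in> ldom m e. cmap e s \<in> V} = B \<inter> L\<^sub>H m"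
proof -
  note f = level_chart_facts[OF assms(1)]
  let ?X = "subtopology (subtopology X (S m)) (S\<^sub>H m)"
  have o: "openin ?X (cdom e)" using f(2) by (simp add: is_chart_def)
  have "continuous_map (subtopology ?X (cdom e)) (top_of_set (cmap e ` cdom e)) (cmap e)"
    using is_chart_maps[OF f(2)] by (simp add: homeomorphic_maps_def)
  from openin_continuous_map_preimage[OF this assms(2)]
  have "openin (subtopology ?X (cdom e)) {s \<in> cdom e. cmap e s \<in> V}"
    unfolding topspace_open_subtopology[OF o] .
  then have "openin ?X {s \<in> cdom e. cmap e s \<in> V}" using o openin_open_subtopology by blast
  then have "openin (subtopology X (S m \<inter> S\<^sub>H m)) {s \<in> cdom e. cmap e s \<in> V}" by (simp add: subtopology_subtopology)
  then obtain B where B: "openin X B" "{s \<in> cdom e. cmap e s \<in> V} = B \<inter> (S m \<inter> S\<^sub>H m)"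
    by (auto simp: openin_subtopology)
  have "{s \<in> ldom m e. cmap e s \<in> V} = B \<inter> L\<^sub>H m" using B(2) L\<^sub>H_subset[of m] by blast
  then show ?thesis using that B(1) by blast
qed

lemma ldom_open:
  assumes "level_chart m e F"
  obtains B where "openin X B" "ldom m e = B \<inter> L\<^sub>H m"
proof (rule level_chart_open[OF assms, of "cmap e ` cdom e"])
  fix B assume "openin X B" "{s \<in> ldom m e. cmap e s \<in> cmap e ` cdom e} = B \<inter> L\<^sub>H m"
  moreover have "{s \<in> ldom m e. cmap e s \<in> cmap e ` cdom e} = ldom m e" by auto
  ultimately show thesis using that by simp
qed simp

text \<open>This exhibits a product with a piece of \<open>L\<^sub>H m\<close> as the trace on the
  stratum of an open tube box, which makes chart domains relatively open.\<close>

lemma tube_stratum: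
  assumes "m \<in> L" "D \<subseteq> W m"
  shows "tube m ` (D \<times> (B \<inter> L\<^sub>H m)) = tube m ` (D \<times> (B \<inter> S m)) \<inter> stratum m"
proof (intro subset_antisym subsetI)
  fix x assume "x \<in> tube m ` (D \<times> (B \<inter> L\<^sub>H m))"
  then obtain w s where ws: "w \<in> D" "s \<in> B" "s \<in> L\<^sub>H m" "x = tube m (w, s)" by blast
  have "s \<in> S m" using ws(3) L\<^sub>H_iff by blast
  then show "x \<in> tube m ` (D \<times> (B \<inter> S m)) \<inter> stratum m"
    using ws assms tube_stratum_iff[OF assms(1), of w s] by blast
next
  fix x assume "x \<in> tube m ` (D \<times> (B \<inter> S m)) \<inter> stratum m"
  then obtain w s where ws: "w \<in> D" "s \<in> B" "s \<in> S m" "x = tube m (w, s)" "x \<in> stratum m" by blast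
  then show "x \<in> tube m ` (D \<times> (B \<inter> L\<^sub>H m))"
    using assms tube_stratum_iff[OF assms(1), of w s] by blast
qed

text \<open>The product of a chart \<open>q\<close> of the coset manifold with a chart
  \<open>e\<close> of the submanifold in the slice, transported by the tube.\<close>

definition stratum_chart :: "'m \<Rightarrow> ('g set, 'eg) chart \<Rightarrow> ('m, 'em) chart \<Rightarrow> 'em set \<Rightarrow> ('m, 'eg \<times> 'em) chart" where
  "stratum_chart m q e F =
     \<lparr>cdom = tube m ` ((cdom q \<inter> W m) \<times> ldom m e),
      cmap = (\<lambda>x. (cmap q (fst (untube m x)), cmap e (snd (untube m x)))),
      cspace = cspace q \<times> F\<rparr>"

definition stratum_atlas :: "'m set \<Rightarrow> ('m, 'eg \<times> 'em) chart set" where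
  "stratum_atlas \<sigma> = {stratum_chart m q e F | m q e F. level_chart m e F \<and> stratum m = \<sigma> \<and> q \<in> matlas (Q m)}"

context
  fixes m q e F
  assumes e: "level_chart m e F" and q: "q \<in> matlas (Q m)"
begin

lemma stratum_chart_image:
  "openin (top_of_set (cspace q \<times> F)) (cmap q ` (cdom q \<inter> W m) \<times> cmap e ` ldom m e)"
  using chart_image_open[OF chart_cover_is_chart[OF chart_covers(6) q] slice_facts(6)] level_chart_facts[OF e]
  by (intro openin_Times_top_of_set) auto

lemma stratum_chart_model: "model_space (cspace q \<times> F)"
  using chart_cover_is_chart[OF chart_covers(6) q] level_chart_facts[OF e]
  by (auto simp: is_chart_def intro: model_space_Times)

text \<open>The inverse chart is a pair of inverse charts followed by the tube map, and each stage
  preserves \<open>smooth_into\<close>.\<close>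

lemma smooth_into_stratum_inv:
  "smooth_into (cspace q \<times> F) (cmap q ` (cdom q \<inter> W m) \<times> cmap e ` ldom m e) M
     (\<lambda>y. tube m (chart_inv q (fst y), chart_inv e (snd y)))"
proof -
  note f = level_chart_facts[OF e]
  note m = f(1)
  note iq = chart_cover_is_chart[OF chart_covers(6)[OF m] q]
  note oq = chart_image_open[OF iq slice_facts(6)[OF m]]
  let ?U = "cmap q ` (cdom q \<inter> W m) \<times> cmap e ` ldom m e"
  have "smooth_into (cspace q) (cmap q ` cdom q) (Q m) (chart_inv q)"
    by (rule smooth_into_chart_inv[OF smooth_manifold_max_atlas[OF slice_facts(5)[OF m] q]])
  then have "smooth_into (cspace q) (cmap q ` (cdom q \<inter> W m)) (Q m) (chart_inv q)"
    by (rule smooth_into_restrict[OF _ _ _ oq]) (use iq in \<open>auto simp: is_chart_def\<close>)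
  then have sq: "smooth_into (cspace q) (cmap q ` (cdom q \<inter> W m)) (coset_manifold m) (chart_inv q)"
    by (rule smooth_into_submanifold[OF _ chart_covers(6)[OF m]]) (use chart_inv_cmap[OF iq] in auto)
  have 1: "smooth_into (cspace q \<times> F) ?U (coset_manifold m) (\<lambda>y. chart_inv q (fst y))"
    by (rule smooth_into_precompose[OF sq chart_covers(2)[OF m] stratum_chart_model stratum_chart_image
          smooth_on_fst[OF stratum_chart_model stratum_chart_image]]) (auto intro: continuous_on_fst continuous_on_id)
  have 2: "smooth_into (cspace q \<times> F) ?U (slice_manifold m) (\<lambda>y. chart_inv e (snd y))"
    by (rule smooth_into_precompose[OF smooth_into_level_inv[OF e] chart_covers(1)[OF m] stratum_chart_model stratum_chart_image
          smooth_on_snd[OF stratum_chart_model stratum_chart_image]]) (auto intro: continuous_on_snd continuous_on_id)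
  have "smooth_into (cspace q \<times> F) ?U (submanifold_of M (T m)) (\<lambda>y. tube m (chart_inv q (fst y), chart_inv e (snd y)))"
    by (rule smooth_into_compose[OF smooth_into_Pair[OF 1 2] chart_cover_prod _ smooth_tube[OF m]])
       (use chart_covers[OF m] in auto)
  then show ?thesis by (rule smooth_into_from_submanifold[OF _ chart_cover_M chart_covers(5)[OF m]])
qed

text \<open>A map into the chart domain is composed with the smooth inverse of the tube, and its two
  components are read in \<open>q\<close> and \<open>e\<close>.\<close>

lemma smooth_on_stratum_chart:
  assumes k: "smooth_into E U M k" and dom: "k ` U \<subseteq> cdom (stratum_chart m q e F)"
  shows "smooth_on E U (\<lambda>x. cmap (stratum_chart m q e F) (k x))"
proof -
  note f = level_chart_facts[OF e]
  note m = f(1)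
  let ?u = "\<lambda>x. untube m (k x)"
  have LS: "ldom m e \<subseteq> S m" using L\<^sub>H_subset(3) by blast
  have u: "?u x \<in> (cdom q \<inter> W m) \<times> ldom m e" "k x \<in> T m" if "x \<in> U" for x
  proof -
    have "k x \<in> tube m ` ((cdom q \<inter> W m) \<times> ldom m e)" using dom that by (auto simp: stratum_chart_def)
    then obtain w s where ws: "w \<in> cdom q \<inter> W m" "s \<in> ldom m e" "k x = tube m (w, s)" by blast
    have "s \<in> S m" using ws(2) LS by blast
    then show "?u x \<in> (cdom q \<inter> W m) \<times> ldom m e" "k x \<in> T m"
      using ws untube_tube[OF m, of w s] tube_in[OF m, of w s] by auto
  qed
  have "smooth_into E U (submanifold_of M (T m)) k"
    by (rule smooth_into_submanifold[OF k chart_cover_M]) (use u in auto)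
  then have s: "smooth_into E U (prod_manifold (coset_manifold m) (slice_manifold m)) ?u"
    by (rule smooth_into_compose[OF _ chart_covers(3)[OF m] chart_cover_prod[OF chart_covers(2,1)[OF m]] smooth_untube[OF m]])
  have "smooth_into E U (coset_manifold m) (\<lambda>x. fst (?u x))"
    by (rule smooth_into_fst[OF s chart_covers(2,1)[OF m]])
  then have "smooth_into E U (Q m) (\<lambda>x. fst (?u x))"
    by (rule smooth_into_from_submanifold[OF _ chart_covers(6,4)[OF m]])
  then have "smooth_on E (U \<inter> (\<lambda>x. fst (?u x)) -` cdom q) (\<lambda>x. cmap q (fst (?u x)))"
    by (rule smooth_intoD(4)[OF _ q])
  moreover have "U \<inter> (\<lambda>x. fst (?u x)) -` cdom q = U" using u(1) by (auto simp: mem_Times_iff)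
  ultimately have 1: "smooth_on E U (\<lambda>x. cmap q (fst (?u x)))" by simp
  have 2: "smooth_on E U (\<lambda>x. cmap e (snd (?u x)))"
    by (rule smooth_on_level_chart[OF e smooth_into_snd[OF s chart_covers(2,1)[OF m]]])
       (use u(1) in \<open>auto simp: mem_Times_iff\<close>)
  show ?thesis
    using smooth_on_Pair[OF smooth_intoD(1,2)[OF k] 1 2] by (simp add: stratum_chart_def)
qed

lemma is_chart_stratum_chart:
  "is_chart (subtopology X (stratum m)) (stratum_chart m q e F)"
  "cmap (stratum_chart m q e F) ` cdom (stratum_chart m q e F) = cmap q ` (cdom q \<inter> W m) \<times> cmap e ` ldom m e"
proof -
  note f = level_chart_facts[OF e]
  note m = f(1)
  note iq = chart_cover_is_chart[OF chart_covers(6)[OF m] q]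
  let ?D = "tube m ` ((cdom q \<inter> W m) \<times> ldom m e)"
  let ?V = "cmap q ` (cdom q \<inter> W m) \<times> cmap e ` ldom m e"
  let ?h = "\<lambda>x. (cmap q (fst (untube m x)), cmap e (snd (untube m x)))"
  let ?k = "\<lambda>y. tube m (chart_inv q (fst y), chart_inv e (snd y))"
  have LS: "s \<in> S m" if "s \<in> ldom m e" for s using that L\<^sub>H_subset(3) by blast
  have uD: "untube m (tube m (w, s)) = (w, s)" if "w \<in> cdom q \<inter> W m" "s \<in> ldom m e" for w s
    using that LS untube_tube[OF m] by blast
  have DT: "?D \<subseteq> T m" using LS tube_in[OF m] by blast
  \<comment> \<open>The domain is the trace on the stratum of an open tube box, hence open
    there.\<close>
  obtain B where B: "openin X B" "ldom m e = B \<inter> L\<^sub>H m" by (rule ldom_open[OF e])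
  have D: "?D = tube m ` ((cdom q \<inter> W m) \<times> (B \<inter> S m)) \<inter> stratum m"
    unfolding B(2) by (rule tube_stratum[OF m]) auto
  have "openin X (tube m ` ((cdom q \<inter> W m) \<times> (B \<inter> S m)))"
    using iq by (intro tube_open[OF m _ B(1)]) (simp add: is_chart_def)
  then have oD: "openin (subtopology X (stratum m)) ?D" unfolding D by (auto simp: openin_subtopology)
  have sub: "subtopology (subtopology X (stratum m)) ?D = subtopology X ?D"
    using D by (simp add: subtopology_subtopology inf.absorb2)
  have "homeomorphic_maps (subtopology (subtopology X (stratum m)) ?D) (top_of_set ?V) ?h ?k"
    unfolding homeomorphic_maps_def sub
  proof (intro conjI ballI)
    have "continuous_map (subtopology X ?D) (prod_topology (subtopology (mtop (Q m)) (W m)) (subtopology X (S m))) (untube m)"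
      using tube_homeomorphic[OF m] DT unfolding homeomorphic_maps_def
      by (blast intro: continuous_map_from_subtopology_mono)
    then have cu: "continuous_map (subtopology X ?D) (mtop (Q m)) (\<lambda>x. fst (untube m x))"
      "continuous_map (subtopology X ?D) X (\<lambda>x. snd (untube m x))"
      by (auto simp: continuous_map_pairwise o_def continuous_map_in_subtopology)
    have "continuous_map (subtopology X ?D) (subtopology (mtop (Q m)) (cdom q)) (\<lambda>x. fst (untube m x))"
      using cu(1) uD by (auto simp: continuous_map_in_subtopology)
    moreover have "continuous_map (subtopology (mtop (Q m)) (cdom q)) euclidean (cmap q)"
      using is_chart_maps[OF iq] by (simp add: homeomorphic_maps_def continuous_map_in_subtopology)
    ultimately have c1: "continuous_map (subtopology X ?D) euclidean (\<lambda>x. cmap q (fst (untube m x)))"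
      by (rule continuous_map_compose[unfolded o_def])
    have "continuous_map (subtopology X ?D) (subtopology (subtopology (subtopology X (S m)) (S\<^sub>H m)) (cdom e)) (\<lambda>x. snd (untube m x))"
      using cu(2) uD f(7) L\<^sub>H_subset(2)[of m] by (auto simp: continuous_map_in_subtopology)
    moreover have "continuous_map (subtopology (subtopology (subtopology X (S m)) (S\<^sub>H m)) (cdom e)) euclidean (cmap e)"
      using is_chart_maps[OF f(2)] unfolding homeomorphic_maps_def by (simp add: continuous_map_in_subtopology)
    ultimately have c2: "continuous_map (subtopology X ?D) euclidean (\<lambda>x. cmap e (snd (untube m x)))"
      by (rule continuous_map_compose[unfolded o_def])
    have "continuous_map (subtopology X ?D) (prod_topology euclidean euclidean) ?h"
      by (intro continuous_map_pairedI c1 c2)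
    then show "continuous_map (subtopology X ?D) (top_of_set ?V) ?h"
      using uD by (auto simp: continuous_map_in_subtopology)
    have kV: "?k y \<in> ?D" if "y \<in> ?V" for y
      using that chart_inv_cmap[OF iq] level_chart_inv(1)[OF e] by fastforce
    show "continuous_map (top_of_set ?V) (subtopology X ?D) ?k"
      using smooth_intoD(3)[OF smooth_into_stratum_inv] kV by (auto simp: continuous_map_in_subtopology)
    fix x assume "x \<in> topspace (subtopology X ?D)"
    then obtain w s where "w \<in> cdom q \<inter> W m" "s \<in> ldom m e" "x = tube m (w, s)" by auto
    then show "?k (?h x) = x" using uD chart_inv_cmap[OF iq] chart_inv_cmap[OF f(2)] by simp
  next
    fix y assume "y \<in> topspace (top_of_set ?V)"
    then obtain w s where "w \<in> cdom q \<inter> W m" "s \<in> ldom m e" "y = (cmap q w, cmap e s)" by auto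
    then show "?h (?k y) = y" using uD chart_inv_cmap[OF iq] chart_inv_cmap[OF f(2)] by simp
  qed
  from is_chartI[OF oD stratum_chart_model stratum_chart_image this]
  show "is_chart (subtopology X (stratum m)) (stratum_chart m q e F)"
    "cmap (stratum_chart m q e F) ` cdom (stratum_chart m q e F) = cmap q ` (cdom q \<inter> W m) \<times> cmap e ` ldom m e"
    by (simp_all add: stratum_chart_def)
qed

lemma stratum_chart_inv:
  assumes "y \<in> cmap q ` (cdom q \<inter> W m) \<times> cmap e ` ldom m e"
  shows "tube m (chart_inv q (fst y), chart_inv e (snd y)) = chart_inv (stratum_chart m q e F) y"
    "tube m (chart_inv q (fst y), chart_inv e (snd y)) \<in> cdom (stratum_chart m q e F)"
proof -
  note f = level_chart_facts[OF e]
  note m = f(1)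
  note iq = chart_cover_is_chart[OF chart_covers(6)[OF m] q]
  obtain w s where ws: "w \<in> cdom q \<inter> W m" "s \<in> ldom m e" "y = (cmap q w, cmap e s)" using assms by auto
  have s: "s \<in> S m" using ws(2) L\<^sub>H_subset(3) by blast
  have "tube m (chart_inv q (fst y), chart_inv e (snd y)) = tube m (w, s)"
    using ws chart_inv_cmap[OF iq] chart_inv_cmap[OF f(2)] by simp
  moreover have d: "tube m (w, s) \<in> cdom (stratum_chart m q e F)" using ws by (auto simp: stratum_chart_def)
  moreover have "cmap (stratum_chart m q e F) (tube m (w, s)) = y"
    using untube_tube[OF m _ s] ws by (simp add: stratum_chart_def)
  ultimately show "tube m (chart_inv q (fst y), chart_inv e (snd y)) = chart_inv (stratum_chart m q e F) y"
    "tube m (chart_inv q (fst y), chart_inv e (snd y)) \<in> cdom (stratum_chart m q e F)"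
    using chart_inv_cmap[OF is_chart_stratum_chart(1) d] by auto
qed

end

lemma stratum_smooth_manifold:
  assumes "x \<in> L"
  shows "smooth_manifold \<lparr>mtop = subtopology X (stratum x), matlas = stratum_atlas (stratum x)\<rparr>"
proof (rule smooth_manifold_from_lifts[where p = "\<lambda>x. x" and M = M and Y = UNIV])
  show "Hausdorff_space (subtopology X (stratum x))"
    using manifold Hausdorff_space_subtopology by (auto simp: smooth_manifold_def)
  have at: "\<exists>m q e F. level_chart m e F \<and> q \<in> matlas (Q m) \<and> stratum m = stratum x \<and> c = stratum_chart m q e F"
    if "c \<in> stratum_atlas (stratum x)" for c
    using that unfolding stratum_atlas_def by blast
  show ch: "is_chart (subtopology X (stratum x)) c" if "c \<in> stratum_atlas (stratum x)" for c
    using at[OF that] is_chart_stratum_chart(1) by metis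
  show "(\<Union>c\<in>stratum_atlas (stratum x). cdom c) = topspace (subtopology X (stratum x))"
  proof (intro subset_antisym subsetI)
    fix y assume "y \<in> (\<Union>c\<in>stratum_atlas (stratum x). cdom c)"
    then obtain c where c: "c \<in> stratum_atlas (stratum x)" "y \<in> cdom c" by blast
    have "openin (subtopology X (stratum x)) (cdom c)" using ch[OF c(1)] by (simp add: is_chart_def)
    then show "y \<in> topspace (subtopology X (stratum x))" using c(2) openin_subset by blast
  next
    fix m assume "m \<in> topspace (subtopology X (stratum x))"
    then have m: "m \<in> stratum x" by simp
    then have mL: "m \<in> L" using stratum_level by blast
    obtain e F where e: "level_chart m e F" "m \<in> ldom m e" by (rule level_chart_exists[OF mL])
    have mT: "m \<in> T m" using slice_in_tube[OF mL] slice_facts(2)[OF mL] .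
    have "stab m \<in> topspace (mtop (Q m))" using slice_facts(6,7)[OF mL] openin_subset by blast
    then obtain q where q: "q \<in> matlas (Q m)" "stab m \<in> cdom q"
      by (rule chart_cover_obtain[OF chart_covers(6)[OF mL]])
    \<comment> \<open>The section's value at the trivial coset may differ from the identity, but it
      lies in \<open>stab m\<close> and so fixes \<open>m\<close>; this places \<open>m\<close> in
      the chart domain.\<close>
    let ?k = "\<kappa> m (stab m)"
    note W = slice_facts(7,8,9)[OF mL]
    have sub: "subgroup (stab m) P" using group_action.stabilizer_subgroup[OF action] mL level_subset by blast
    have "?k \<in> ?k <#\<^bsub>P\<^esub> stab m" using group.lcos_self[OF group_P W(2)[OF W(1)] sub] .
    then have "?k \<in> stab m" using W(3)[OF W(1)] by simp
    then have "m = tube m (stab m, m)" using stab_fixes by (simp add: tube_def)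
    then have "m \<in> cdom (stratum_chart m q e F)"
      using q e W(1) unfolding stratum_chart_def by auto
    moreover have "stratum_chart m q e F \<in> stratum_atlas (stratum x)"
      using e q stratum_eq[OF m] unfolding stratum_atlas_def by blast
    ultimately show "m \<in> (\<Union>c\<in>stratum_atlas (stratum x). cdom c)" by blast
  qed
  show "\<exists>K. smooth_into (cspace c) (cmap c ` cdom c) M K \<and>
      (\<forall>y\<in>cmap c ` cdom c. K y \<in> UNIV \<and> K y = chart_inv c y)" if ca: "c \<in> stratum_atlas (stratum x)" for c
  proof -
    obtain m q e F where c: "level_chart m e F" "q \<in> matlas (Q m)" "c = stratum_chart m q e F"
      using at[OF ca] by blast
    have "cspace c = cspace q \<times> F" by (simp add: c(3) stratum_chart_def)
    then show ?thesis
      using smooth_into_stratum_inv[OF c(1,2)] stratum_chart_inv(1)[OF c(1,2)] is_chart_stratum_chart(2)[OF c(1,2)]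
      by (intro exI[of _ "\<lambda>y. tube m (chart_inv q (fst y), chart_inv e (snd y))"]) (simp add: c(3))
  qed
  show "smooth_on E U (\<lambda>y. cmap c (k y))"
    if ca: "c \<in> stratum_atlas (stratum x)" and k: "smooth_into E U M k" "\<And>y. y \<in> U \<Longrightarrow> k y \<in> cdom c"
    for c and E U :: "('eg \<times> 'em) set" and k
  proof -
    obtain m q e F where c: "level_chart m e F" "q \<in> matlas (Q m)" "c = stratum_chart m q e F"
      using at[OF ca] by blast
    have "k ` U \<subseteq> cdom (stratum_chart m q e F)" using k(2) c(3) by blast
    then show ?thesis unfolding c(3) by (rule smooth_on_stratum_chart[OF c(1,2) k(1)])
  qed
qed

end

section \<open>Strata of the quotient\<close>

context level_stratification
begin

section \<open>Topology and charts of the quotient\<close>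

abbreviation quot where "quot \<equiv> quotient_topology Z \<pi>"

lemma topspace_Z: "topspace Z = L"
  using level_subset by auto

lemma level_X: "x \<in> L \<Longrightarrow> x \<in> topspace X"
  using level_subset by blast

lemma topspace_quot: "topspace quot = \<pi> ` L"
proof
  show "topspace quot \<subseteq> \<pi> ` L"
    using openin_topspace[of quot] unfolding openin_quotient_topology topspace_Z by blast
  have "{x \<in> L. \<pi> x \<in> \<pi> ` L} = L" by blast
  moreover have "openin Z L" using openin_topspace[of Z] unfolding topspace_Z .
  ultimately have "openin quot (\<pi> ` L)"
    unfolding openin_quotient_topology topspace_Z by simp
  then show "\<pi> ` L \<subseteq> topspace quot" by (rule openin_subset)
qed

lemma quot_continuous: "continuous_map Z quot \<pi>"
  unfolding continuous_map_def topspace_quot topspace_Z openin_quotient_topology by auto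

text \<open>The saturation of \<open>A\<close> is the union of its preimages under the translations,
  each of which is continuous and preserves \<open>L\<close>.\<close>

lemma quot_open:
  assumes "openin Z A"
  shows "openin quot (\<pi> ` A)"
  unfolding openin_quotient_topology topspace_Z
proof
  have AL: "A \<subseteq> L" using assms openin_subset topspace_Z by blast
  then show "\<pi> ` A \<subseteq> \<pi> ` L" by blast
  have "{x \<in> L. \<pi> x \<in> \<pi> ` A} = (\<Union>g\<in>carrier P. {x \<in> topspace Z. \<phi> g x \<in> A})"
  proof (intro subset_antisym subsetI)
    fix x assume "x \<in> {x \<in> L. \<pi> x \<in> \<pi> ` A}"
    then obtain a where a: "x \<in> L" "a \<in> A" "\<pi> x = \<pi> a" by blast
    then have "a \<in> topspace X" using AL level_X by blast
    then obtain g where "g \<in> carrier P" "a = \<phi> g x" using orbit_eq_iff[OF level_X[OF a(1)]] a(3) by blast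
    then show "x \<in> (\<Union>g\<in>carrier P. {x \<in> topspace Z. \<phi> g x \<in> A})" using a topspace_Z by blast
  next
    fix x assume "x \<in> (\<Union>g\<in>carrier P. {x \<in> topspace Z. \<phi> g x \<in> A})"
    then obtain g where g: "g \<in> carrier P" "x \<in> L" "\<phi> g x \<in> A" using topspace_Z by blast
    have "\<pi> x = \<pi> (\<phi> g x)" using orbit_eq_iff[OF level_X[OF g(2)] act_in[OF g(1) level_X[OF g(2)]]] g(1) by blast
    then show "x \<in> {x \<in> L. \<pi> x \<in> \<pi> ` A}" using g by blast
  qed
  moreover have "openin Z {x \<in> topspace Z. \<phi> g x \<in> A}" if g: "g \<in> carrier P" for g
  proof -
    have "continuous_map X X (\<phi> g)" using smooth_translation[OF g] by (simp add: smooth_map_def)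
    then have "continuous_map Z X (\<phi> g)" by (rule continuous_map_from_subtopology)
    moreover have "\<phi> g ` topspace Z \<subseteq> L" using level_invariant[OF g] topspace_Z by blast
    ultimately have "continuous_map Z Z (\<phi> g)" by (auto simp: continuous_map_in_subtopology)
    then show ?thesis using assms by (rule openin_continuous_map_preimage)
  qed
  ultimately show "openin Z {x \<in> L. \<pi> x \<in> \<pi> ` A}" by (auto intro: openin_Union)
qed

text \<open>Points with different orbits form the complement of a closed relation, so they have
  neighbourhoods \<open>A\<close> and \<open>B\<close> whose product avoids it. Their orbit images
  are disjoint, and open because the orbit map is open.\<close>

lemma quot_Hausdorff: "Hausdorff_space quot"
  unfolding Hausdorff_space_def topspace_quot
proof (intro allI impI)
  fix p p' assume "p \<in> \<pi> ` L \<and> p' \<in> \<pi> ` L \<and> p \<noteq> p'"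
  then obtain x y where xy: "x \<in> L" "y \<in> L" "p = \<pi> x" "p' = \<pi> y" "\<pi> x \<noteq> \<pi> y" by blast
  let ?R = "{(x, y). x \<in> topspace X \<and> y \<in> topspace X \<and> \<pi> x = \<pi> y}"
  have op: "openin (prod_topology X X) (topspace (prod_topology X X) - ?R)"
    using openin_diff[OF openin_topspace orbit_relation_closed] .
  have "(x, y) \<in> topspace (prod_topology X X) - ?R" using xy(5) level_X[OF xy(1)] level_X[OF xy(2)] by simp
  from openin_prod_topology_alt[THEN iffD1, OF op, rule_format, OF this]
  obtain A B where AB: "openin X A" "openin X B" "x \<in> A" "y \<in> B"
    "A \<times> B \<subseteq> topspace (prod_topology X X) - ?R"
    by blast
  have "disjnt (\<pi> ` (A \<inter> L)) (\<pi> ` (B \<inter> L))"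
  proof (rule ccontr)
    assume "\<not> disjnt (\<pi> ` (A \<inter> L)) (\<pi> ` (B \<inter> L))"
    then obtain a b where ab: "a \<in> A \<inter> L" "b \<in> B \<inter> L" "\<pi> a = \<pi> b" by (auto simp: disjnt_iff)
    then have "(a, b) \<in> ?R" using level_X by blast
    then show False using AB(5) ab by blast
  qed
  moreover have "openin quot (\<pi> ` (A \<inter> L))" "openin quot (\<pi> ` (B \<inter> L))"
    using AB by (auto intro!: quot_open simp: openin_subtopology)
  ultimately show "\<exists>U V. openin quot U \<and> openin quot V \<and> p \<in> U \<and> p' \<in> V \<and> disjnt U V"
    using xy AB by (intro exI[of _ "\<pi> ` (A \<inter> L)"] exI[of _ "\<pi> ` (B \<inter> L)"]) auto
qed

lemma stratum_saturated:
  assumes "x \<in> L" "\<pi> x \<in> \<pi> ` stratum y"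
  shows "x \<in> stratum y"
proof -
  obtain z where "z \<in> stratum y" "\<pi> x = \<pi> z" using assms(2) by blast
  then show ?thesis using stratum_orbit[OF _ level_X[OF assms(1)], of z y] by simp
qed

text \<open>The orbit map is open and strata are saturated, so closures can be tested before passing
  to orbits. This transfers local closedness and the frontier condition to the quotient.\<close>

lemma quot_closure_iff:
  assumes "x \<in> L"
  shows "\<pi> x \<in> quot closure_of (\<pi> ` stratum y) \<longleftrightarrow> x \<in> Z closure_of stratum y"
proof
  assume x: "\<pi> x \<in> quot closure_of (\<pi> ` stratum y)"
  show "x \<in> Z closure_of stratum y"
    unfolding in_closure_of
  proof (intro conjI allI impI)
    show "x \<in> topspace Z" using assms topspace_Z by simp
    fix A assume A: "x \<in> A \<and> openin Z A"
    then have "openin quot (\<pi> ` A)" "\<pi> x \<in> \<pi> ` A" using quot_open by blast+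
    from closure_of_meets[OF x this]
    obtain a where a: "a \<in> A" "\<pi> a \<in> \<pi> ` stratum y" by blast
    have "a \<in> L" using A a(1) openin_subset topspace_Z by blast
    then have "a \<in> stratum y" using stratum_saturated a(2) by blast
    then show "\<exists>z. z \<in> stratum y \<and> z \<in> A" using a(1) by blast
  qed
next
  assume "x \<in> Z closure_of stratum y"
  then show "\<pi> x \<in> quot closure_of (\<pi> ` stratum y)"
    using continuous_map_image_closure_subset[OF quot_continuous] by blast
qed

lemma stratum_mem_iff:
  assumes "x \<in> L"
  shows "a \<in> stratum x \<longleftrightarrow> a \<in> (\<Union>y\<in>stratum x. T y \<inter> L) \<and> a \<in> Z closure_of stratum x"
  using arg_cong[OF stratum_locally_closed(1)[OF assms], of "\<lambda>S. a \<in> S"] by (simp only: Int_iff)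

lemma quot_stratum_locally_closed:
  assumes x: "x \<in> L"
  shows "\<exists>A B. openin quot A \<and> closedin quot B \<and> \<pi> ` stratum x = A \<inter> B"
proof (intro exI conjI)
  let ?A = "\<Union>y\<in>stratum x. T y \<inter> L"
  show "openin quot (\<pi> ` ?A)" by (rule quot_open[OF stratum_locally_closed(2)[OF x]])
  show "closedin quot (quot closure_of (\<pi> ` stratum x))" by (rule closedin_closure_of)
  show "\<pi> ` stratum x = \<pi> ` ?A \<inter> quot closure_of (\<pi> ` stratum x)"
  proof (intro subset_antisym subsetI)
    fix p assume "p \<in> \<pi> ` stratum x"
    then obtain a where a: "a \<in> stratum x" "p = \<pi> a" by blast
    note am = stratum_mem_iff[OF x, THEN iffD1, OF a(1)]
    note aA = conjunct1[OF am] and acl = conjunct2[OF am]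
    have "a \<in> L" using a(1) stratum_level by blast
    then have "p \<in> quot closure_of (\<pi> ` stratum x)" using acl a(2) quot_closure_iff by simp
    moreover have "p \<in> \<pi> ` ?A" using aA a(2) by (rule rev_image_eqI)
    ultimately show "p \<in> \<pi> ` ?A \<inter> quot closure_of (\<pi> ` stratum x)" by blast
  next
    fix p assume p: "p \<in> \<pi> ` ?A \<inter> quot closure_of (\<pi> ` stratum x)"
    then have "p \<in> \<pi> ` ?A" by (rule IntD1)
    then obtain a where a: "p = \<pi> a" "a \<in> ?A" by (rule imageE)
    then have "a \<in> L" by blast
    then have "a \<in> Z closure_of stratum x" using p a(1) quot_closure_iff by simp
    with a(2) have "a \<in> stratum x" by (intro stratum_mem_iff[OF x, THEN iffD2] conjI)
    then show "p \<in> \<pi> ` stratum x" using a(1) by blast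
  qed
qed

text \<open>\<open>B \<inter> L\<^sub>H m\<close> itself is usually not open in the stratum. It has
  the same orbits, within the stratum, as an open tube box, and the orbit image of that box is
  open.\<close>

lemma quot_slice_open:
  assumes m: "m \<in> L" and B: "openin X B"
  shows "openin (subtopology quot (\<pi> ` stratum m)) (\<pi> ` (B \<inter> L\<^sub>H m))"
proof -
  let ?O = "tube m ` ((topspace (mtop (Q m)) \<inter> W m) \<times> (B \<inter> S m))"
  have WQ: "W m \<subseteq> topspace (mtop (Q m))" using slice_facts(6)[OF m] openin_subset by blast
  have "openin X ?O" by (rule tube_open[OF m openin_topspace B])
  then have "openin Z (?O \<inter> L)" by (auto simp: openin_subtopology)
  then have "openin quot (\<pi> ` (?O \<inter> L))" by (rule quot_open)
  moreover have "\<pi> ` (B \<inter> L\<^sub>H m) = \<pi> ` (?O \<inter> L) \<inter> \<pi> ` stratum m"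
  proof (intro subset_antisym subsetI)
    fix p assume "p \<in> \<pi> ` (B \<inter> L\<^sub>H m)"
    then obtain s where s: "s \<in> B" "s \<in> L\<^sub>H m" "p = \<pi> s" by blast
    have sS: "s \<in> S m" and ss: "s \<in> stratum m" using s(2) L\<^sub>H_iff by auto
    then have sX: "s \<in> topspace X" using slice_subset[OF m] by blast
    note w = slice_facts(7)[OF m]
    note k = slice_facts(8)[OF m w]
    \<comment> \<open>The point \<open>s\<close> is replaced by its translate over the trivial
      coset, which lies visibly in the box and has the same orbit.\<close>
    have t: "tube m (stab m, s) = \<phi> (\<kappa> m (stab m)) s" by (simp add: tube_def)
    have "tube m (stab m, s) \<in> stratum m" using tube_stratum_iff[OF m w sS] s(2) by blast
    then have "tube m (stab m, s) \<in> ?O \<inter> L" using w WQ s(1) sS stratum_level by blast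
    moreover have "\<pi> s = \<pi> (tube m (stab m, s))"
      using orbit_eq_iff[OF sX act_in[OF k sX]] k t by auto
    ultimately show "p \<in> \<pi> ` (?O \<inter> L) \<inter> \<pi> ` stratum m" using s(3) ss by blast
  next
    fix p assume "p \<in> \<pi> ` (?O \<inter> L) \<inter> \<pi> ` stratum m"
    then obtain z where z: "z \<in> ?O" "z \<in> L" "p = \<pi> z" "\<pi> z \<in> \<pi> ` stratum m" by blast
    then have zs: "z \<in> stratum m" using stratum_saturated by blast
    obtain w s where ws: "w \<in> W m" "s \<in> B" "s \<in> S m" "z = tube m (w, s)" using z(1) by blast
    have "s \<in> L\<^sub>H m" using tube_stratum_iff[OF m ws(1,3)] zs ws(4) by blast
    have sX: "s \<in> topspace X" using slice_subset[OF m] ws(3) by blast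
    note k = slice_facts(8)[OF m ws(1)]
    have "\<pi> s = \<pi> z" using orbit_eq_iff[OF sX act_in[OF k sX]] k ws(4) by (auto simp: tube_def)
    then have "p = \<pi> s" using z(3) by simp
    then show "p \<in> \<pi> ` (B \<inter> L\<^sub>H m)" using ws(2) \<open>s \<in> L\<^sub>H m\<close> by blast
  qed
  ultimately show ?thesis by (auto simp: openin_subtopology)
qed

text \<open>By \<open>L\<^sub>H_unique\<close> an orbit meeting \<open>L\<^sub>H m\<close> has a
  single representative there; the chart reads this representative in \<open>e\<close>, and no
  coordinate along the orbit remains.\<close>

definition quot_chart :: "'m \<Rightarrow> ('m, 'em) chart \<Rightarrow> 'em set \<Rightarrow> ('m set, 'em) chart" where
  "quot_chart m e F = \<lparr>cdom = \<pi> ` ldom m e, cmap = (\<lambda>p. cmap e (inv_into (L\<^sub>H m) \<pi> p)), cspace = F\<rparr>"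

definition quot_atlas :: "'m set set \<Rightarrow> ('m set, 'em) chart set" where
  "quot_atlas \<tau> = {quot_chart m e F | m e F. level_chart m e F \<and> \<pi> ` stratum m = \<tau>}"

lemma inj_on_L\<^sub>H: "m \<in> L \<Longrightarrow> inj_on \<pi> (L\<^sub>H m)"
  using L\<^sub>H_unique by (intro inj_onI) blast

lemma L\<^sub>H_rep: "m \<in> L \<Longrightarrow> s \<in> L\<^sub>H m \<Longrightarrow> inv_into (L\<^sub>H m) \<pi> (\<pi> s) = s"
  using inj_on_L\<^sub>H by (rule inv_into_f_f)

lemma is_chart_quot_chart:
  assumes e: "level_chart m e F"
  shows "is_chart (subtopology quot (\<pi> ` stratum m)) (quot_chart m e F)"
    "cmap (quot_chart m e F) ` cdom (quot_chart m e F) = cmap e ` ldom m e"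
proof -
  note f = level_chart_facts[OF e]
  note m = f(1)
  let ?X = "subtopology quot (\<pi> ` stratum m)"
  let ?D = "\<pi> ` ldom m e" and ?V = "cmap e ` ldom m e"
  let ?h = "\<lambda>p. cmap e (inv_into (L\<^sub>H m) \<pi> p)" and ?k = "\<lambda>y. \<pi> (chart_inv e y)"
  have hp: "?h (\<pi> s) = cmap e s" if "s \<in> L\<^sub>H m" for s using L\<^sub>H_rep[OF m that] by simp
  obtain B where B: "openin X B" "ldom m e = B \<inter> L\<^sub>H m" by (rule ldom_open[OF e])
  have oD: "openin ?X ?D" unfolding B(2) by (rule quot_slice_open[OF m B(1)])
  note tD = topspace_open_subtopology[OF oD]
  have "homeomorphic_maps (subtopology ?X ?D) (top_of_set ?V) ?h ?k"
    unfolding homeomorphic_maps_def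
  proof (intro conjI ballI)
    show "continuous_map (subtopology ?X ?D) (top_of_set ?V) ?h"
      unfolding continuous_map_def tD
    proof (intro conjI allI impI)
      show "?h \<in> ?D \<rightarrow> topspace (top_of_set ?V)" using hp by auto
      fix U assume "openin (top_of_set ?V) U"
      then obtain O1 where O1: "open O1" "U = ?V \<inter> O1" by (auto simp: openin_open)
      have "openin (top_of_set (cmap e ` cdom e)) (cmap e ` cdom e \<inter> O1)" using O1(1) by (auto simp: openin_open)
      then obtain C where C: "openin X C" "{s \<in> ldom m e. cmap e s \<in> cmap e ` cdom e \<inter> O1} = C \<inter> L\<^sub>H m"
        by (rule level_chart_open[OF e])
      \<comment> \<open>As \<open>\<pi>\<close> is injective on \<open>L\<^sub>H m\<close>, the
        preimage of \<open>U\<close> is the orbit image of a trace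
        \<open>C \<inter> L\<^sub>H m\<close>, to which \<open>quot_slice_open\<close>
        applies.\<close>
      have "{p \<in> ?D. ?h p \<in> U} = \<pi> ` (C \<inter> L\<^sub>H m)"
        unfolding C(2)[symmetric] O1(2) using hp by auto
      moreover have "\<pi> ` (C \<inter> L\<^sub>H m) \<subseteq> ?D" unfolding C(2)[symmetric] by blast
      ultimately show "openin (subtopology ?X ?D) {p \<in> ?D. ?h p \<in> U}"
        using quot_slice_open[OF m C(1)] by (simp add: subset_openin_subtopology)
    qed
    have "continuous_map (top_of_set ?V) X (chart_inv e)"
      using smooth_intoD(3)[OF smooth_into_level_inv[OF e]] by (simp add: continuous_map_in_subtopology)
    moreover have "chart_inv e ` ?V \<subseteq> L" using level_chart_inv(1)[OF e] by (auto simp: L\<^sub>H_def)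
    ultimately have "continuous_map (top_of_set ?V) Z (chart_inv e)" by (auto simp: continuous_map_in_subtopology)
    from continuous_map_compose[OF this quot_continuous]
    have "continuous_map (top_of_set ?V) quot ?k" by (simp add: o_def)
    moreover have "?k ` ?V \<subseteq> ?D" using level_chart_inv(1)[OF e] by blast
    moreover have "?D \<subseteq> \<pi> ` stratum m" using L\<^sub>H_iff by blast
    ultimately show "continuous_map (top_of_set ?V) (subtopology ?X ?D) ?k"
      by (force simp: continuous_map_in_subtopology)
    fix p assume "p \<in> topspace (subtopology ?X ?D)"
    then obtain s where "s \<in> ldom m e" "p = \<pi> s" using tD by blast
    then show "?k (?h p) = p" using hp chart_inv_cmap[OF f(2)] by simp
  next
    fix y assume "y \<in> topspace (top_of_set ?V)"
    then have "y \<in> ?V" by simp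
    then show "?h (?k y) = y" using level_chart_inv[OF e] hp by simp
  qed
  from is_chartI[OF oD f(3,6) this]
  show "is_chart (subtopology quot (\<pi> ` stratum m)) (quot_chart m e F)"
    "cmap (quot_chart m e F) ` cdom (quot_chart m e F) = cmap e ` ldom m e"
    by (simp_all add: quot_chart_def)
qed

lemma quot_chart_inv:
  assumes e: "level_chart m e F" and y: "y \<in> cmap e ` ldom m e"
  shows "\<pi> (chart_inv e y) = chart_inv (quot_chart m e F) y"
proof -
  note f = level_chart_facts[OF e]
  let ?s = "chart_inv e y"
  have s: "?s \<in> ldom m e" "cmap e ?s = y" using level_chart_inv[OF e y] by auto
  have "\<pi> ?s \<in> cdom (quot_chart m e F)" using s(1) by (simp add: quot_chart_def)
  moreover have "cmap (quot_chart m e F) (\<pi> ?s) = y"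
    using s L\<^sub>H_rep[OF f(1), of ?s] by (simp add: quot_chart_def)
  ultimately show ?thesis using chart_inv_cmap[OF is_chart_quot_chart(1)[OF e], of "\<pi> ?s"] by simp
qed

text \<open>Locally a lift is moved into the tube by a fixed group element; its slice component is then the
  representative of its orbit in \<open>L\<^sub>H m\<close>.\<close>

lemma smooth_on_quot_chart:
  assumes e: "level_chart m e F" and k: "smooth_into E U M k" and st: "k ` U \<subseteq> stratum m"
    and dom: "\<And>x. x \<in> U \<Longrightarrow> \<pi> (k x) \<in> cdom (quot_chart m e F)"
  shows "smooth_on E U (\<lambda>x. cmap (quot_chart m e F) (\<pi> (k x)))"
proof (rule smooth_on_local[OF smooth_intoD(1)[OF k]])
  note f = level_chart_facts[OF e]
  note m = f(1)
  fix x assume x: "x \<in> U"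
  have kX: "k y \<in> topspace X" if "y \<in> U" for y using smooth_intoD(5)[OF k that] .
  obtain s where s: "s \<in> ldom m e" "\<pi> (k x) = \<pi> s" using dom[OF x] by (auto simp: quot_chart_def)
  have sS: "s \<in> S m" using s(1) L\<^sub>H_subset(3) by blast
  then have "s \<in> topspace X" using slice_subset[OF m] by blast
  then obtain g where g: "g \<in> carrier P" "s = \<phi> g (k x)" using orbit_eq_iff[OF kX[OF x]] s(2) by blast
  have gk: "smooth_into E U M (\<lambda>y. \<phi> g (k y))"
    by (rule smooth_into_compose[OF k chart_cover_M chart_cover_M smooth_translation[OF g(1)]])
  let ?W = "U \<inter> (\<lambda>y. \<phi> g (k y)) -` T m"
  have W: "openin (top_of_set E) ?W"
    by (rule openin_preimage[OF smooth_intoD(2,3)[OF gk] slice_facts(10)[OF m]])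
  have xW: "x \<in> ?W" using x g(2) slice_in_tube[OF m sS] by simp
  have "smooth_into E ?W M (\<lambda>y. \<phi> g (k y))"
    by (rule smooth_into_restrict[OF gk smooth_intoD(1)[OF k] _ W]) auto
  then have "smooth_into E ?W (submanifold_of M (T m)) (\<lambda>y. \<phi> g (k y))"
    by (rule smooth_into_submanifold[OF _ chart_cover_M]) auto
  then have "smooth_into E ?W (prod_manifold (coset_manifold m) (slice_manifold m)) (\<lambda>y. untube m (\<phi> g (k y)))"
    by (rule smooth_into_compose[OF _ chart_covers(3)[OF m] chart_cover_prod[OF chart_covers(2,1)[OF m]] smooth_untube[OF m]])
  then have sl: "smooth_into E ?W (slice_manifold m) (\<lambda>y. snd (untube m (\<phi> g (k y))))"
    by (rule smooth_into_snd[OF _ chart_covers(2,1)[OF m]])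
  have rep: "snd (untube m (\<phi> g (k y))) \<in> ldom m e"
    "cmap (quot_chart m e F) (\<pi> (k y)) = cmap e (snd (untube m (\<phi> g (k y))))" if y: "y \<in> ?W" for y
  proof -
    let ?z = "\<phi> g (k y)"
    have yU: "y \<in> U" and zT: "?z \<in> T m" using y by auto
    obtain w t where wt: "untube m ?z = (w, t)" by (cases "untube m ?z")
    have wt': "w \<in> W m" "t \<in> S m" "?z = tube m (w, t)" using tube_untube[OF m zT] wt by auto
    have "?z \<in> stratum m" using st yU stratum_act[OF _ g(1)] by blast
    then have tL: "t \<in> L\<^sub>H m" using tube_stratum_iff[OF m wt'(1,2)] wt'(3) by simp
    note kw = slice_facts(8)[OF m wt'(1)]
    have tX: "t \<in> topspace X" using slice_subset[OF m] wt'(2) by blast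
    have "\<pi> t = \<pi> ?z" using orbit_eq_iff[OF tX act_in[OF kw tX]] kw wt'(3) by (auto simp: tube_def)
    moreover have "\<pi> (k y) = \<pi> ?z" using orbit_eq_iff[OF kX[OF yU] act_in[OF g(1) kX[OF yU]]] g(1) by blast
    ultimately have \<pi>t: "\<pi> (k y) = \<pi> t" by simp
    \<comment> \<open>The chart domain gives some representative \<open>t'\<close> in
      \<open>ldom m e\<close>; uniqueness identifies it with the slice component \<open>t\<close>,
      which depends smoothly on \<open>y\<close>.\<close>
    obtain t' where t': "t' \<in> ldom m e" "\<pi> t = \<pi> t'" using dom[OF yU] \<pi>t by (auto simp: quot_chart_def)
    have "t = t'" using L\<^sub>H_unique[OF m tL _ t'(2)] t'(1) by blast
    then show "snd (untube m ?z) \<in> ldom m e" using t'(1) wt by simp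
    show "cmap (quot_chart m e F) (\<pi> (k y)) = cmap e (snd (untube m ?z))"
      using L\<^sub>H_rep[OF m tL] wt \<pi>t by (simp add: quot_chart_def)
  qed
  have "smooth_on E ?W (\<lambda>y. cmap e (snd (untube m (\<phi> g (k y)))))"
    by (rule smooth_on_level_chart[OF e sl]) (use rep(1) in blast)
  then show "\<exists>W h. openin (top_of_set E) W \<and> x \<in> W \<and> smooth_on E W h \<and>
      (\<forall>y\<in>W. cmap (quot_chart m e F) (\<pi> (k y)) = h y)"
    using W xW rep(2) by (intro exI[of _ ?W] exI[of _ "\<lambda>y. cmap e (snd (untube m (\<phi> g (k y))))"]) blast
qed

lemma quot_stratum_eq:
  assumes "m \<in> L" "x \<in> L" "\<pi> ` stratum m = \<pi> ` stratum x"
  shows "stratum m = stratum x"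
proof -
  have "m \<in> stratum x" using stratum_saturated[OF assms(1)] stratum_refl[OF assms(1)] assms(3) by blast
  then show ?thesis by (rule stratum_eq)
qed

text \<open>The charts lift to \<open>M\<close> by the inverse slice charts, whose values lie in the
  stratum. Hence transition maps are quotient charts read along lifts into the stratum, the case
  settled by \<open>smooth_on_quot_chart\<close>.\<close>

lemma quot_smooth_manifold:
  assumes x: "x \<in> L"
  shows "smooth_manifold \<lparr>mtop = subtopology quot (\<pi> ` stratum x), matlas = quot_atlas (\<pi> ` stratum x)\<rparr>"
proof (rule smooth_manifold_from_lifts[where p = \<pi> and M = M and Y = "stratum x"])
  show "Hausdorff_space (subtopology quot (\<pi> ` stratum x))"
    using quot_Hausdorff Hausdorff_space_subtopology by blast
  have at: "\<exists>m e F. level_chart m e F \<and> stratum m = stratum x \<and> c = quot_chart m e F"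
    if c: "c \<in> quot_atlas (\<pi> ` stratum x)" for c
  proof -
    obtain m e F where c': "level_chart m e F" "\<pi> ` stratum m = \<pi> ` stratum x" "c = quot_chart m e F"
      using c unfolding quot_atlas_def by blast
    then show ?thesis using quot_stratum_eq[OF level_chart_facts(1)[OF c'(1)] x] by blast
  qed
  show ch: "is_chart (subtopology quot (\<pi> ` stratum x)) c" if "c \<in> quot_atlas (\<pi> ` stratum x)" for c
    using at[OF that] is_chart_quot_chart(1) by metis
  show "(\<Union>c\<in>quot_atlas (\<pi> ` stratum x). cdom c) = topspace (subtopology quot (\<pi> ` stratum x))"
  proof (intro subset_antisym subsetI)
    fix p assume "p \<in> (\<Union>c\<in>quot_atlas (\<pi> ` stratum x). cdom c)"
    then obtain c where c: "c \<in> quot_atlas (\<pi> ` stratum x)" "p \<in> cdom c" by blast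
    have "openin (subtopology quot (\<pi> ` stratum x)) (cdom c)" using ch[OF c(1)] by (simp add: is_chart_def)
    then show "p \<in> topspace (subtopology quot (\<pi> ` stratum x))" using c(2) openin_subset by blast
  next
    fix p assume "p \<in> topspace (subtopology quot (\<pi> ` stratum x))"
    then obtain m where m: "m \<in> stratum x" "p = \<pi> m" by auto
    then have mL: "m \<in> L" using stratum_level by blast
    obtain e F where e: "level_chart m e F" "m \<in> ldom m e" by (rule level_chart_exists[OF mL])
    have "p \<in> cdom (quot_chart m e F)" using e(2) m(2) by (simp add: quot_chart_def)
    moreover have "quot_chart m e F \<in> quot_atlas (\<pi> ` stratum x)"
      using e(1) stratum_eq[OF m(1)] unfolding quot_atlas_def by blast
    ultimately show "p \<in> (\<Union>c\<in>quot_atlas (\<pi> ` stratum x). cdom c)" by blast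
  qed
  show "\<exists>K. smooth_into (cspace c) (cmap c ` cdom c) M K \<and>
      (\<forall>y\<in>cmap c ` cdom c. K y \<in> stratum x \<and> \<pi> (K y) = chart_inv c y)"
    if ca: "c \<in> quot_atlas (\<pi> ` stratum x)" for c
  proof -
    obtain m e F where c: "level_chart m e F" "stratum m = stratum x" "c = quot_chart m e F"
      using at[OF ca] by blast
    note f = level_chart_facts[OF c(1)]
    have "smooth_into F (cmap e ` ldom m e) M (chart_inv e)"
      by (rule smooth_into_from_submanifold[OF smooth_into_level_inv[OF c(1)] chart_cover_M slice_facts(1)[OF f(1)]])
    moreover have "chart_inv e y \<in> stratum x" if "y \<in> cmap e ` ldom m e" for y
      using level_chart_inv(1)[OF c(1) that] L\<^sub>H_iff c(2) by blast
    moreover have "cspace c = F" by (simp add: c(3) quot_chart_def)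
    ultimately show ?thesis
      using quot_chart_inv[OF c(1)] is_chart_quot_chart(2)[OF c(1)]
      by (intro exI[of _ "chart_inv e"]) (simp add: c(3))
  qed
  show "smooth_on E U (\<lambda>y. cmap c (\<pi> (k y)))"
    if ca: "c \<in> quot_atlas (\<pi> ` stratum x)" and k: "smooth_into E U M k" "k ` U \<subseteq> stratum x"
      "\<And>y. y \<in> U \<Longrightarrow> \<pi> (k y) \<in> cdom c"
    for c and E U :: "'em set" and k
  proof -
    obtain m e F where c: "level_chart m e F" "stratum m = stratum x" "c = quot_chart m e F"
      using at[OF ca] by blast
    show ?thesis unfolding c(3)
      by (rule smooth_on_quot_chart[OF c(1) k(1)]) (use k(2,3) c(2,3) in auto)
  qed
qed

section \<open>The two stratifications\<close>

lemma partition_strata: "partition_on L (stratum ` L)"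
proof (rule partition_onI)
  show "\<Union> (stratum ` L) = L" using stratum_refl stratum_level by blast
  show "disjnt p q" if "p \<in> stratum ` L" "q \<in> stratum ` L" "p \<noteq> q" for p q
    using that strata_disjoint by blast
  show "{} \<notin> stratum ` L" using stratum_refl by blast
qed

lemma stratification_level: "stratification Z (stratum ` L) stratum_atlas"
  unfolding stratification_def
proof (intro conjI ballI impI)
  show "Hausdorff_space Z"
    using manifold Hausdorff_space_subtopology by (auto simp: smooth_manifold_def)
  show "partition_on (topspace Z) (stratum ` L)" using partition_strata topspace_Z by simp
  fix \<sigma> assume "\<sigma> \<in> stratum ` L"
  then obtain x where x: "x \<in> L" "\<sigma> = stratum x" by blast
  show "\<exists>A B. openin Z A \<and> closedin Z B \<and> \<sigma> = A \<inter> B"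
    unfolding x(2)
    by (rule exI[of _ "\<Union>y\<in>stratum x. T y \<inter> L"], rule exI[of _ "Z closure_of stratum x"])
      (intro conjI stratum_locally_closed[OF x(1)] closedin_closure_of)
  have "subtopology Z \<sigma> = subtopology X \<sigma>"
    using stratum_level by (simp add: x(2) subtopology_subtopology inf.absorb2)
  then show "smooth_manifold \<lparr>mtop = subtopology Z \<sigma>, matlas = stratum_atlas \<sigma>\<rparr>"
    using stratum_smooth_manifold[OF x(1)] x(2) by simp
next
  fix \<tau> \<sigma> assume ts: "\<tau> \<in> stratum ` L" "\<sigma> \<in> stratum ` L" "disjnt \<tau> \<sigma> \<and> \<tau> \<inter> Z closure_of \<sigma> \<noteq> {}"
  then obtain x y where xy: "x \<in> L" "y \<in> L" "\<tau> = stratum x" "\<sigma> = stratum y" by blast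
  show "\<tau> \<subseteq> Z closure_of \<sigma> - \<sigma>" "\<sigma> \<inter> Z closure_of \<tau> = {}"
    using frontier[OF xy(1,2)] ts(3) unfolding xy(3,4) by simp_all
qed

text \<open>Saturation makes orbit images of distinct strata disjoint, and
  \<open>quot_closure_iff\<close> reduces the frontier condition to the one already proved in
  \<open>L\<close>.\<close>

lemma stratification_quotient: "stratification quot ((`) \<pi> ` stratum ` L) quot_atlas"
  unfolding stratification_def
proof (intro conjI ballI impI)
  show "Hausdorff_space quot" by (rule quot_Hausdorff)
  show "partition_on (topspace quot) ((`) \<pi> ` stratum ` L)"
    unfolding topspace_quot
  proof (rule partition_onI)
    show "\<Union> ((`) \<pi> ` stratum ` L) = \<pi> ` L" using stratum_refl stratum_level by blast
    show "disjnt p q" if pq: "p \<in> (`) \<pi> ` stratum ` L" "q \<in> (`) \<pi> ` stratum ` L" "p \<noteq> q" for p q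
    proof (rule ccontr)
      assume nd: "\<not> disjnt p q"
      obtain x y where xy: "p = \<pi> ` stratum x" "q = \<pi> ` stratum y" using pq by blast
      obtain a where a: "a \<in> stratum x" "\<pi> a \<in> \<pi> ` stratum y" using nd xy by (auto simp: disjnt_iff)
      have "a \<in> L" using a(1) stratum_level by blast
      then have "a \<in> stratum y" using stratum_saturated a(2) by blast
      then show False using stratum_eq a(1) xy pq(3) by metis
    qed
    show "{} \<notin> (`) \<pi> ` stratum ` L" using stratum_refl by blast
  qed
  fix \<sigma> assume "\<sigma> \<in> (`) \<pi> ` stratum ` L"
  then obtain x where x: "x \<in> L" "\<sigma> = \<pi> ` stratum x" by blast
  show "\<exists>A B. openin quot A \<and> closedin quot B \<and> \<sigma> = A \<inter> B"
    unfolding x(2) by (rule quot_stratum_locally_closed[OF x(1)])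
  show "smooth_manifold \<lparr>mtop = subtopology quot \<sigma>, matlas = quot_atlas \<sigma>\<rparr>"
    unfolding x(2) by (rule quot_smooth_manifold[OF x(1)])
next
  fix \<tau> \<sigma> assume ts: "\<tau> \<in> (`) \<pi> ` stratum ` L" "\<sigma> \<in> (`) \<pi> ` stratum ` L"
    "disjnt \<tau> \<sigma> \<and> \<tau> \<inter> quot closure_of \<sigma> \<noteq> {}"
  then obtain x y where xy: "x \<in> L" "y \<in> L" "\<tau> = \<pi> ` stratum x" "\<sigma> = \<pi> ` stratum y" by blast
  have dis: "disjnt (stratum x) (stratum y)" using ts(3) xy by (auto simp: disjnt_iff)
  obtain a where a: "a \<in> stratum x" "\<pi> a \<in> quot closure_of \<sigma>" using ts(3) xy by blast
  have aL: "a \<in> L" using a(1) stratum_level by blast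
  have "a \<in> Z closure_of stratum y" using a(2) quot_closure_iff[OF aL] xy(4) by blast
  then have "stratum x \<inter> Z closure_of stratum y \<noteq> {}" using a(1) by blast
  note fr = frontier[OF xy(1,2) dis this]
  show "\<tau> \<subseteq> quot closure_of \<sigma> - \<sigma>"
  proof
    fix p assume p: "p \<in> \<tau>"
    then obtain b where b: "b \<in> stratum x" "p = \<pi> b" using xy(3) by blast
    then have "b \<in> L" "b \<in> Z closure_of stratum y" using fr(1) stratum_level by blast+
    then have "p \<in> quot closure_of \<sigma>" using quot_closure_iff b(2) xy(4) by blast
    moreover have "p \<notin> \<sigma>" using p ts(3) by (auto simp: disjnt_iff)
    ultimately show "p \<in> quot closure_of \<sigma> - \<sigma>" by blast
  qed
  show "\<sigma> \<inter> quot closure_of \<tau> = {}"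
  proof (rule ccontr)
    assume "\<sigma> \<inter> quot closure_of \<tau> \<noteq> {}"
    then obtain b where b: "b \<in> stratum y" "\<pi> b \<in> quot closure_of \<tau>" using xy(4) by blast
    then have "b \<in> Z closure_of stratum x" using quot_closure_iff stratum_level xy(3) by blast
    then show False using fr(2) b(1) by blast
  qed
qed

end

section \<open>From normal forms to slices of the level set\<close>

text \<open>Every representative of the class of the identity and \<open>x\<close> consists of
  \<open>inv h\<close> and \<open>h x\<close>, and equivariance cancels the two. It serves both
  sides of the normal form identity, with \<open>y\<close> the slice map and with \<open>y\<close>
  the inverse chart after the normal form.\<close>

lemma assoc_class_tube:
  fixes P :: "'g monoid"
  assumes act: "group_action P E \<phi>" and H: "subgroup H P" and y: "y x \<in> E"
    and eq: "\<And>h. h \<in> H \<Longrightarrow> y (r h x) = \<phi> h (y x)"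
  shows "tube_map \<phi> (assoc_map y (assoc_class P H r \<one>\<^bsub>P\<^esub> x)) = y x"
proof -
  interpret group_action P E \<phi> by (rule act)
  interpret group P using group_hom group_hom.axioms(1) by blast
  let ?c = "assoc_class P H r \<one>\<^bsub>P\<^esub> x"
  have HP: "h \<in> carrier P" if "h \<in> H" for h using subgroup.subset[OF H] that by blast
  have "(\<lambda>(g, s). \<phi> g s) ` assoc_map y ?c = {y x}"
  proof (intro subset_antisym subsetI)
    fix z assume "z \<in> (\<lambda>(g, s). \<phi> g s) ` assoc_map y ?c"
    then obtain h where h: "h \<in> H" "z = \<phi> (\<one>\<^bsub>P\<^esub> \<otimes>\<^bsub>P\<^esub> inv\<^bsub>P\<^esub> h) (y (r h x))"
      by (auto simp: assoc_map_def assoc_class_def)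
    then show "z \<in> {y x}" using eq[OF h(1)] HP[OF h(1)] orbit_sym_aux[OF HP[OF h(1)] y refl] by simp
  next
    fix z assume "z \<in> {y x}"
    moreover have o: "\<one>\<^bsub>P\<^esub> \<in> H" using subgroup.one_closed[OF H] .
    then have "(\<one>\<^bsub>P\<^esub> \<otimes>\<^bsub>P\<^esub> inv\<^bsub>P\<^esub> \<one>\<^bsub>P\<^esub>, r \<one>\<^bsub>P\<^esub> x) \<in> ?c" unfolding assoc_class_def by blast
    then have "(\<one>\<^bsub>P\<^esub>, y (r \<one>\<^bsub>P\<^esub> x)) \<in> assoc_map y ?c" unfolding assoc_map_def by force
    then have "\<phi> \<one>\<^bsub>P\<^esub> (y (r \<one>\<^bsub>P\<^esub> x)) \<in> (\<lambda>(g, s). \<phi> g s) ` assoc_map y ?c" by force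
    moreover have "\<phi> \<one>\<^bsub>P\<^esub> (y (r \<one>\<^bsub>P\<^esub> x)) = y x"
    proof -
      have "\<phi> \<one>\<^bsub>P\<^esub> (\<phi> \<one>\<^bsub>P\<^esub> (y x)) = y x" using orbit_sym_aux[OF one_closed y refl] by simp
      then show ?thesis using eq[OF o] by simp
    qed
    ultimately show "z \<in> (\<lambda>(g, s). \<phi> g s) ` assoc_map y ?c" by simp
  qed
  then show ?thesis by (simp add: tube_map_def)
qed

lemma orbit_translate:
  fixes P :: "'g monoid"
  assumes act: "group_action P E \<phi>" and x: "x \<in> E" and g: "g \<in> carrier P"
  shows "orbit P \<phi> (\<phi> g x) = orbit P \<phi> x"
proof -
  have gx: "\<phi> g x \<in> E" using group_action.element_image[OF act g x refl] .
  have 1: "\<phi> g x \<in> orbit P \<phi> x" using g by (auto simp: orbit_def)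
  have 2: "x \<in> orbit P \<phi> (\<phi> g x)" by (rule group_action.orbit_sym[OF act x gx 1])
  have in_E: "z \<in> E" if z: "z \<in> orbit P \<phi> y" and y: "y \<in> E" for z y
    using z group_action.element_image[OF act _ y refl] by (auto simp: orbit_def)
  show ?thesis
  proof (intro subset_antisym subsetI)
    fix z assume z: "z \<in> orbit P \<phi> (\<phi> g x)"
    show "z \<in> orbit P \<phi> x" by (rule group_action.orbit_trans[OF act x gx in_E[OF z gx] 1 z])
  next
    fix z assume z: "z \<in> orbit P \<phi> x"
    show "z \<in> orbit P \<phi> (\<phi> g x)" by (rule group_action.orbit_trans[OF act gx x in_E[OF z x] 2 z])
  qed
qed

lemma group_action_subgroup:
  assumes act: "group_action G E \<phi>" and C: "subgroup C G"
  shows "group_action (G\<lparr>carrier := C\<rparr>) E \<phi>"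
proof -
  have hom: "\<phi> \<in> hom G (BijGroup E)" "group (BijGroup E)" "group G"
    using group_action.group_hom[OF act] group_hom.homh group_hom.axioms by blast+
  then have "\<phi> \<in> hom (G\<lparr>carrier := C\<rparr>) (BijGroup E)"
    using subgroup.subset[OF C] by (auto simp: hom_def)
  then show ?thesis
    by (intro group_action.intro group_hom.intro group_hom_axioms.intro hom(2) subgroup.subgroup_is_group[OF C hom(3)])
qed

section \<open>The level set inside a slice\<close>

lemma direct_sum_facts:
  assumes "topological_direct_sum X A B"
  shows "subspace A" "subspace B" "A \<subseteq> X" "B \<subseteq> X"
    "\<And>x. x \<in> X \<Longrightarrow> \<exists>a\<in>A. \<exists>b\<in>B. x = a + b"
    "\<And>a b a' b'. a \<in> A \<Longrightarrow> b \<in> B \<Longrightarrow> a' \<in> A \<Longrightarrow> b' \<in> B \<Longrightarrow> a + b = a' + b' \<Longrightarrow> a = a' \<and> b = b'"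
    "\<And>a b. a \<in> A \<Longrightarrow> b \<in> B \<Longrightarrow> second_component A B (a + b) = b"
proof -
  have hom: "homeomorphic_map (top_of_set (A \<times> B)) (top_of_set X) (\<lambda>(a, b). a + b)"
    and "model_space A" "model_space B"
    using assms by (auto simp: topological_direct_sum_def)
  then show sA: "subspace A" and sB: "subspace B" by (auto simp: model_space_def)
  have sur: "(\<lambda>(a, b). a + b) ` (A \<times> B) = X" using homeomorphic_imp_surjective_map[OF hom] by simp
  have inj: "inj_on (\<lambda>(a, b). a + b) (A \<times> B)" using homeomorphic_imp_injective_map[OF hom] by simp
  show "A \<subseteq> X" unfolding sur[symmetric] using subspace_0[OF sB] by force
  show "B \<subseteq> X" unfolding sur[symmetric] using subspace_0[OF sA] by force
  show "\<exists>a\<in>A. \<exists>b\<in>B. x = a + b" if "x \<in> X" for x using that unfolding sur[symmetric] by auto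
  show u: "a = a' \<and> b = b'" if "a \<in> A" "b \<in> B" "a' \<in> A" "b' \<in> B" "a + b = a' + b'" for a b a' b'
  proof -
    have "(a, b) = (a', b')" by (rule inj_onD[OF inj]) (simp_all only: mem_Sigma_iff prod.case that simp_thms)
    then show ?thesis by simp
  qed
  show "second_component A B (a + b) = b" if ab: "a \<in> A" "b \<in> B" for a b
    unfolding second_component_def
  proof (rule the_equality)
    fix b' assume b': "b' \<in> B \<and> a + b - b' \<in> A"
    have "a + b - b' = a \<and> b' = b"
      by (rule u[OF conjunct2[OF b'] conjunct1[OF b'] ab]) (rule diff_add_cancel)
    then show "b' = b" by (rule conjunct2)
  qed (use ab in simp)
qed

text \<open>At the class of the identity the normal form identity says that \<open>f\<close> on the
  slice is \<open>nf_fibre A\<close> read in the chart \<open>\<rho>\<close>. As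
  \<open>\<rho> \<mu> = 0\<close>, the level set is given by vanishing of the fibre map, whose parts
  in \<open>Coker\<close> and \<open>Im\<close> must vanish separately; injectivity of
  \<open>nfHat A\<close> then forces the \<open>Coim\<close> component to be 0.\<close>

lemma normal_form_zeros:
  fixes P :: "'g monoid" and A :: "('g, 'x::locally_convex_space, 'y::locally_convex_space) normal_form"
  assumes nf: "in_normal_form_at P PM M \<phi> N \<psi> f \<mu> m S \<iota> V' V \<rho> A"
    and act: "group_action P (topspace (mtop M)) \<phi>" "group_action P (topspace (mtop N)) \<psi>"
    and m: "m \<in> topspace (mtop M)"
  shows "\<iota> ` sing_zeros A = S \<inter> level_set M f \<mu>"
proof -
  define H where "H = stabilizer P \<phi> m"
  define U where "U = nfU A"
  have anf: "abstract_normal_form (isotropy_group P \<phi> m) (isotropy_manifold P PM \<phi> m) A"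
    and sl: "slice P PM M \<phi> m S (nfX A) (nfActX A) U \<iota>"
    and V': "openin (mtop N) V'" "\<mu> \<in> V'" "\<forall>h\<in>H. \<psi> h ` V' \<subseteq> V'"
    and diff: "diffeomorphism (submanifold_of N V') (open_in_model (nfY A) V) \<rho>" and \<rho>0: "\<rho> \<mu> = 0"
    and \<rho>eq: "\<forall>h\<in>H. \<forall>n\<in>V'. \<rho> (\<psi> h n) = nfActY A h (\<rho> n)"
    and fV: "nf_fibre A ` U \<subseteq> V"
    and eq: "\<forall>c\<in>assoc_bundle P H (nfActX A) U.
         f (tube_map \<phi> (assoc_map \<iota> c)) = tube_map \<psi> (assoc_map (inv_into V' \<rho>) (nf_map A c))"
    using nf by (simp_all add: in_normal_form_at_def Let_def H_def U_def)
  have H: "subgroup H P" unfolding H_def by (rule group_action.stabilizer_subgroup[OF act(1) m])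
  have grp: "group P" using act(1) group_action.group_hom group_hom.axioms(1) by blast
  have one: "\<one>\<^bsub>P\<^esub> \<in> carrier P" using grp group.is_monoid monoid.one_closed by blast
  have cH: "carrier (isotropy_group P \<phi> m) = H" by (simp add: isotropy_group_def H_def)
  have sX: "topological_direct_sum (nfX A) (nfKer A) (nfCoim A)"
    and sY: "topological_direct_sum (nfY A) (nfCoker A) (nfIm A)"
    and inv: "\<And>h. h \<in> H \<Longrightarrow> nfActX A h ` nfKer A \<subseteq> nfKer A \<and> nfActX A h ` nfCoim A \<subseteq> nfCoim A"
    and hat: "homeomorphic_map (top_of_set (nfCoim A)) (top_of_set (nfIm A)) (nfHat A)"
    and hatlin: "\<And>x y a b. x \<in> nfCoim A \<Longrightarrow> y \<in> nfCoim A \<Longrightarrow>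
        nfHat A (a *\<^sub>R x + b *\<^sub>R y) = a *\<^sub>R nfHat A x + b *\<^sub>R nfHat A y"
    and hateq: "\<And>h x. h \<in> H \<Longrightarrow> x \<in> nfCoim A \<Longrightarrow> nfHat A (nfActX A h x) = nfActY A h (nfHat A x)"
    and UX: "openin (top_of_set (nfX A)) U" and Uinv: "\<And>h. h \<in> H \<Longrightarrow> nfActX A h ` U \<subseteq> U"
    and sing: "nfSing A ` U \<subseteq> nfCoker A"
    and singeq: "\<And>h x. h \<in> H \<Longrightarrow> x \<in> U \<Longrightarrow> nfSing A (nfActX A h x) = nfActY A h (nfSing A x)"
    and linX: "\<And>h x y a b. h \<in> H \<Longrightarrow> x \<in> nfX A \<Longrightarrow> y \<in> nfX A \<Longrightarrow>
        nfActX A h (a *\<^sub>R x + b *\<^sub>R y) = a *\<^sub>R nfActX A h x + b *\<^sub>R nfActX A h y"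
    and linY: "\<And>h x y a b. h \<in> H \<Longrightarrow> x \<in> nfY A \<Longrightarrow> y \<in> nfY A \<Longrightarrow>
        nfActY A h (a *\<^sub>R x + b *\<^sub>R y) = a *\<^sub>R nfActY A h x + b *\<^sub>R nfActY A h y"
    using anf by (simp_all add: abstract_normal_form_def continuous_representation_def cH U_def)
  have S: "submanifold M S" and \<iota>d: "diffeomorphism (open_in_model (nfX A) U) (submanifold_of M S) \<iota>"
    and \<iota>eq: "\<And>h x. h \<in> H \<Longrightarrow> x \<in> U \<Longrightarrow> \<iota> (nfActX A h x) = \<phi> h (\<iota> x)"
    using sl by (simp_all add: slice_def Let_def H_def)
  have SM: "S \<subseteq> topspace (mtop M)" using S by (simp add: submanifold_def)
  have \<iota>bij: "bij_betw \<iota> U S"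
    using \<iota>d SM by (simp add: diffeomorphism_def open_in_model_def inf.absorb2)
  have V'N: "V' \<subseteq> topspace (mtop N)" using V'(1) openin_subset by blast
  have \<rho>bij: "bij_betw \<rho> V' V"
    using diff V'N by (simp add: diffeomorphism_def open_in_model_def inf.absorb2)
  define \<rho>' where "\<rho>' = inv_into V' \<rho>"
  have \<rho>': "\<rho>' v \<in> V'" "\<rho> (\<rho>' v) = v" if "v \<in> V" for v
    using that \<rho>bij bij_betw_inv_into_right[OF \<rho>bij] unfolding \<rho>'_def
    by (auto simp: bij_betw_def intro: inv_into_into)
  have \<rho>'': "\<rho>' (\<rho> n) = n" if "n \<in> V'" for n
    using that bij_betw_inv_into_left[OF \<rho>bij] by (simp add: \<rho>'_def)
  note dX = direct_sum_facts[OF sX] and dY = direct_sum_facts[OF sY]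
  have dec: "\<exists>a\<in>nfKer A. \<exists>b\<in>nfCoim A. x = a + b \<and> nf_fibre A x = nfHat A b + nfSing A x" if x: "x \<in> U" for x
  proof -
    have "x \<in> nfX A" using x UX openin_imp_subset by blast
    then obtain a b where "a \<in> nfKer A" "b \<in> nfCoim A" "x = a + b" using dX(5) by blast
    moreover have "nf_fibre A x = nfHat A b + nfSing A x"
      unfolding nf_fibre_def using dX(7)[OF calculation(1,2)] calculation(3) by simp
    ultimately show ?thesis by blast
  qed
  have hatIm: "nfHat A b \<in> nfIm A" if "b \<in> nfCoim A" for b
    using homeomorphic_imp_surjective_map[OF hat] that by auto
  \<comment> \<open>Equivariance of the fibre map rests on the invariance of both summands: the
    action commutes with taking the \<open>Coim\<close> component.\<close>
  have nfeq: "nf_fibre A (nfActX A h x) = nfActY A h (nf_fibre A x)" if h: "h \<in> H" and x: "x \<in> U" for h x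
  proof -
    obtain a b where ab: "a \<in> nfKer A" "b \<in> nfCoim A" "x = a + b" "nf_fibre A x = nfHat A b + nfSing A x"
      using dec[OF x] by blast
    have X: "a \<in> nfX A" "b \<in> nfX A" using ab(1,2) dX(3,4) by auto
    have 1: "nfActX A h x = nfActX A h a + nfActX A h b"
      using linX[OF h X, of 1 1] ab(3) by simp
    have "second_component (nfKer A) (nfCoim A) (nfActX A h x) = nfActX A h b"
      unfolding 1 by (rule dX(7)) (use inv[OF h] ab(1,2) in auto)
    then have "nf_fibre A (nfActX A h x) = nfActY A h (nfHat A b) + nfActY A h (nfSing A x)"
      using hateq[OF h ab(2)] singeq[OF h x] by (simp add: nf_fibre_def)
    moreover have "nfHat A b \<in> nfY A" "nfSing A x \<in> nfY A"
      using hatIm[OF ab(2)] dY(3,4) sing x by auto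
    ultimately show ?thesis using linY[OF h, of "nfHat A b" "nfSing A x" 1 1] ab(4) by simp
  qed
  have f\<iota>: "f (\<iota> x) = \<rho>' (nf_fibre A x)" if x: "x \<in> U" for x
  proof -
    let ?c = "assoc_class P H (nfActX A) \<one>\<^bsub>P\<^esub> x"
    have "\<iota> x \<in> topspace (mtop M)" using \<iota>bij x SM by (auto simp: bij_betw_def)
    then have l: "tube_map \<phi> (assoc_map \<iota> ?c) = \<iota> x"
      by (rule assoc_class_tube[OF act(1) H, of \<iota> x]) (rule \<iota>eq[OF _ x])
    let ?y = "\<lambda>x. \<rho>' (nf_fibre A x)"
    have nV: "nf_fibre A x \<in> V" using fV x by blast
    have yN: "?y x \<in> topspace (mtop N)" using \<rho>'(1)[OF nV] V'N by blast
    have "?y (nfActX A h x) = \<psi> h (?y x)" if h: "h \<in> H" for h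
    proof -
      have "\<rho> (\<psi> h (?y x)) = nf_fibre A (nfActX A h x)"
        using \<rho>eq h \<rho>'[OF nV] nfeq[OF h x] by simp
      moreover have "\<psi> h (?y x) \<in> V'" using V'(3) h \<rho>'(1)[OF nV] by blast
      ultimately show ?thesis using \<rho>'' by metis
    qed
    from assoc_class_tube[where r = "nfActX A" and y = ?y and x = x, OF act(2) H yN this]
    have e1: "tube_map \<psi> (assoc_map ?y ?c) = ?y x" by blast
    have e2: "assoc_map \<rho>' (nf_map A ?c) = assoc_map ?y ?c"
      by (simp add: nf_map_def assoc_map_def image_image map_prod_def case_prod_beta)
    have "?c \<in> assoc_bundle P H (nfActX A) U" unfolding assoc_bundle_def using one x by blast
    from bspec[OF eq[folded \<rho>'_def] this] show ?thesis unfolding l e2 e1 .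
  qed
  have zero: "f (\<iota> x) = \<mu> \<longleftrightarrow> x \<in> sing_zeros A" if x: "x \<in> U" for x
  proof -
    obtain a b where ab: "a \<in> nfKer A" "b \<in> nfCoim A" "x = a + b" "nf_fibre A x = nfHat A b + nfSing A x"
      using dec[OF x] by blast
    have nV: "nf_fibre A x \<in> V" using fV x by blast
    have "f (\<iota> x) = \<mu> \<longleftrightarrow> nf_fibre A x = 0"
      using f\<iota>[OF x] \<rho>'(2)[OF nV] \<rho>''[OF V'(2)] \<rho>0 by metis
    \<comment> \<open>Both sides are written as an element of \<open>Coker\<close> plus one of
      \<open>Im\<close>, so uniqueness of the decomposition splits the equation.\<close>
    also have "\<dots> \<longleftrightarrow> nfSing A x + nfHat A b = 0 + 0" by (simp add: ab(4) add.commute)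
    also have "\<dots> \<longleftrightarrow> nfSing A x = 0 \<and> nfHat A b = 0"
    proof
      assume eq0: "nfSing A x + nfHat A b = 0 + 0"
      have "nfSing A x \<in> nfCoker A" using sing x by blast
      from dY(6)[OF this hatIm[OF ab(2)] subspace_0[OF dY(1)] subspace_0[OF dY(2)] eq0]
      show "nfSing A x = 0 \<and> nfHat A b = 0" .
    qed simp
    also have "nfHat A b = 0 \<longleftrightarrow> b = 0"
    proof
      have h0: "nfHat A 0 = 0" using hatlin[OF ab(2) ab(2), of 0 0] by simp
      show "nfHat A b = 0" if "b = 0" using h0 that by simp
      show "b = 0" if "nfHat A b = 0"
        by (rule inj_onD[OF homeomorphic_imp_injective_map[OF hat]])
           (simp_all add: h0 that ab(2) subspace_0[OF dX(2)])
    qed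
    also have "b = 0 \<longleftrightarrow> x \<in> nfKer A"
    proof
      show "x \<in> nfKer A" if "b = 0" using that ab(1,3) by simp
      assume xK: "x \<in> nfKer A"
      have "a + b = x + 0" using ab(3) by simp
      from dX(6)[OF ab(1,2) xK subspace_0[OF dX(2)] this] show "b = 0" by (rule conjunct2)
    qed
    finally show ?thesis using x by (auto simp: sing_zeros_def U_def)
  qed
  show ?thesis
  proof (intro subset_antisym subsetI)
    fix s assume "s \<in> \<iota> ` sing_zeros A"
    then obtain x where x: "x \<in> sing_zeros A" "s = \<iota> x" by blast
    have xU: "x \<in> U" using x(1) by (simp add: sing_zeros_def U_def)
    have "s \<in> S" using \<iota>bij xU x(2) by (auto simp: bij_betw_def)
    then show "s \<in> S \<inter> level_set M f \<mu>" using zero[OF xU] x SM by (auto simp: level_set_def)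
  next
    fix s assume s: "s \<in> S \<inter> level_set M f \<mu>"
    then obtain x where x: "x \<in> U" "s = \<iota> x" using \<iota>bij by (auto simp: bij_betw_def)
    then show "s \<in> \<iota> ` sing_zeros A" using zero[OF x(1)] s by (auto simp: level_set_def)
  qed
qed

text \<open>A translation is the action map after \<open>x \<mapsto> (g, x)\<close>, whose first
  component is constant.\<close>

lemma smooth_map_action:
  assumes sm: "smooth_manifold GM" "smooth_manifold M"
    and act: "smooth_map (prod_manifold GM M) M (\<lambda>(g, x). \<phi> g x)" and g: "g \<in> topspace (mtop GM)"
  shows "smooth_map M M (\<phi> g)"
  unfolding smooth_map_def
proof (intro conjI ballI)
  note cG = smooth_manifold_chart_cover[OF sm(1)] and cM = smooth_manifold_chart_cover[OF sm(2)]
  have "continuous_map (mtop M) (prod_topology (mtop GM) (mtop M)) (\<lambda>x. (g, x))"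
    using g by (intro continuous_map_pairedI) auto
  moreover have "continuous_map (prod_topology (mtop GM) (mtop M)) (mtop M) (\<lambda>(g, x). \<phi> g x)"
    using act by (simp add: smooth_map_def)
  ultimately have "continuous_map (mtop M) (mtop M) ((\<lambda>(g, x). \<phi> g x) \<circ> (\<lambda>x. (g, x)))"
    by (rule continuous_map_compose)
  then show "continuous_map (mtop M) (mtop M) (\<phi> g)" by (simp add: o_def)
  fix c d assume c: "c \<in> matlas M" and d: "d \<in> matlas M"
  note ic = chart_cover_is_chart[OF cM c]
  have k: "smooth_into (cspace c) (cmap c ` cdom c) M (chart_inv c)"
    by (rule smooth_into_chart_inv[OF smooth_manifold_max_atlas[OF sm(2) c]])
  have "smooth_into (cspace c) (cmap c ` cdom c) GM (\<lambda>_. g)"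
    by (rule smooth_into_const[OF smooth_intoD(1,2)[OF k] g cG])
  from smooth_into_compose[OF smooth_into_Pair[OF this k cG cM] chart_cover_prod[OF cG cM] cM act]
  have "smooth_into (cspace c) (cmap c ` cdom c) M (\<lambda>x. \<phi> g (chart_inv c x))" by simp
  from smooth_intoD(4)[OF this d]
  have "smooth_on (cspace c) (cmap c ` cdom c \<inter> (\<lambda>x. \<phi> g (chart_inv c x)) -` cdom d) (\<lambda>x. cmap d (\<phi> g (chart_inv c x)))" .
  moreover have "cmap c ` cdom c \<inter> (\<lambda>x. \<phi> g (chart_inv c x)) -` cdom d = cmap c ` (cdom c \<inter> \<phi> g -` cdom d)"
    using chart_inv_cmap[OF ic] by auto
  ultimately show "smooth_on (cspace c) (cmap c ` (cdom c \<inter> \<phi> g -` cdom d)) (cmap d \<circ> \<phi> g \<circ> chart_inv c)"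
    by (simp add: o_def)
qed

text \<open>Conjugation by \<open>g\<close> restricts to an injective continuous endomorphism of
  \<open>H\<close>, to which the surjectivity result applies. Continuity is inherited from
  multiplication in \<open>G\<close>.\<close>

lemma compact_subgroup_conjugate_eq:
  fixes G :: "'g monoid" and GM :: "('g, 'e::locally_convex_space) manifold"
  assumes G: "lie_group G GM" and C: "subgroup C G" and H: "subgroup H (G\<lparr>carrier := C\<rparr>)"
    and lie: "lie_group (G\<lparr>carrier := H\<rparr>) HM" and comp: "compact_space (mtop HM)"
    and top: "mtop HM = subtopology (mtop GM) H"
    and g: "g \<in> C" and sub: "conjugate_set (G\<lparr>carrier := C\<rparr>) g H \<subseteq> H"
  shows "conjugate_set (G\<lparr>carrier := C\<rparr>) g H = H"
proof -
  have grp: "group G" and tG: "topspace (mtop GM) = carrier G"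
    and mult: "continuous_map (prod_topology (mtop GM) (mtop GM)) (mtop GM) (\<lambda>(g, h). g \<otimes>\<^bsub>G\<^esub> h)"
    using G by (auto simp: lie_group_def smooth_map_def prod_manifold_def)
  interpret group G by (rule grp)
  have HC: "H \<subseteq> C" using subgroup.subset[OF H] by simp
  have CG: "C \<subseteq> carrier G" using subgroup.subset[OF C] .
  have inv: "inv\<^bsub>G\<lparr>carrier := C\<rparr>\<^esub> g = inv\<^bsub>G\<^esub> g" using m_inv_consistent[OF C g] .
  have gG: "g \<in> carrier G" using g CG by blast
  let ?c = "\<lambda>h. g \<otimes>\<^bsub>G\<^esub> h \<otimes>\<^bsub>G\<^esub> inv\<^bsub>G\<^esub> g"
  have cs: "conjugate_set (G\<lparr>carrier := C\<rparr>) g H = ?c ` H"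
    by (auto simp: conjugate_set_iff inv)
  have cH: "?c ` H \<subseteq> H" using sub cs by simp
  have HG: "h \<in> carrier G" if "h \<in> H" for h using that HC CG by blast
  have "?c ` carrier (G\<lparr>carrier := H\<rparr>) = carrier (G\<lparr>carrier := H\<rparr>)"
  proof (rule compact_lie_group_endomorphism_surj[OF lie comp])
    have "?c (h \<otimes>\<^bsub>G\<^esub> k) = ?c h \<otimes>\<^bsub>G\<^esub> ?c k" if hk: "h \<in> H" "k \<in> H" for h k
    proof -
      have "?c h \<otimes>\<^bsub>G\<^esub> ?c k = g \<otimes>\<^bsub>G\<^esub> h \<otimes>\<^bsub>G\<^esub> (inv\<^bsub>G\<^esub> g \<otimes>\<^bsub>G\<^esub> g) \<otimes>\<^bsub>G\<^esub> k \<otimes>\<^bsub>G\<^esub> inv\<^bsub>G\<^esub> g"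
        using HG[OF hk(1)] HG[OF hk(2)] gG by (simp only: m_assoc m_closed inv_closed)
      then show ?thesis using HG[OF hk(1)] HG[OF hk(2)] gG by (simp add: m_assoc)
    qed
    then show "?c \<in> hom (G\<lparr>carrier := H\<rparr>) (G\<lparr>carrier := H\<rparr>)"
      using cH by (auto simp: hom_def)
    have "continuous_map (mtop GM) (prod_topology (mtop GM) (mtop GM)) (\<lambda>h. (g, h))"
      using gG tG by (intro continuous_map_pairedI) auto
    from continuous_map_compose[OF this mult] have 1: "continuous_map (mtop GM) (mtop GM) (\<lambda>h. g \<otimes>\<^bsub>G\<^esub> h)"
      by (simp add: o_def)
    have "continuous_map (mtop GM) (prod_topology (mtop GM) (mtop GM)) (\<lambda>h. (g \<otimes>\<^bsub>G\<^esub> h, inv\<^bsub>G\<^esub> g))"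
      using 1 gG tG by (intro continuous_map_pairedI) auto
    from continuous_map_compose[OF this mult] have "continuous_map (mtop GM) (mtop GM) ?c"
      by (simp add: o_def)
    then have "continuous_map (subtopology (mtop GM) H) (mtop GM) ?c" by (rule continuous_map_from_subtopology)
    then show "continuous_map (mtop HM) (mtop HM) ?c"
      unfolding top using cH by (auto simp: continuous_map_in_subtopology)
    show "inj_on ?c (carrier (G\<lparr>carrier := H\<rparr>))"
    proof (rule inj_onI)
      fix h k assume hk: "h \<in> carrier (G\<lparr>carrier := H\<rparr>)" "k \<in> carrier (G\<lparr>carrier := H\<rparr>)" "?c h = ?c k"
      then have "h \<in> carrier G" "k \<in> carrier G" using HG by auto
      then show "h = k" using hk(3) gG by (simp add: m_assoc)
    qed
  qed
  then show ?thesis using cs by simp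
qed

theorem proposition3p3p1:
  fixes G :: "'g monoid"
    and GM :: "('g, 'eg::locally_convex_space) manifold"
    and M :: "('m, 'em::locally_convex_space) manifold"
    and N :: "('n, 'en::locally_convex_space) manifold"
    and \<phi> :: "'g \<Rightarrow> 'm \<Rightarrow> 'm" and \<psi> :: "'g \<Rightarrow> 'n \<Rightarrow> 'n"
    and f :: "'m \<Rightarrow> 'n" and \<mu> :: 'n
  assumes "lie_group G GM"
    and "smooth_manifold M" and "smooth_action G GM M \<phi>"
    and "smooth_manifold N" and "smooth_action G GM N \<psi>"
    and "smooth_map M N f"
    and "\<forall>g\<in>carrier G. \<forall>x\<in>topspace (mtop M). f (\<phi> g x) = \<psi> g (f x)"
    and "\<mu> \<in> topspace (mtop N)"
    and "lie_subgroup G GM (stabilizer G \<psi> \<mu>)"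
    and "proper_action (mtop (isotropy_manifold G GM \<psi> \<mu>)) (mtop M) \<phi>"
    and "\<forall>m\<in>level_set M f \<mu>.
           \<exists>S \<iota> V' V \<rho> (A :: ('g, 'x::locally_convex_space, 'y::locally_convex_space) normal_form).
             in_normal_form_at (isotropy_group G \<psi> \<mu>) (isotropy_manifold G GM \<psi> \<mu>)
               M \<phi> N \<psi> f \<mu> m S \<iota> V' V \<rho> A \<and>
             submanifold_property (isotropy_group G \<psi> \<mu>) M \<phi> m S \<iota> A \<and>
             approximation_property (isotropy_group G \<psi> \<mu>) M \<phi> m S \<iota> A"
  shows "(\<exists>\<A> :: 'm set \<Rightarrow> ('m, 'eg \<times> 'em) chart set.
            stratification (subtopology (mtop M) (level_set M f \<mu>))
              (orbit_type_partition (isotropy_group G \<psi> \<mu>) \<phi> (level_set M f \<mu>)) \<A>) \<and>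
         (\<exists>\<B> :: 'm set set \<Rightarrow> ('m set, 'em) chart set.
            stratification
              (quotient_topology (subtopology (mtop M) (level_set M f \<mu>))
                (orbit (isotropy_group G \<psi> \<mu>) \<phi>))
              ((`) (orbit (isotropy_group G \<psi> \<mu>) \<phi>) `
                orbit_type_partition (isotropy_group G \<psi> \<mu>) \<phi> (level_set M f \<mu>)) \<B>)"
proof -
  define C where "C = stabilizer G \<psi> \<mu>"
  define P where "P = isotropy_group G \<psi> \<mu>"
  define PM where "PM = isotropy_manifold G GM \<psi> \<mu>"
  define L where "L = level_set M f \<mu>"
  have P: "P = G\<lparr>carrier := C\<rparr>" by (simp add: P_def isotropy_group_def C_def)
  have cP: "carrier P = C" by (simp add: P)
  have grp: "group G" and smG: "smooth_manifold GM" and tG: "topspace (mtop GM) = carrier G"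
    using assms(1) by (auto simp: lie_group_def)
  have C: "subgroup C G" using assms(9) by (simp add: lie_subgroup_def C_def)
  have CG: "C \<subseteq> carrier G" using subgroup.subset[OF C] .
  have actM: "group_action G (topspace (mtop M)) \<phi>" and actN: "group_action G (topspace (mtop N)) \<psi>"
    and smM: "smooth_map (prod_manifold GM M) M (\<lambda>(g, x). \<phi> g x)"
    using assms(3,5) by (auto simp: smooth_action_def)
  have aM: "group_action P (topspace (mtop M)) \<phi>" unfolding P by (rule group_action_subgroup[OF actM C])
  have aN: "group_action P (topspace (mtop N)) \<psi>" unfolding P by (rule group_action_subgroup[OF actN C])
  have LM: "L \<subseteq> topspace (mtop M)" by (auto simp: L_def level_set_def)
  have tPM: "mtop PM = subtopology (mtop GM) C" by (simp add: PM_def isotropy_manifold_def C_def)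
  have sls: "\<exists>S (Q :: ('g set, 'eg) manifold) W \<kappa> T. level_slice P M \<phi> L m S Q W \<kappa> T" if m: "m \<in> L" for m
  proof -
    obtain S \<iota> V' V \<rho> and A :: "('g, 'x, 'y) normal_form"
      where nf: "in_normal_form_at P PM M \<phi> N \<psi> f \<mu> m S \<iota> V' V \<rho> A"
        and sp: "submanifold_property P M \<phi> m S \<iota> A" and ap: "approximation_property P M \<phi> m S \<iota> A"
      using assms(11) m unfolding P_def PM_def L_def by blast
    define H where "H = stabilizer P \<phi> m"
    have mM: "m \<in> topspace (mtop M)" using m LM by blast
    have z: "\<iota> ` sing_zeros A = S \<inter> L" unfolding L_def by (rule normal_form_zeros[OF nf aM aN mM])
    have sl: "slice P PM M \<phi> m S (nfX A) (nfActX A) (nfU A) \<iota>"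
      and anf: "abstract_normal_form (isotropy_group P \<phi> m) (isotropy_manifold P PM \<phi> m) A"
      using nf by (simp_all add: in_normal_form_at_def Let_def)
    have HP: "subgroup H P" unfolding H_def by (rule group_action.stabilizer_subgroup[OF aM mM])
    have HC: "H \<subseteq> C" using subgroup.subset[OF HP] cP by simp
    have ig: "isotropy_group P \<phi> m = G\<lparr>carrier := H\<rparr>" by (simp add: isotropy_group_def P H_def)
    have tH: "mtop (isotropy_manifold P PM \<phi> m) = subtopology (mtop GM) H"
      using HC by (simp add: isotropy_manifold_def tPM H_def[symmetric] subtopology_subtopology inf.absorb2)
    have lieH: "lie_group (G\<lparr>carrier := H\<rparr>) (isotropy_manifold P PM \<phi> m)"
      "compact_space (mtop (isotropy_manifold P PM \<phi> m))"
      using anf by (simp_all add: abstract_normal_form_def ig)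
    have conj: "conjugate_set P g H = H" if "g \<in> carrier P" "conjugate_set P g H \<subseteq> H" for g
      using compact_subgroup_conjugate_eq[OF assms(1) C HP[unfolded P] lieH tH, folded P] that cP by simp
    obtain Q :: "('g set, 'eg) manifold" and W \<kappa> T where Q: "principal_bundle P PM H Q"
      "openin (mtop Q) W" "H \<in> W" "smooth_map (submanifold_of Q W) PM \<kappa>" "\<forall>w\<in>W. \<kappa> w <#\<^bsub>P\<^esub> H = w"
      "openin (mtop M) T"
      "diffeomorphism (prod_manifold (submanifold_of Q W) (submanifold_of M S)) (submanifold_of M T) (\<lambda>(w, s). \<phi> (\<kappa> w) s)"
      using sl unfolding slice_def Let_def H_def[symmetric] by (elim conjE exE) (rule that; assumption)
    \<comment> \<open>Being smooth into \<open>PM\<close> includes taking values in its underlying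
      set, the stabilizer of \<open>\<mu>\<close>.\<close>
    have \<kappa>: "\<kappa> w \<in> carrier P" if "w \<in> W" for w
    proof -
      have "continuous_map (subtopology (mtop Q) W) (mtop PM) \<kappa>" using Q(4) by (simp add: smooth_map_def)
      moreover have "w \<in> topspace (subtopology (mtop Q) W)" using that openin_subset[OF Q(2)] by auto
      ultimately have "\<kappa> w \<in> topspace (mtop PM)" by (auto simp: continuous_map_def)
      then show ?thesis by (simp add: tPM cP)
    qed
    \<comment> \<open>By \<open>normal_form_zeros\<close> the two assumptions on zeros of the
      singular part become statements about \<open>L\<close>.\<close>
    have zSH: "\<iota> ` sing_zeros A \<inter> orbit_type_subset P \<phi> S K = L \<inter> orbit_type_subset P \<phi> S K" for K
      unfolding z by (auto simp: orbit_type_subset_def)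
    have "submanifold M S" "m \<in> S" "\<forall>h\<in>H. \<phi> h ` S \<subseteq> S"
      "\<forall>g\<in>carrier P. \<phi> g ` S \<inter> S \<noteq> {} \<longrightarrow> g \<in> H"
      "closedin (subtopology (mtop M) S) (orbit_type_subset P \<phi> S H)"
      "submanifold (submanifold_of M S) (orbit_type_subset P \<phi> S H)"
      using sl by (simp_all add: slice_def Let_def H_def)
    moreover have "smooth_manifold Q" using Q(1) by (simp add: principal_bundle_def)
    moreover have "submanifold (submanifold_of (submanifold_of M S) (orbit_type_subset P \<phi> S H)) (L \<inter> orbit_type_subset P \<phi> S H)"
      using sp unfolding submanifold_property_def Let_def H_def[symmetric] zSH .
    moreover have "\<forall>K\<in>stabilizer P \<phi> ` topspace (mtop M). orbit_type_le P K H \<longrightarrow>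
        m \<in> subtopology (mtop M) S closure_of (L \<inter> orbit_type_subset P \<phi> S K)"
      using ap unfolding approximation_property_def H_def[symmetric] zSH .
    ultimately have "level_slice P M \<phi> L m S Q W \<kappa> T"
      unfolding level_slice_def Let_def H_def[symmetric] using Q \<kappa> conj by simp
    then show ?thesis by blast
  qed
  \<comment> \<open>The implication is moved under the quantifiers so that choice produces total
    functions of \<open>m\<close>, as the locale requires.\<close>
  then have "\<forall>m. \<exists>S (Q :: ('g set, 'eg) manifold) W \<kappa> T. m \<in> L \<longrightarrow> level_slice P M \<phi> L m S Q W \<kappa> T" by blast
  then obtain S and Q :: "'m \<Rightarrow> ('g set, 'eg) manifold" and W \<kappa> T
    where ls: "\<And>m. m \<in> L \<Longrightarrow> level_slice P M \<phi> L m (S m) (Q m) (W m) (\<kappa> m) (T m)"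
    by metis
  have orb: "closedin (prod_topology (mtop M) (mtop M))
      {(x, y). x \<in> topspace (mtop M) \<and> y \<in> topspace (mtop M) \<and> orbit P \<phi> x = orbit P \<phi> y}"
  proof -
    \<comment> \<open>Properness makes this map closed, and the image of the whole space is exactly
      the orbit relation.\<close>
    have "closed_map (prod_topology (mtop PM) (mtop M)) (prod_topology (mtop M) (mtop M)) (\<lambda>(g, x). (\<phi> g x, x))"
      using assms(10) by (simp add: proper_action_def proper_map_def PM_def)
    then have "closedin (prod_topology (mtop M) (mtop M))
        ((\<lambda>(g, x). (\<phi> g x, x)) ` topspace (prod_topology (mtop PM) (mtop M)))"
      unfolding closed_map_def by blast
    moreover have "topspace (prod_topology (mtop PM) (mtop M)) = carrier P \<times> topspace (mtop M)"
      using CG by (auto simp: tPM tG cP)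
    moreover have "(\<lambda>(g, x). (\<phi> g x, x)) ` (carrier P \<times> topspace (mtop M)) =
        {(x, y). x \<in> topspace (mtop M) \<and> y \<in> topspace (mtop M) \<and> orbit P \<phi> x = orbit P \<phi> y}"
    proof (intro subset_antisym subsetI)
      fix p assume "p \<in> (\<lambda>(g, x). (\<phi> g x, x)) ` (carrier P \<times> topspace (mtop M))"
      then obtain g x where gx: "g \<in> carrier P" "x \<in> topspace (mtop M)" "p = (\<phi> g x, x)" by auto
      have "\<phi> g x \<in> topspace (mtop M)" using group_action.element_image[OF aM gx(1,2) refl] .
      moreover have "orbit P \<phi> (\<phi> g x) = orbit P \<phi> x"
        using orbit_translate[OF aM gx(2,1)] by simp
      ultimately show "p \<in> {(x, y). x \<in> topspace (mtop M) \<and> y \<in> topspace (mtop M) \<and> orbit P \<phi> x = orbit P \<phi> y}"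
        using gx by simp
    next
      fix p assume "p \<in> {(x, y). x \<in> topspace (mtop M) \<and> y \<in> topspace (mtop M) \<and> orbit P \<phi> x = orbit P \<phi> y}"
      then obtain x y where xy: "p = (x, y)" "x \<in> topspace (mtop M)" "y \<in> topspace (mtop M)" "orbit P \<phi> x = orbit P \<phi> y" by auto
      have "x \<in> orbit P \<phi> y" using group_action.orbit_refl[OF aM xy(2)] xy(4) by simp
      then obtain g where "g \<in> carrier P" "x = \<phi> g y" by (auto simp: orbit_def)
      then show "p \<in> (\<lambda>(g, x). (\<phi> g x, x)) ` (carrier P \<times> topspace (mtop M))" using xy by auto
    qed
    ultimately show ?thesis by simp
  qed
  interpret level_stratification P M \<phi> L S Q W \<kappa> T
  proof (rule level_stratification.intro)
    show "smooth_map M M (\<phi> g)" if "g \<in> carrier P" for g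
      by (rule smooth_map_action[OF smG assms(2) smM]) (use that cP CG tG in auto)
    show "\<phi> g x \<in> L" if g: "g \<in> carrier P" and x: "x \<in> L" for g x
    proof -
      have xM: "x \<in> topspace (mtop M)" and fx: "f x = \<mu>" using x by (auto simp: L_def level_set_def)
      have gC: "g \<in> C" using g cP by simp
      then have "f (\<phi> g x) = \<psi> g \<mu>" using assms(7) CG xM fx by auto
      also have "\<dots> = \<mu>" using gC by (simp add: C_def stabilizer_def)
      finally show ?thesis
        using group_action.element_image[OF aM g xM refl] by (simp add: L_def level_set_def)
    qed
  qed (fact aM assms(2) LM ls orb)+
  show ?thesis
    using stratification_level stratification_quotient
    unfolding orbit_type_partition_eq[symmetric] unfolding P_def L_def by blast
qed

end
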